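(* Let $0\le \alpha<1$. Let $a\in C(\mathbf{R})$ and suppose there are constants $a_1,a_2>0$ such that $$\frac{a_1}{(1+|x|)^{\alpha}}\le a(x)\le \frac{a_2}{(1+|x|)^{\alpha}},\qquad x\in\mathbf{R}.$$ Let $V\in C^1(\mathbf{R})$ be bounded with $V(x)>0$ and $xV'(x)\le 0$ for all $x\in\mathbf{R}$. Let $R>0$ and let $[u_0,u_1]\in H^1(\mathbf{R})\times L^2(\mathbf{R})$ satisfy $\operatorname{supp}u_0\cup\operatorname{supp}u_1\subset\{x:|x|\le R\}$. Then the Cauchy problem $$u_{tt}-u_{xx}+V(x)u+a(x)u_t=0\ \ \text{in }(0,\infty)\times\mathbf{R},\qquad u(0,x)=u_0(x),\ u_t(0,x)=u_1(x),$$ has a unique weak solution $u\in C([0,\infty);H^1(\mathbf{R}))\cap C^1([0,\infty);L^2(\mathbf{R}))$, this solution satisfies $u(t,x)=0$ for $|x|>R+t$, $t\ge0$, and its total energy satisfies $$E(t)=O(t^{-2})\qquad (t\to\infty).$$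
   Context: All functions are real-valued. The total energy of $u$ is $E(t)=\frac12\big(\|u_t(t,\cdot)\|^2+\|u_x(t,\cdot)\|^2+\|\sqrt{V}\,u(t,\cdot)\|^2\big)$, where $\|\cdot\|$ denotes the $L^2(\mathbf{R})$ norm. *)

theory Defs
  imports "HOL-Analysis.Analysis" "HOL-Library.Landau_Symbols"
begin

definition L2 :: "(real \<Rightarrow> real) \<Rightarrow> bool" where
  "L2 f \<longleftrightarrow> f \<in> borel_measurable lborel \<and> integrable lborel (\<lambda>x. (f x)\<^sup>2)"

definition L2norm :: "(real \<Rightarrow> real) \<Rightarrow> real" where
  "L2norm f = sqrt (LINT x|lborel. (f x)\<^sup>2)"

definition test_fun :: "(real \<Rightarrow> real) \<Rightarrow> bool" where
  "test_fun \<phi> \<longleftrightarrow> (\<forall>n x. ((deriv ^^ n) \<phi>) differentiable (at x))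
                   \<and> (\<exists>r. \<forall>x. \<bar>x\<bar> > r \<longrightarrow> \<phi> x = 0)"

definition weak_deriv :: "(real \<Rightarrow> real) \<Rightarrow> (real \<Rightarrow> real) \<Rightarrow> bool" where
  "weak_deriv f g \<longleftrightarrow> (\<forall>\<phi>. test_fun \<phi> \<longrightarrow>
      (LINT x|lborel. f x * deriv \<phi> x) = - (LINT x|lborel. g x * \<phi> x))"

definition H1 :: "(real \<Rightarrow> real) \<Rightarrow> bool" where
  "H1 f \<longleftrightarrow> L2 f \<and> (\<exists>g. L2 g \<and> weak_deriv f g)"

definition wderiv :: "(real \<Rightarrow> real) \<Rightarrow> (real \<Rightarrow> real)" where
  "wderiv f = (SOME g. L2 g \<and> weak_deriv f g)"

definition H1norm :: "(real \<Rightarrow> real) \<Rightarrow> real" where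
  "H1norm f = sqrt ((L2norm f)\<^sup>2 + (L2norm (wderiv f))\<^sup>2)"

definition C_H1 :: "(real \<Rightarrow> real \<Rightarrow> real) \<Rightarrow> bool" where
  "C_H1 u \<longleftrightarrow> (\<forall>t\<ge>0. H1 (u t)) \<and>
     (\<forall>t\<ge>0. ((\<lambda>s. H1norm (\<lambda>x. u s x - u t x)) \<longlongrightarrow> 0) (at t within {0..}))"

definition C1_L2_with :: "(real \<Rightarrow> real \<Rightarrow> real) \<Rightarrow> (real \<Rightarrow> real \<Rightarrow> real) \<Rightarrow> bool" where
  "C1_L2_with u v \<longleftrightarrow> (\<forall>t\<ge>0. L2 (u t) \<and> L2 (v t)) \<and>
     (\<forall>t\<ge>0. ((\<lambda>s. L2norm (\<lambda>x. v s x - v t x)) \<longlongrightarrow> 0) (at t within {0..})) \<and>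
     (\<forall>t\<ge>0. ((\<lambda>s. L2norm (\<lambda>x. (u s x - u t x) / (s - t) - v t x)) \<longlongrightarrow> 0)
               (at t within {0..}))"

definition weak_solution ::
  "(real \<Rightarrow> real) \<Rightarrow> (real \<Rightarrow> real) \<Rightarrow> (real \<Rightarrow> real) \<Rightarrow> (real \<Rightarrow> real) \<Rightarrow>
   (real \<Rightarrow> real \<Rightarrow> real) \<Rightarrow> (real \<Rightarrow> real \<Rightarrow> real) \<Rightarrow> bool" where
  "weak_solution a V u0 u1 u v \<longleftrightarrow>
     C_H1 u \<and> C1_L2_with u v \<and>
     (AE x in lborel. u 0 x = u0 x) \<and> (AE x in lborel. v 0 x = u1 x) \<and>
     (\<forall>\<phi>. test_fun \<phi> \<longrightarrow> (\<forall>t>0.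
        ((\<lambda>s. LINT x|lborel. v s x * \<phi> x) has_real_derivative
           (- (LINT x|lborel. wderiv (u t) x * deriv \<phi> x)
            - (LINT x|lborel. V x * u t x * \<phi> x)
            - (LINT x|lborel. a x * v t x * \<phi> x))) (at t)))"

definition energy ::
  "(real \<Rightarrow> real) \<Rightarrow> (real \<Rightarrow> real \<Rightarrow> real) \<Rightarrow> (real \<Rightarrow> real \<Rightarrow> real) \<Rightarrow> real \<Rightarrow> real" where
  "energy V u v t = (1/2) * ((L2norm (v t))\<^sup>2 + (L2norm (wderiv (u t)))\<^sup>2
                             + (L2norm (\<lambda>x. sqrt (V x) * u t x))\<^sup>2)"

end

(* In the Riemann invariants p = u_t + u_x and q = u_t - u_x the equation is a pair of transport
   equations with the bounded source -V u - a u_t. Pulled back along the characteristics it becomes a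
   linear ODE in L^2 x L^2 x L^2 with bounded coefficients; this gives existence, finite speed of
   propagation and, since weak solutions satisfy the same ODE, uniqueness by the energy identity.

   For the decay, let U be the time integral of u. It solves the wave equation with the source
   g = u_1 + a u_0, and testing this with u = U_t gives
     |u|^2/2 + |U_x|^2/2 + (V U, U)/2 + (integral of (a u, u) over [0, t]) = |u_0|^2/2 + (g, U).
   As V has a positive minimum on the compact support of g, the term (g, U) is absorbed by (V U, U)/2,
   so (a u, u) is integrable in time. With tau = 1 + R + t and the energy E, the functional
   H = tau^2 E + tau ((u_t, u) + (a u, u)/2) satisfies H' <= (a u, u) and H >= tau^2 E / 2 for large t,
   because a >= a_1 tau^(-alpha) on the support of u and alpha < 1. *)

theory Submission
  imports Defs "HOL-Computational_Algebra.Polynomial"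
begin

section \<open>The Hilbert space of square integrable functions\<close>

text \<open>A weak solution offers only u_t and u_x as elements of L^2, so p and q need not be
  differentiable in time, and u_t is not admissible as a test function. Undoing the translation
  along the characteristics removes the unbounded operator: \<open>shift (- t) (p t)\<close> and
  \<open>shift t (q t)\<close> are continuously differentiable in norm. As shifts are isometries,
  the energy identity is then an exact product rule, without mollification. This is why the classes
  of L^2 functions are made a Banach space type, on which vector calculus and the fixed point
  theorem act. The rate t^(-2) has two sources. In the derivative of H the terms 2 tau E cancel and
  leave 2 tau |u_t|^2, which the damping tau^2 (a u_t, u_t) dominates, since tau bounds 1 + |x| on
  the support and tau^(1 - alpha) tends to infinity. The term (a u, u) that remains in H' is not
  controlled by the decay of E; only its integrability in time is required. The identity for U
  supplies this because U lies one time derivative below u, so that (a u, u) is its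
  dissipation.\<close>

lemma L2_borel: "L2 f \<Longrightarrow> f \<in> borel_measurable borel"
  by (simp add: L2_def)

lemma L2_sq: "L2 f \<Longrightarrow> integrable lborel (\<lambda>x. (f x)\<^sup>2)"
  by (simp add: L2_def)

lemma L2_mult_integrable:
  assumes "L2 f" "L2 g"
  shows "integrable lborel (\<lambda>x. f x * g x)"
proof (rule Bochner_Integration.integrable_bound)
  show "integrable lborel (\<lambda>x. (f x)\<^sup>2 + (g x)\<^sup>2)"
    using assms by (intro Bochner_Integration.integrable_add L2_sq)
  show "(\<lambda>x. f x * g x) \<in> borel_measurable lborel"
    using assms by (auto simp: L2_def)
  have "\<bar>f x * g x\<bar> \<le> (f x)\<^sup>2 + (g x)\<^sup>2" for x
  proof -
    have "2 * (\<bar>f x\<bar> * \<bar>g x\<bar>) \<le> \<bar>f x\<bar>\<^sup>2 + \<bar>g x\<bar>\<^sup>2"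
      using sum_squares_bound[of "\<bar>f x\<bar>" "\<bar>g x\<bar>"] by (simp add: mult_ac)
    moreover have "0 \<le> \<bar>f x\<bar> * \<bar>g x\<bar>" by simp
    ultimately show ?thesis unfolding abs_mult power2_abs by linarith
  qed
  then show "AE x in lborel. norm (f x * g x) \<le> norm ((f x)\<^sup>2 + (g x)\<^sup>2)"
    by simp
qed

lemma L2_zero: "L2 (\<lambda>x. 0)"
  by (simp add: L2_def)

lemma L2_add:
  assumes "L2 f" "L2 g"
  shows "L2 (\<lambda>x. f x + g x)"
proof -
  have "integrable lborel (\<lambda>x. (f x)\<^sup>2 + (g x)\<^sup>2 + 2 * (f x * g x))"
    using assms by (intro Bochner_Integration.integrable_add L2_sq L2_mult_integrable integrable_mult_right) auto
  moreover have "(\<lambda>x. (f x)\<^sup>2 + (g x)\<^sup>2 + 2 * (f x * g x)) = (\<lambda>x. (f x + g x)\<^sup>2)"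
    by (auto simp: power2_sum fun_eq_iff)
  ultimately show ?thesis using assms by (auto simp: L2_def)
qed

lemma L2_scale:
  assumes "L2 f"
  shows "L2 (\<lambda>x. c * f x)"
  using assms by (auto simp: L2_def power_mult_distrib)

lemma L2_uminus:
  assumes "L2 f"
  shows "L2 (\<lambda>x. - f x)"
  using assms by (auto simp: L2_def)

lemma L2_diff:
  assumes "L2 f" "L2 g"
  shows "L2 (\<lambda>x. f x - g x)"
  using L2_add[OF assms(1) L2_uminus[OF assms(2)]] by simp

lemma L2_dominated:
  assumes "L2 g" "f \<in> borel_measurable borel" "AE x in lborel. \<bar>f x\<bar> \<le> c * \<bar>g x\<bar>"
  shows "L2 f"
proof -
  have "integrable lborel (\<lambda>x. (f x)\<^sup>2)"
  proof (rule Bochner_Integration.integrable_bound)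
    show "integrable lborel (\<lambda>x. c\<^sup>2 * (g x)\<^sup>2)"
      using assms by (auto simp: L2_def)
    show "(\<lambda>x. (f x)\<^sup>2) \<in> borel_measurable lborel" using assms by auto
    show "AE x in lborel. norm ((f x)\<^sup>2) \<le> norm (c\<^sup>2 * (g x)\<^sup>2)"
      using assms(3)
    proof eventually_elim
      case (elim x)
      then have "\<bar>f x\<bar>\<^sup>2 \<le> (c * \<bar>g x\<bar>)\<^sup>2" by (intro power_mono) auto
      then show ?case by (simp add: power_mult_distrib)
    qed
  qed
  with assms show ?thesis by (auto simp: L2_def)
qed

\<comment> \<open>The type of classes makes the calculus of Hilbert and Banach spaces available. The
  relation is partial: a function outside L^2 has no class. \<open>rep_lsq\<close> returns some
  representative, which is known almost everywhere only.\<close>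
quotient_type lsq = "real \<Rightarrow> real" / partial:
  "\<lambda>f g. L2 f \<and> L2 g \<and> (AE x in lborel. f x = g x)"
proof (rule part_equivpI)
  show "\<exists>f. L2 f \<and> L2 f \<and> (AE x in lborel. f x = f x)"
    using L2_zero by auto
  show "symp (\<lambda>f g. L2 f \<and> L2 g \<and> (AE x in lborel. f x = g x))"
    by (auto simp: symp_def elim: AE_mp)
  show "transp (\<lambda>f g. L2 f \<and> L2 g \<and> (AE x in lborel. f x = g x))"
  proof (rule transpI)
    fix f g h :: "real \<Rightarrow> real"
    assume 1: "L2 f \<and> L2 g \<and> (AE x in lborel. f x = g x)" and 2: "L2 g \<and> L2 h \<and> (AE x in lborel. g x = h x)"
    then have "AE x in lborel. f x = g x" "AE x in lborel. g x = h x" by auto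
    then have "AE x in lborel. f x = h x" by eventually_elim simp
    with 1 2 show "L2 f \<and> L2 h \<and> (AE x in lborel. f x = h x)" by auto
  qed
qed

lemma integral_cong_L2:
  assumes "L2 f" "L2 g" "L2 f'" "L2 g'" "AE x in lborel. f x = f' x" "AE x in lborel. g x = g' x"
  shows "(LINT x|lborel. f x * g x) = (LINT x|lborel. f' x * g' x)"
proof (rule integral_cong_AE)
  show "AE x in lborel. f x * g x = f' x * g' x"
    using assms(5,6) by eventually_elim simp
qed (use assms in \<open>auto simp: L2_def\<close>)

lemma L2_inner_eq_0:
  assumes "L2 f"
  shows "(LINT x|lborel. f x * f x) = 0 \<longleftrightarrow> (AE x in lborel. f x = 0)"
  using assms integral_nonneg_eq_0_iff_AE[of lborel "\<lambda>x. f x * f x"]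
  by (simp add: L2_def power2_eq_square)

instantiation lsq :: real_inner
begin

lift_definition zero_lsq :: lsq is "\<lambda>x. 0" by (auto simp: L2_zero)

lift_definition plus_lsq :: "lsq \<Rightarrow> lsq \<Rightarrow> lsq" is "\<lambda>f g x. f x + g x"
  by (auto simp: L2_add)

lift_definition uminus_lsq :: "lsq \<Rightarrow> lsq" is "\<lambda>f x. - f x"
  by (auto simp: L2_uminus)

lift_definition minus_lsq :: "lsq \<Rightarrow> lsq \<Rightarrow> lsq" is "\<lambda>f g x. f x - g x"
  by (auto simp: L2_diff)

lift_definition scaleR_lsq :: "real \<Rightarrow> lsq \<Rightarrow> lsq" is "\<lambda>c f x. c * f x"
  by (auto simp: L2_scale)

lift_definition inner_lsq :: "lsq \<Rightarrow> lsq \<Rightarrow> real" is "\<lambda>f g. LINT x|lborel. f x * g x"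
  by (rule integral_cong_L2) auto

definition norm_lsq :: "lsq \<Rightarrow> real" where "norm_lsq f = sqrt (inner f f)"
definition sgn_lsq :: "lsq \<Rightarrow> lsq" where "sgn_lsq f = scaleR (inverse (norm f)) f"
definition dist_lsq :: "lsq \<Rightarrow> lsq \<Rightarrow> real" where "dist_lsq f g = norm (f - g)"
definition uniformity_lsq :: "(lsq \<times> lsq) filter" where
  "uniformity_lsq = (INF e\<in>{0<..}. principal {(x, y). dist x y < e})"
definition open_lsq :: "lsq set \<Rightarrow> bool" where
  "open_lsq U \<longleftrightarrow> (\<forall>x\<in>U. eventually (\<lambda>(x', y). x' = x \<longrightarrow> y \<in> U) uniformity)"

instance
proof
  fix f g h :: lsq and a b :: real
  show "f + g + h = f + (g + h)" "f + g = g + f" "0 + f = f" "- f + f = 0" "f - g = f + - g"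
    by (transfer; auto simp: L2_add L2_zero L2_uminus L2_diff algebra_simps)+
  show "a *\<^sub>R (f + g) = a *\<^sub>R f + a *\<^sub>R g" "(a + b) *\<^sub>R f = a *\<^sub>R f + b *\<^sub>R f"
    "a *\<^sub>R b *\<^sub>R f = (a * b) *\<^sub>R f" "1 *\<^sub>R f = f"
    by (transfer; auto simp: L2_add L2_scale algebra_simps)+
  show "inner f g = inner g f" by transfer (simp add: mult.commute)
  show "inner (f + g) h = inner f h + inner g h"
    by transfer (simp add: algebra_simps L2_mult_integrable)
  show "inner (a *\<^sub>R f) g = a * inner f g"
    by transfer (simp add: algebra_simps)
  show "0 \<le> inner f f" by transfer (simp add: integral_nonneg_AE)
  show "(inner f f = 0) = (f = 0)"
    by transfer (auto simp: L2_zero L2_inner_eq_0)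
qed (simp_all add: norm_lsq_def sgn_lsq_def dist_lsq_def uniformity_lsq_def open_lsq_def)

end

lemma L2_rep_lsq[simp]: "L2 (rep_lsq f)"
  using Quotient_rep_reflp[OF Quotient_lsq, of f] by auto

lemma abs_lsq_rep[simp]: "abs_lsq (rep_lsq f) = f"
  using Quotient_abs_rep[OF Quotient_lsq] .

lemma abs_lsq_eq_iff: "L2 f \<Longrightarrow> L2 g \<Longrightarrow> abs_lsq f = abs_lsq g \<longleftrightarrow> (AE x in lborel. f x = g x)"
  using Quotient_rel[OF Quotient_lsq, of f g] by auto

lemma rep_lsq_abs: "L2 f \<Longrightarrow> AE x in lborel. rep_lsq (abs_lsq f) x = f x"
  by (subst abs_lsq_eq_iff[symmetric]) auto

lemma lsq_eqI: "AE x in lborel. rep_lsq f x = rep_lsq g x \<Longrightarrow> f = g"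
  by (metis L2_rep_lsq abs_lsq_eq_iff abs_lsq_rep)

lemma rep_lsq_measurable[measurable]: "rep_lsq f \<in> borel_measurable borel"
  using L2_rep_lsq[of f] by (simp add: L2_def)

lemma abs_lsq_add: "L2 f \<Longrightarrow> L2 g \<Longrightarrow> abs_lsq (\<lambda>x. f x + g x) = abs_lsq f + abs_lsq g"
  by (simp add: plus_lsq.abs_eq)

lemma abs_lsq_diff: "L2 f \<Longrightarrow> L2 g \<Longrightarrow> abs_lsq (\<lambda>x. f x - g x) = abs_lsq f - abs_lsq g"
  by (simp add: minus_lsq.abs_eq)

lemma abs_lsq_scale: "L2 f \<Longrightarrow> abs_lsq (\<lambda>x. c * f x) = c *\<^sub>R abs_lsq f"
  by (simp add: scaleR_lsq.abs_eq)

lemma abs_lsq_zero: "abs_lsq (\<lambda>x. 0) = 0"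
  by (simp add: zero_lsq_def)

lemma rep_lsq_add: "AE x in lborel. rep_lsq (f + g) x = rep_lsq f x + rep_lsq g x"
  using rep_lsq_abs[OF L2_add[OF L2_rep_lsq L2_rep_lsq], of f g] by (simp add: abs_lsq_add)

lemma rep_lsq_diff: "AE x in lborel. rep_lsq (f - g) x = rep_lsq f x - rep_lsq g x"
  using rep_lsq_abs[OF L2_diff[OF L2_rep_lsq L2_rep_lsq], of f g] by (simp add: abs_lsq_diff)

lemma rep_lsq_scaleR: "AE x in lborel. rep_lsq (c *\<^sub>R f) x = c * rep_lsq f x"
  using rep_lsq_abs[OF L2_scale[OF L2_rep_lsq], of c f] by (simp add: abs_lsq_scale)

lemma inner_abs_lsq: "L2 f \<Longrightarrow> L2 g \<Longrightarrow> inner (abs_lsq f) (abs_lsq g) = (LINT x|lborel. f x * g x)"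
  by (simp add: inner_lsq.abs_eq)

lemma inner_rep_lsq: "inner f g = (LINT x|lborel. rep_lsq f x * rep_lsq g x)"
  by (metis L2_rep_lsq abs_lsq_rep inner_abs_lsq)

lemma norm_abs_lsq: "L2 f \<Longrightarrow> norm (abs_lsq f) = L2norm f"
  by (simp add: norm_lsq_def inner_abs_lsq L2norm_def power2_eq_square)

lemma norm_rep_lsq: "norm f = L2norm (rep_lsq f)"
  by (metis L2_rep_lsq abs_lsq_rep norm_abs_lsq)

section \<open>Completeness of L^2\<close>

lemma norm_sq_nn_integral:
  assumes "L2 f"
  shows "ennreal ((norm (abs_lsq f))\<^sup>2) = (\<integral>\<^sup>+x. ennreal ((f x)\<^sup>2) \<partial>lborel)"
  using assms nn_integral_eq_integral[OF L2_sq[OF assms]]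
  by (simp only: power2_norm_eq_inner inner_abs_lsq) (simp add: power2_eq_square)

text \<open>Passes from summable weighted squares to absolute summability: with
  \<open>c = 2^n\<close> the first term on the right is a geometric series in
  \<open>n\<close>.\<close>

lemma abs_le_weighted_square:
  fixes d :: real
  assumes "0 < c"
  shows "\<bar>d\<bar> \<le> inverse c / 2 + c * d\<^sup>2 / 2"
proof -
  have "0 \<le> (c * \<bar>d\<bar> - 1)\<^sup>2" by simp
  then have "2 * c * \<bar>d\<bar> \<le> c\<^sup>2 * d\<^sup>2 + 1"
    by (simp add: power2_eq_square algebra_simps)
  then have "c * (2 * \<bar>d\<bar>) \<le> c * (inverse c + c * d\<^sup>2)"
    using assms by (simp add: algebra_simps power2_eq_square)
  then show ?thesis using assms by (simp add: mult_le_cancel_left_pos)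
qed

text \<open>Fatou's lemma for the squares yields membership in L^2 and the norm bound at once,
  before any norm convergence is known.\<close>

lemma Fatou_L2:
  assumes f: "\<And>m. L2 (f m)" and g: "g \<in> borel_measurable borel"
    and lim: "AE x in lborel. (\<lambda>m. f m x) \<longlonglongrightarrow> g x"
    and bd: "eventually (\<lambda>m. norm (abs_lsq (f m)) \<le> c) sequentially"
  shows "L2 g \<and> norm (abs_lsq g) \<le> c"
proof -
  have c: "0 \<le> c" using bd norm_ge_zero by (metis (mono_tags, lifting) eventually_sequentially order.trans order_refl)
  have fm[measurable]: "f m \<in> borel_measurable borel" for m using f by (rule L2_borel)
  note g[measurable]
  have "(\<integral>\<^sup>+x. ennreal ((g x)\<^sup>2) \<partial>lborel) = (\<integral>\<^sup>+x. liminf (\<lambda>m. ennreal ((f m x)\<^sup>2)) \<partial>lborel)"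
  proof (rule nn_integral_cong_AE)
    show "AE x in lborel. ennreal ((g x)\<^sup>2) = liminf (\<lambda>m. ennreal ((f m x)\<^sup>2))"
      using lim
    proof eventually_elim
      case (elim x)
      then have "(\<lambda>m. ennreal ((f m x)\<^sup>2)) \<longlonglongrightarrow> ennreal ((g x)\<^sup>2)"
        by (intro tendsto_ennrealI tendsto_power)
      then show ?case by (intro lim_imp_Liminf[symmetric]) auto
    qed
  qed
  also have "\<dots> \<le> liminf (\<lambda>m. \<integral>\<^sup>+x. ennreal ((f m x)\<^sup>2) \<partial>lborel)"
    by (rule nn_integral_liminf) auto
  also have "\<dots> = liminf (\<lambda>m. ennreal ((norm (abs_lsq (f m)))\<^sup>2))"
    using f by (simp add: norm_sq_nn_integral)
  also have "\<dots> \<le> liminf (\<lambda>m. ennreal (c\<^sup>2))"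
    using bd by (intro Liminf_mono) (auto elim!: eventually_mono intro!: ennreal_leI power_mono)
  also have "\<dots> = ennreal (c\<^sup>2)" by (simp add: lim_imp_Liminf)
  finally have le: "(\<integral>\<^sup>+x. ennreal ((g x)\<^sup>2) \<partial>lborel) \<le> ennreal (c\<^sup>2)" .
  then have "(\<integral>\<^sup>+x. ennreal ((g x)\<^sup>2) \<partial>lborel) < \<infinity>" 
    by (simp add: le_less_trans)
  then have L2: "L2 g"
    unfolding L2_def by (auto simp: integrable_iff_bounded)
  have "ennreal ((norm (abs_lsq g))\<^sup>2) \<le> ennreal (c\<^sup>2)"
    using le norm_sq_nn_integral[OF L2] by simp
  then have "(norm (abs_lsq g))\<^sup>2 \<le> c\<^sup>2" by simp
  with L2 c show ?thesis by (simp add: power2_le_iff_abs_le)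
qed

text \<open>The squares of \<open>d n\<close>, weighted by \<open>2^n\<close>, have integrals
  bounded by a geometric series, so their sum is finite almost everywhere; the weights then give
  absolute convergence of the unsquared series.\<close>

lemma summable_AE_L2:
  fixes d :: "nat \<Rightarrow> lsq"
  assumes d: "\<And>n. norm (d n) \<le> (1/4)^n"
  shows "AE x in lborel. summable (\<lambda>n. rep_lsq (d n) x)"
proof -
  have "(\<integral>\<^sup>+x. (\<Sum>n. ennreal (2^n * (rep_lsq (d n) x)\<^sup>2)) \<partial>lborel)
      = (\<Sum>n. \<integral>\<^sup>+x. ennreal (2^n * (rep_lsq (d n) x)\<^sup>2) \<partial>lborel)"
    by (rule nn_integral_suminf) auto
  also have "\<dots> = (\<Sum>n. ennreal (2^n * (norm (d n))\<^sup>2))"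
  proof (rule suminf_cong)
    fix n
    have "(\<integral>\<^sup>+x. ennreal (2^n * (rep_lsq (d n) x)\<^sup>2) \<partial>lborel)
        = (\<integral>\<^sup>+x. ennreal (2^n) * ennreal ((rep_lsq (d n) x)\<^sup>2) \<partial>lborel)"
      by (simp add: ennreal_mult)
    also have "\<dots> = ennreal (2^n) * (\<integral>\<^sup>+x. ennreal ((rep_lsq (d n) x)\<^sup>2) \<partial>lborel)"
      by (rule nn_integral_cmult) auto
    also have "\<dots> = ennreal (2^n * (norm (d n))\<^sup>2)"
      using norm_sq_nn_integral[OF L2_rep_lsq, of "d n"] by (simp add: ennreal_mult)
    finally show "(\<integral>\<^sup>+x. ennreal (2^n * (rep_lsq (d n) x)\<^sup>2) \<partial>lborel) = ennreal (2^n * (norm (d n))\<^sup>2)" .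
  qed
  also have "\<dots> \<le> (\<Sum>n. ennreal ((1/2)^n))"
  proof (intro suminf_le ennreal_leI summableI)
    fix n
    have "2^n * (norm (d n))\<^sup>2 \<le> 2^n * ((1/4)^n)\<^sup>2"
      using d[of n] by (intro mult_left_mono power_mono) auto
    also have "\<dots> = (1/8)^n"
      by (simp add: power2_eq_square flip: power_mult_distrib)
    also have "\<dots> \<le> (1/2)^n" by (intro power_mono) auto
    finally show "2^n * (norm (d n))\<^sup>2 \<le> (1/2)^n" .
  qed
  also have "\<dots> < \<infinity>"
    by (subst suminf_ennreal2) (auto intro!: summable_geometric)
  finally have "AE x in lborel. (\<Sum>n. ennreal (2^n * (rep_lsq (d n) x)\<^sup>2)) \<noteq> \<infinity>"
    by (intro nn_integral_PInf_AE) auto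
  then show ?thesis
  proof eventually_elim
    case (elim x)
    have s: "summable (\<lambda>n. 2^n * (rep_lsq (d n) x)\<^sup>2)"
      using elim by (intro summable_suminf_not_top) (auto simp: top_ennreal_def)
    have "summable (\<lambda>n. inverse (2^n) / 2 + 2^n * (rep_lsq (d n) x)\<^sup>2 / 2)"
      using s summable_geometric[of "1/2::real"]
      by (intro summable_add summable_divide) (auto simp: power_one_over inverse_eq_divide)
    then show ?case
      by (rule summable_comparison_test'[where N=0]) (auto intro!: abs_le_weighted_square)
  qed
qed

lemma Cauchy_fast_subseq:
  fixes X :: "nat \<Rightarrow> 'a :: real_normed_vector"
  assumes "Cauchy X"
  shows "\<exists>r. strict_mono r \<and> (\<forall>n. \<forall>m\<ge>n. norm (X (r m) - X (r n)) \<le> (1/4)^n)"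
proof -
  have "\<exists>N. \<forall>m\<ge>N. \<forall>k\<ge>N. norm (X m - X k) < (1/4)^n" for n :: nat
    using CauchyD[OF assms, of "(1/4)^n"] by auto
  then obtain N where N: "\<And>n m k. m \<ge> N n \<Longrightarrow> k \<ge> N n \<Longrightarrow> norm (X m - X k) < (1/4)^n"
    by metis
  \<comment> \<open>\<open>Suc k\<close> makes the indices strictly increasing,
    \<open>N (Suc n)\<close> puts each of them into the tail that its own exponent requires.\<close>
  define r where "r = rec_nat (N 0) (\<lambda>n k. max (Suc k) (N (Suc n)))"
  have r: "r (Suc n) = max (Suc (r n)) (N (Suc n))" for n by (simp add: r_def)
  have sm: "strict_mono r" by (auto simp: strict_mono_Suc_iff r)
  have rN: "r n \<ge> N n" for n by (cases n) (auto simp: r, simp add: r_def)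
  have "norm (X (r m) - X (r n)) \<le> (1/4)^n" if "m \<ge> n" for m n
  proof -
    have "r m \<ge> r n" using sm that by (simp add: strict_mono_less_eq)
    then have "r m \<ge> N n" using rN[of n] by simp
    then show ?thesis using N[of n "r m" "r n"] rN[of n] by auto
  qed
  with sm show ?thesis by auto
qed

text \<open>Riesz-Fischer: a fast subsequence converges almost everywhere by telescoping, and
  \<open>Fatou_L2\<close> applied to differences gives both the membership of the limit in L^2 and
  the rate \<open>(1/4)^n\<close> in norm.\<close>

instance lsq :: banach
proof
  fix X :: "nat \<Rightarrow> lsq" assume C: "Cauchy X"
  from Cauchy_fast_subseq[OF C] obtain r where r: "strict_mono r"
    and fast: "\<And>n m. m \<ge> n \<Longrightarrow> norm (X (r m) - X (r n)) \<le> (1/4)^n" by auto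
  define d where "d n = X (r (Suc n)) - X (r n)" for n
  \<comment> \<open>\<open>lim\<close> is total, so \<open>g\<close> is a measurable function on the
    whole line; the sequence diverges at most on a null set.\<close>
  define g where "g x = lim (\<lambda>n. rep_lsq (X (r n)) x)" for x
  have g[measurable]: "g \<in> borel_measurable borel" unfolding g_def by measurable
  have "AE x in lborel. summable (\<lambda>n. rep_lsq (d n) x)"
    using fast[of _ "Suc _"] by (intro summable_AE_L2) (simp add: d_def)
  moreover have "AE x in lborel. \<forall>n. rep_lsq (d n) x = rep_lsq (X (r (Suc n))) x - rep_lsq (X (r n)) x"
    by (subst AE_all_countable) (auto simp: d_def rep_lsq_diff)
  ultimately have conv: "AE x in lborel. (\<lambda>n. rep_lsq (X (r n)) x) \<longlonglongrightarrow> g x"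
  proof eventually_elim
    case (elim x)
    then have "summable (\<lambda>n. rep_lsq (X (r (Suc n))) x - rep_lsq (X (r n)) x)" by simp
    then have "convergent (\<lambda>n. \<Sum>i<n. rep_lsq (X (r (Suc i))) x - rep_lsq (X (r i)) x)"
      by (simp add: summable_iff_convergent)
    then have "convergent (\<lambda>n. rep_lsq (X (r n)) x - rep_lsq (X (r 0)) x)"
      by (simp only: sum_lessThan_telescope[of "\<lambda>i. rep_lsq (X (r i)) x"])
    then have "convergent (\<lambda>n. rep_lsq (X (r n)) x)"
      by (subst (asm) convergent_diff_const_right_iff)
    then show ?case unfolding g_def by (simp add: convergent_LIMSEQ_iff)
  qed
  have *: "L2 (\<lambda>x. g x - rep_lsq (X (r n)) x) \<and> norm (abs_lsq (\<lambda>x. g x - rep_lsq (X (r n)) x)) \<le> (1/4)^n" for n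
  proof (rule Fatou_L2)
    show "L2 (\<lambda>x. rep_lsq (X (r m)) x - rep_lsq (X (r n)) x)" for m
      by (intro L2_diff L2_rep_lsq)
    show "AE x in lborel. (\<lambda>m. rep_lsq (X (r m)) x - rep_lsq (X (r n)) x) \<longlonglongrightarrow> g x - rep_lsq (X (r n)) x"
      using conv by eventually_elim (intro tendsto_intros)
    show "eventually (\<lambda>m. norm (abs_lsq (\<lambda>x. rep_lsq (X (r m)) x - rep_lsq (X (r n)) x)) \<le> (1/4)^n) sequentially"
      using eventually_ge_at_top[of n] by eventually_elim (simp add: abs_lsq_diff fast)
  qed auto
  have L2g: "L2 g"
    using L2_add[OF conjunct1[OF *[of 0]] L2_rep_lsq[of "X (r 0)"]] by simp
  have "norm (X (r n) - abs_lsq g) \<le> (1/4)^n" for n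
    using *[of n] by (simp add: abs_lsq_diff L2g norm_minus_commute)
  then have "(\<lambda>n. X (r n) - abs_lsq g) \<longlonglongrightarrow> 0"
    by (intro Lim_null_comparison[OF always_eventually LIMSEQ_power_zero[of "1/4::real"]]) auto
  then have "(X \<circ> r) \<longlonglongrightarrow> abs_lsq g" by (simp add: LIM_zero_iff o_def)
  with Cauchy_converges_subseq[OF C r] show "convergent X" by (auto simp: convergent_def)
qed

section \<open>Multiplication and translation operators\<close>

definition bmeas :: "(real \<Rightarrow> real) \<Rightarrow> bool" where
  "bmeas m \<longleftrightarrow> m \<in> borel_measurable borel \<and> bounded (range m)"

definition multop :: "(real \<Rightarrow> real) \<Rightarrow> lsq \<Rightarrow> lsq" where
  "multop m f = abs_lsq (\<lambda>x. m x * rep_lsq f x)"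

definition shift :: "real \<Rightarrow> lsq \<Rightarrow> lsq" where
  "shift s f = abs_lsq (\<lambda>x. rep_lsq f (x + s))"

lemma bmeas_bound: "bmeas m \<Longrightarrow> \<exists>B>0. \<forall>x. \<bar>m x\<bar> \<le> B"
  unfolding bmeas_def by (metis bounded_pos rangeI real_norm_def)

lemma bmeasI: "m \<in> borel_measurable borel \<Longrightarrow> (\<And>x. \<bar>m x\<bar> \<le> B) \<Longrightarrow> bmeas m"
  unfolding bmeas_def by (auto simp: bounded_iff)

lemma L2_bmeas_mult: 
  assumes "bmeas m" "L2 f"
  shows "L2 (\<lambda>x. m x * f x)"
proof -
  obtain B where B: "B > 0" "\<And>x. \<bar>m x\<bar> \<le> B" using bmeas_bound[OF assms(1)] by auto
  show ?thesis
    by (rule L2_dominated[OF assms(2), where c=B])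
       (use assms B in \<open>auto simp: L2_def bmeas_def abs_mult intro!: mult_right_mono\<close>)
qed

lemma rep_lsq_multop: "bmeas m \<Longrightarrow> AE x in lborel. rep_lsq (multop m f) x = m x * rep_lsq f x"
  unfolding multop_def by (intro rep_lsq_abs L2_bmeas_mult) auto

lemma multop_abs_lsq:
  assumes "bmeas m" "L2 f"
  shows "multop m (abs_lsq f) = abs_lsq (\<lambda>x. m x * f x)"
  unfolding multop_def
proof (subst abs_lsq_eq_iff)
  show "AE x in lborel. m x * rep_lsq (abs_lsq f) x = m x * f x"
    using rep_lsq_abs[OF assms(2)] by eventually_elim simp
qed (use assms in \<open>auto intro: L2_bmeas_mult\<close>)

lemma norm_le_pointwise:
  assumes "AE x in lborel. \<bar>rep_lsq f x\<bar> \<le> B * \<bar>rep_lsq g x\<bar>" "B \<ge> 0"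
  shows "norm f \<le> B * norm g"
proof -
  have "(norm f)\<^sup>2 = (LINT x|lborel. (rep_lsq f x)\<^sup>2)"
    by (simp only: power2_norm_eq_inner inner_rep_lsq) (simp add: power2_eq_square)
  also have "\<dots> \<le> (LINT x|lborel. B\<^sup>2 * (rep_lsq g x)\<^sup>2)"
  proof (rule integral_mono_AE)
    show "AE x in lborel. (rep_lsq f x)\<^sup>2 \<le> B\<^sup>2 * (rep_lsq g x)\<^sup>2"
      using assms(1)
    proof eventually_elim
      case (elim x)
      then have "\<bar>rep_lsq f x\<bar>\<^sup>2 \<le> (B * \<bar>rep_lsq g x\<bar>)\<^sup>2" by (intro power_mono) auto
      then show ?case by (simp add: power_mult_distrib)
    qed
  qed (auto intro: L2_sq)
  also have "\<dots> = (B * norm g)\<^sup>2"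
    by (simp only: power2_norm_eq_inner inner_rep_lsq power_mult_distrib integral_mult_right_zero)
       (simp add: power2_eq_square)
  finally show ?thesis using assms(2) by (simp add: power2_le_iff_abs_le)
qed

lemma bounded_linear_mult:
  assumes "bmeas m"
  shows "bounded_linear (multop m)"
proof -
  obtain B where B: "B > 0" "\<And>x. \<bar>m x\<bar> \<le> B" using bmeas_bound[OF assms] by auto
  show ?thesis
  proof (rule bounded_linear_intro[where K=B])
    fix f g :: lsq and c :: real
    show "multop m (f + g) = multop m f + multop m g"
    proof (rule lsq_eqI)
      show "AE x in lborel. rep_lsq (multop m (f + g)) x = rep_lsq (multop m f + multop m g) x"
        using rep_lsq_multop[OF assms, of "f+g"] rep_lsq_multop[OF assms, of f] rep_lsq_multop[OF assms, of g]
          rep_lsq_add[of f g] rep_lsq_add[of "multop m f" "multop m g"]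
        by eventually_elim (simp add: algebra_simps)
    qed
    show "multop m (c *\<^sub>R f) = c *\<^sub>R multop m f"
    proof (rule lsq_eqI)
      show "AE x in lborel. rep_lsq (multop m (c *\<^sub>R f)) x = rep_lsq (c *\<^sub>R multop m f) x"
        using rep_lsq_multop[OF assms, of "c *\<^sub>R f"] rep_lsq_multop[OF assms, of f]
          rep_lsq_scaleR[of c f] rep_lsq_scaleR[of c "multop m f"]
        by eventually_elim (simp add: algebra_simps)
    qed
    have "norm (multop m f) \<le> B * norm f"
    proof (rule norm_le_pointwise)
      show "AE x in lborel. \<bar>rep_lsq (multop m f) x\<bar> \<le> B * \<bar>rep_lsq f x\<bar>"
        using rep_lsq_multop[OF assms, of f] by eventually_elim (auto simp: abs_mult B intro: mult_right_mono)
    qed (use B in auto)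
    then show "norm (multop m f) \<le> norm f * B" by (simp add: mult.commute)
  qed
qed

lemma inner_mult_left:
  assumes "bmeas m"
  shows "inner (multop m f) g = (LINT x|lborel. m x * rep_lsq f x * rep_lsq g x)"
proof -
  have "inner (multop m f) (abs_lsq (rep_lsq g)) = (LINT x|lborel. m x * rep_lsq f x * rep_lsq g x)"
    unfolding multop_def using assms by (subst inner_abs_lsq) (auto intro: L2_bmeas_mult)
  then show ?thesis by simp
qed

lemma inner_mult_commute:
  assumes "bmeas m"
  shows "inner (multop m f) g = inner f (multop m g)"
  using inner_mult_left[OF assms, of f g] inner_mult_left[OF assms, of g f]
  by (simp add: inner_commute[of f] mult_ac)

text \<open>Lebesgue measure equals its image under a translation, so null sets can be pulled
  back.\<close>

lemma AE_shift:
  assumes "AE x in lborel. P (x::real)"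
  shows "AE x in lborel. P (x + s)"
proof -
  obtain N where N: "N \<in> null_sets lborel" "\<And>x. x \<in> space lborel - N \<Longrightarrow> P x"
    using AE_E3[OF assms] by blast
  have "AE x in lborel. x \<notin> N" using N by (intro AE_not_in)
  then have "AE x in distr lborel borel ((+) s). x \<notin> N" by (subst lborel_distr_plus)
  then have "AE x in lborel. s + x \<notin> N" using N
    by (subst (asm) AE_distr_iff) (auto simp: null_sets_def)
  then show ?thesis
    by eventually_elim (use N in \<open>auto simp: add.commute\<close>)
qed

lemma L2_shift:
  assumes "L2 f"
  shows "L2 (\<lambda>x. f (x + s))"
proof -
  note L2_borel[OF assms, measurable]
  show ?thesis
    using lborel_integrable_real_affine[OF L2_sq[OF assms], of 1 s]
    by (simp add: L2_def add.commute)
qed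

lemma rep_lsq_shift: "AE x in lborel. rep_lsq (shift s f) x = rep_lsq f (x + s)"
  unfolding shift_def by (intro rep_lsq_abs L2_shift) auto

lemma shift_abs:
  assumes "L2 f"
  shows "shift s (abs_lsq f) = abs_lsq (\<lambda>x. f (x + s))"
  unfolding shift_def
  by (subst abs_lsq_eq_iff) (use AE_shift[OF rep_lsq_abs[OF assms], of s] in \<open>auto intro: L2_shift assms\<close>)

lemma shift_shift: "shift s (shift t f) = shift (s + t) f"
  using shift_abs[OF L2_shift[OF L2_rep_lsq], of s f t]
  by (simp add: shift_def add_ac)

lemma shift_0[simp]: "shift 0 f = f"
  by (simp add: shift_def)

lemma inner_shift: "inner (shift s f) (shift s g) = inner f g"
proof -
  have "inner (shift s f) (shift s g) = (LINT x|lborel. rep_lsq f (x + s) * rep_lsq g (x + s))"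
    unfolding shift_def by (rule inner_abs_lsq) (auto intro: L2_shift)
  also have "\<dots> = (LINT x|lborel. rep_lsq f x * rep_lsq g x)"
    using lborel_integral_real_affine[of 1 "\<lambda>x. rep_lsq f x * rep_lsq g x" s]
    by (simp add: add.commute)
  finally show ?thesis by (simp add: inner_rep_lsq)
qed

lemma norm_shift[simp]: "norm (shift s f) = norm f"
  by (simp add: norm_eq_sqrt_inner inner_shift)

lemma inner_shift_left: "inner (shift s f) g = inner f (shift (- s) g)"
  using inner_shift[of s f "shift (- s) g"] by (simp add: shift_shift)

lemma bounded_linear_shift: "bounded_linear (shift s)"
proof (rule bounded_linear_intro[where K=1])
  fix f g :: lsq and c :: real
  show "shift s (f + g) = shift s f + shift s g"
    using shift_abs[OF L2_add[OF L2_rep_lsq L2_rep_lsq], of s f g]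
    by (simp add: abs_lsq_add shift_def L2_shift)
  show "shift s (c *\<^sub>R f) = c *\<^sub>R shift s f"
    using shift_abs[OF L2_scale[OF L2_rep_lsq], of s c f]
    by (simp add: abs_lsq_scale shift_def L2_shift)
qed simp

section \<open>Support in an interval as a closed linear condition\<close>

definition supported :: "real \<Rightarrow> lsq \<Rightarrow> bool" where
  "supported r f \<longleftrightarrow> (AE x in lborel. \<bar>x\<bar> > r \<longrightarrow> rep_lsq f x = 0)"

lemma bmeas_indicator: "A \<in> sets borel \<Longrightarrow> bmeas (indicator A)"
  by (rule bmeasI[where B=1]) (auto simp: indicator_def)

text \<open>Support conditions become kernels of bounded operators; linearity, closedness and
  compatibility with integrals all follow from this form.\<close>

lemma supported_iff: "supported r f \<longleftrightarrow> multop (indicator {x. r < \<bar>x\<bar>}) f = 0"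
proof -
  have b: "bmeas (indicator {x. r < \<bar>x\<bar>})" by (rule bmeas_indicator) measurable
  have "multop (indicator {x. r < \<bar>x\<bar>}) f = 0 \<longleftrightarrow> (AE x in lborel. indicator {x. r < \<bar>x\<bar>} x * rep_lsq f x = 0)"
    unfolding multop_def abs_lsq_zero[symmetric] by (rule abs_lsq_eq_iff) (auto intro: L2_zero L2_bmeas_mult b)
  also have "\<dots> \<longleftrightarrow> supported r f"
    unfolding supported_def by (intro AE_cong) (auto simp: indicator_def)
  finally show ?thesis by simp
qed

lemma bounded_linear_cutoff: "bounded_linear (multop (indicator {x. r < \<bar>x\<bar>}))"
  by (intro bounded_linear_mult bmeas_indicator) measurable

lemma supported_add: "supported r f \<Longrightarrow> supported r g \<Longrightarrow> supported r (f + g)"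
  unfolding supported_iff by (simp add: linear_add[OF bounded_linear.linear[OF bounded_linear_cutoff]])

lemma supported_scaleR: "supported r f \<Longrightarrow> supported r (c *\<^sub>R f)"
  unfolding supported_iff by (simp add: linear_cmul[OF bounded_linear.linear[OF bounded_linear_cutoff]])

lemma supported_diff: "supported r f \<Longrightarrow> supported r g \<Longrightarrow> supported r (f - g)"
  unfolding supported_iff by (simp add: linear_diff[OF bounded_linear.linear[OF bounded_linear_cutoff]])

lemma supported_mult:
  assumes "supported r f" "bmeas m"
  shows "supported r (multop m f)"
  using assms(1) rep_lsq_multop[OF assms(2), of f] unfolding supported_def by eventually_elim simp

lemma supported_mono: "supported r f \<Longrightarrow> r \<le> s \<Longrightarrow> supported s f"
  unfolding supported_def by (auto elim: eventually_mono)

lemma supported_shift: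
  assumes "supported r f"
  shows "supported (r + \<bar>s\<bar>) (shift s f)"
  using AE_shift[OF assms[unfolded supported_def], of s] rep_lsq_shift[of s f]
  unfolding supported_def by eventually_elim auto

lemma closed_supported: "closed {f. supported r f}"
proof -
  have "closed ((multop (indicator {x. r < \<bar>x\<bar>})) -` {0})"
    by (intro closed_vimage closed_singleton linear_continuous_on bounded_linear_cutoff)
  then show ?thesis by (simp add: supported_iff vimage_def)
qed

lemma inner_mult_nonneg:
  assumes "bmeas m" "\<And>x. 0 \<le> m x"
  shows "0 \<le> inner (multop m f) f"
  unfolding inner_mult_left[OF assms(1)]
  by (intro integral_nonneg_AE) (auto simp: mult.assoc assms(2))

text \<open>Serves the damping, whose lower bound decays in space: on the cone |x| <= R + t it is at
  least its value at the edge.\<close>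

lemma inner_mult_supported_ge:
  assumes "bmeas m" "supported r f" "\<And>x. \<bar>x\<bar> \<le> r \<Longrightarrow> c \<le> m x"
  shows "c * (norm f)\<^sup>2 \<le> inner (multop m f) f"
proof -
  have "c * (norm f)\<^sup>2 = (LINT x|lborel. c * (rep_lsq f x * rep_lsq f x))"
    by (simp add: power2_norm_eq_inner inner_rep_lsq)
  also have "\<dots> \<le> (LINT x|lborel. m x * rep_lsq f x * rep_lsq f x)"
  proof (rule integral_mono_AE)
    show "integrable lborel (\<lambda>x. m x * rep_lsq f x * rep_lsq f x)"
      using L2_mult_integrable[OF L2_bmeas_mult[OF assms(1) L2_rep_lsq] L2_rep_lsq] .
    show "AE x in lborel. c * (rep_lsq f x * rep_lsq f x) \<le> m x * rep_lsq f x * rep_lsq f x"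
      using assms(2)[unfolded supported_def]
    proof eventually_elim
      case (elim x)
      show ?case
      proof (cases "\<bar>x\<bar> \<le> r")
        case True
        then show ?thesis using assms(3)[of x] by (auto simp: mult.assoc intro!: mult_right_mono)
      qed (use elim in auto)
    qed
  qed (auto intro: L2_mult_integrable)
  finally show ?thesis by (simp add: inner_mult_left[OF assms(1)])
qed

section \<open>Density of test functions\<close>

text \<open>\<open>Cn n f\<close> means that \<open>f\<close> is \<open>n + 1\<close> times differentiable.\<close>

primrec Cn :: "nat \<Rightarrow> (real \<Rightarrow> real) \<Rightarrow> bool" where
  "Cn 0 f \<longleftrightarrow> (\<forall>x. f differentiable (at x))"
| "Cn (Suc n) f \<longleftrightarrow> (\<forall>x. f differentiable (at x)) \<and> Cn n (deriv f)"

lemma Cn_iff: "Cn n f \<longleftrightarrow> (\<forall>k\<le>n. \<forall>x. ((deriv ^^ k) f) differentiable (at x))"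
proof (induction n arbitrary: f)
  case (Suc n)
  have "(\<forall>k\<le>Suc n. \<forall>x. ((deriv ^^ k) f) differentiable (at x)) \<longleftrightarrow>
    (\<forall>x. f differentiable (at x)) \<and> (\<forall>k\<le>n. \<forall>x. ((deriv ^^ Suc k) f) differentiable (at x))"
    by (metis funpow_0 le0 not0_implies_Suc not_less_eq_eq)
  also have "\<dots> \<longleftrightarrow> Cn (Suc n) f"
    by (simp add: Suc.IH funpow_swap1)
  finally show ?case ..
qed simp

lemma Cn_differentiable: "Cn n f \<Longrightarrow> f differentiable (at x)"
  by (cases n) auto

lemma deriv_real: "f differentiable (at x) \<Longrightarrow> (f has_real_derivative deriv f x) (at x)" for f :: "real \<Rightarrow> real"
  by (simp add: DERIV_deriv_iff_real_differentiable)

lemma Cn_DERIV: "Cn n f \<Longrightarrow> (f has_real_derivative deriv f x) (at x)"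
  by (intro deriv_real Cn_differentiable)

lemma Cn_SucI:
  assumes "\<And>x. (f has_real_derivative f' x) (at x)" "Cn n f'"
  shows "Cn (Suc n) f"
proof -
  have "deriv f = f'" using assms(1) by (auto intro!: DERIV_imp_deriv)
  then show ?thesis using assms by (auto simp: real_differentiable_def)
qed

lemma Cn_Suc: "Cn (Suc n) f \<Longrightarrow> Cn n f"
  unfolding Cn_iff by auto

lemma Cn_add: "Cn n f \<Longrightarrow> Cn n g \<Longrightarrow> Cn n (\<lambda>x. f x + g x)"
proof (induction n arbitrary: f g)
  case (Suc n)
  show ?case
    by (rule Cn_SucI[where f'="\<lambda>x. deriv f x + deriv g x"])
       (use Suc Cn_DERIV[OF Suc.prems(1)] Cn_DERIV[OF Suc.prems(2)] in \<open>auto intro: DERIV_add\<close>)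
qed auto

lemma Cn_mult: "Cn n f \<Longrightarrow> Cn n g \<Longrightarrow> Cn n (\<lambda>x. f x * g x)"
proof (induction n arbitrary: f g)
  case (Suc n)
  show ?case
  proof (rule Cn_SucI)
    show "((\<lambda>x. f x * g x) has_real_derivative deriv f x * g x + deriv g x * f x) (at x)" for x
      by (rule DERIV_mult[OF Cn_DERIV[OF Suc.prems(1)] Cn_DERIV[OF Suc.prems(2)]])
    show "Cn n (\<lambda>x. deriv f x * g x + deriv g x * f x)"
      using Suc.prems by (intro Cn_add Suc.IH) (auto simp del: Cn.simps intro: Cn_Suc, auto)
  qed
qed auto

lemma Cn_const: "Cn n (\<lambda>x. c)"
  by (induction n arbitrary: c) auto

lemma Cn_affine: "Cn n f \<Longrightarrow> Cn n (\<lambda>x. f (c * x + d))"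
proof (induction n arbitrary: f)
  case 0
  then have "(f has_real_derivative deriv f x) (at x)" for x by (rule Cn_DERIV)
  then have "((\<lambda>x. f (c * x + d)) has_real_derivative deriv f (c * x + d) * c) (at x)" for x
    by (rule DERIV_chain2) (auto intro!: derivative_eq_intros)
  then show ?case by (auto simp: real_differentiable_def)
next
  case (Suc n)
  show ?case
  proof (rule Cn_SucI)
    show "((\<lambda>x. f (c * x + d)) has_real_derivative deriv f (c * x + d) * c) (at x)" for x
      by (rule DERIV_chain2[OF Cn_DERIV[OF Suc.prems]]) (auto intro!: derivative_eq_intros)
    show "Cn n (\<lambda>x. deriv f (c * x + d) * c)"
      using Suc by (intro Cn_mult Cn_const) auto
  qed
qed

section \<open>Smooth functions of compact support, built from exp (- 1/x)\<close>

definition flat :: "real poly \<Rightarrow> real \<Rightarrow> real" where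
  "flat p x = (if x > 0 then poly p (1/x) * exp (- (1/x)) else 0)"

lemma poly_exp_tendsto_0: "((\<lambda>y. poly p y * exp (- y)) \<longlongrightarrow> 0) at_top" for p :: "real poly"
proof -
  have "((\<lambda>y. \<Sum>i\<le>degree p. coeff p i * (y ^ i / exp y)) \<longlongrightarrow> 0) at_top"
    by (intro tendsto_null_sum tendsto_mult_right_zero tendsto_power_div_exp_0)
  then show ?thesis by (simp add: poly_altdef exp_minus divide_inverse sum_distrib_right mult.assoc)
qed

lemma flat_tendsto_0: "(flat p \<longlongrightarrow> 0) (at 0)"
proof -
  have "((\<lambda>x. poly p (1/x) * exp (- (1/x))) \<longlongrightarrow> 0) (at_right 0)"
    using filterlim_compose[OF poly_exp_tendsto_0 filterlim_inverse_at_top_right]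
    by (simp add: inverse_eq_divide)
  then have r: "(flat p \<longlongrightarrow> 0) (at_right 0)"
    by (rule Lim_transform_eventually)
       (auto simp: flat_def eventually_at_filter)
  have l: "(flat p \<longlongrightarrow> 0) (at_left 0)"
    by (rule Lim_transform_eventually[OF tendsto_const])
       (auto simp: flat_def eventually_at_filter)
  from l r show ?thesis by (simp add: filterlim_split_at)
qed

text \<open>With y = 1/x one has y' = - y^2, so p(y) exp (- y) has the derivative y^2 (p - p')(y)
  exp (- y). Hence the family \<open>flat p\<close> is closed under differentiation;
  \<open>[:0,0,1:]\<close> is the factor y^2.\<close>

lemma flat_DERIV: "(flat p has_real_derivative flat ([:0,0,1:] * (p - pderiv p)) x) (at x)"
proof -
  consider "x > 0" | "x < 0" | "x = 0" by linarith
  then show ?thesis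
  proof cases
    case 1
    have "((\<lambda>x. poly p (1/x) * exp (- (1/x))) has_real_derivative flat ([:0,0,1:] * (p - pderiv p)) x) (at x)"
      using 1 by (auto intro!: derivative_eq_intros DERIV_chain2[OF poly_DERIV] simp: flat_def field_simps power2_eq_square)
    then show ?thesis
      by (rule has_field_derivative_transform_within_open[of _ _ _ "{0<..}"]) (use 1 in \<open>auto simp: flat_def\<close>)
  next
    case 2
    have "((\<lambda>x. 0) has_real_derivative flat ([:0,0,1:] * (p - pderiv p)) x) (at x)"
      using 2 by (simp add: flat_def)
    then show ?thesis
      by (rule has_field_derivative_transform_within_open[of _ _ _ "{..<0}"]) (use 2 in \<open>auto simp: flat_def\<close>)
  next
    case 3
    \<comment> \<open>Division by \<open>h\<close> multiplies the polynomial in 1/h by its variable,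
      so the difference quotient at 0 is again a \<open>flat\<close> function and tends to
      0.\<close>
    have "(\<lambda>h. (flat p (0 + h) - flat p 0) / h) = flat ([:0,1:] * p)"
      by (auto simp: flat_def fun_eq_iff)
    then have "(flat p has_real_derivative 0) (at 0)"
      using flat_tendsto_0[of "[:0,1:] * p"] by (simp add: DERIV_def)
    then show ?thesis using 3 by (simp add: flat_def)
  qed
qed

lemma Cn_flat: "Cn n (flat p)"
proof (induction n arbitrary: p)
  case 0
  show ?case using flat_DERIV by (auto simp: real_differentiable_def)
next
  case (Suc n)
  show ?case by (rule Cn_SucI[OF flat_DERIV Suc])
qed

lemma test_fun_iff: "test_fun \<phi> \<longleftrightarrow> (\<forall>n. Cn n \<phi>) \<and> (\<exists>r. \<forall>x. \<bar>x\<bar> > r \<longrightarrow> \<phi> x = 0)"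
  unfolding test_fun_def Cn_iff by auto

lemma test_fun_DERIV: "test_fun \<phi> \<Longrightarrow> (\<phi> has_real_derivative deriv \<phi> x) (at x)"
  unfolding test_fun_iff by (auto intro: Cn_DERIV)

lemma test_fun_continuous: "test_fun \<phi> \<Longrightarrow> continuous_on A \<phi>"
  by (meson DERIV_continuous_on DERIV_subset subset_UNIV test_fun_DERIV)

lemma test_fun_deriv:
  assumes "test_fun \<phi>"
  shows "test_fun (deriv \<phi>)"
proof -
  obtain r where r: "\<And>x. \<bar>x\<bar> > r \<Longrightarrow> \<phi> x = 0" using assms unfolding test_fun_def by auto
  have "deriv \<phi> x = 0" if "\<bar>x\<bar> > r" for x
  proof (rule DERIV_imp_deriv)
    show "(\<phi> has_real_derivative 0) (at x)"
      by (rule has_field_derivative_transform_within_open[of "\<lambda>x. 0" _ _ "{x. r < \<bar>x\<bar>}"])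
         (use that r in \<open>auto intro!: open_Collect_less continuous_intros\<close>)
  qed
  moreover have "Cn n (deriv \<phi>)" for n
    using assms unfolding test_fun_iff by (metis Cn.simps(2))
  ultimately show ?thesis unfolding test_fun_iff by auto
qed

lemma test_fun_shift:
  assumes "test_fun \<phi>"
  shows "test_fun (\<lambda>x. \<phi> (x + s))"
proof -
  obtain r where r: "\<And>x. \<bar>x\<bar> > r \<Longrightarrow> \<phi> x = 0" using assms unfolding test_fun_def by auto
  have "\<phi> (x + s) = 0" if "\<bar>x\<bar> > r + \<bar>s\<bar>" for x using that by (intro r) linarith
  moreover have "Cn n (\<lambda>x. \<phi> (x + s))" for n
    using Cn_affine[of n \<phi> 1 s] assms unfolding test_fun_iff by simp
  ultimately show ?thesis unfolding test_fun_iff by blast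
qed

lemma L2_indicator_interval: "L2 (indicator {a..b::real})"
proof -
  have "(\<lambda>x. (indicator {a..b} x)\<^sup>2 :: real) = indicator {a..b}"
    by (auto simp: indicator_def)
  moreover have "integrable lborel (indicator {a..b} :: real \<Rightarrow> real)"
    by (rule integrable_real_indicator) (auto simp: emeasure_lborel_Icc_eq)
  ultimately show ?thesis by (simp add: L2_def)
qed

lemma test_fun_bounds:
  assumes "test_fun \<phi>"
  obtains B r where "B \<ge> 0" "r \<ge> 0" "\<And>x. \<bar>\<phi> x\<bar> \<le> B * indicator {-r..r} x"
proof -
  obtain r where r: "\<And>x. \<bar>x\<bar> > r \<Longrightarrow> \<phi> x = 0" using assms unfolding test_fun_def by auto
  have "bounded (\<phi> ` {-\<bar>r\<bar>..\<bar>r\<bar>})"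
    by (intro compact_imp_bounded compact_continuous_image test_fun_continuous assms) auto
  then obtain B where B: "\<And>x. x \<in> {-\<bar>r\<bar>..\<bar>r\<bar>} \<Longrightarrow> \<bar>\<phi> x\<bar> \<le> B" "B > 0"
    unfolding bounded_pos by (metis image_eqI real_norm_def)
  show ?thesis
  proof (rule that[of B "\<bar>r\<bar>"])
    show "\<bar>\<phi> x\<bar> \<le> B * indicator {-\<bar>r\<bar>..\<bar>r\<bar>} x" for x
      using r[of x] B(1)[of x] by (auto simp: indicator_def)
  qed (use B in auto)
qed

lemma L2_test_fun:
  assumes "test_fun \<phi>"
  shows "L2 \<phi>"
proof -
  obtain B r where B: "B \<ge> 0" "r \<ge> 0" "\<And>x. \<bar>\<phi> x\<bar> \<le> B * indicator {-r..r} x"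
    using test_fun_bounds[OF assms] by metis
  show ?thesis
    by (rule L2_dominated[OF L2_indicator_interval[of "-r" r], where c=B])
       (use B test_fun_continuous[OF assms, of UNIV] in \<open>auto intro: borel_measurable_continuous_onI\<close>)
qed

text \<open>Dominated convergence for squares: \<open>h\<close> inherits the bound, hence |f n -
  h|^2 <= 4 g^2.\<close>

lemma lsq_dominated_tendsto:
  assumes g: "L2 g" and f: "\<And>n. f n \<in> borel_measurable borel" "h \<in> borel_measurable borel"
    and lim: "AE x in lborel. (\<lambda>n. f n x) \<longlonglongrightarrow> h x"
    and bd: "\<And>n. AE x in lborel. \<bar>f n x\<bar> \<le> \<bar>g x\<bar>"
  shows "L2 h \<and> (\<forall>n. L2 (f n)) \<and> (\<lambda>n. abs_lsq (f n)) \<longlonglongrightarrow> abs_lsq h"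
proof -
  have L2f: "L2 (f n)" for n
    by (rule L2_dominated[OF g f(1), where c=1]) (use bd in auto)
  have "AE x in lborel. \<forall>n. \<bar>f n x\<bar> \<le> \<bar>g x\<bar>" using bd by (simp add: AE_all_countable)
  with lim have hb: "AE x in lborel. \<bar>h x\<bar> \<le> \<bar>g x\<bar>"
    by eventually_elim (auto intro!: LIMSEQ_le_const2 intro: tendsto_rabs)
  have L2h: "L2 h"
    by (rule L2_dominated[OF g f(2), where c=1]) (use hb in auto)
  note [measurable] = f L2_borel[OF g]
  have "(\<lambda>n. LINT x|lborel. (f n x - h x)\<^sup>2) \<longlonglongrightarrow> integral\<^sup>L lborel (\<lambda>x::real. 0)"
  proof (rule integral_dominated_convergence[where w="\<lambda>x. 4 * (g x)\<^sup>2"])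
    show "integrable lborel (\<lambda>x. 4 * (g x)\<^sup>2)" using g by (auto simp: L2_def)
    show "AE x in lborel. (\<lambda>n. (f n x - h x)\<^sup>2) \<longlonglongrightarrow> 0"
      using lim
    proof eventually_elim
      case (elim x)
      then have "(\<lambda>n. (f n x - h x)\<^sup>2) \<longlonglongrightarrow> (h x - h x)\<^sup>2" by (intro tendsto_intros)
      then show ?case by simp
    qed
    show "AE x in lborel. norm ((f n x - h x)\<^sup>2) \<le> 4 * (g x)\<^sup>2" for n
      using bd[of n] hb
    proof eventually_elim
      case (elim x)
      then have "\<bar>f n x - h x\<bar>\<^sup>2 \<le> (2 * \<bar>g x\<bar>)\<^sup>2" by (intro power_mono) auto
      then show ?case by (simp add: power_mult_distrib)
    qed
  qed auto
  then have "(\<lambda>n. sqrt (LINT x|lborel. (f n x - h x)\<^sup>2)) \<longlonglongrightarrow> sqrt 0"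
    by (intro tendsto_real_sqrt) simp
  then have "(\<lambda>n. norm (abs_lsq (\<lambda>x. f n x - h x))) \<longlonglongrightarrow> 0"
    using L2f L2h by (simp add: norm_abs_lsq L2_diff L2norm_def)
  then have "(\<lambda>n. abs_lsq (f n) - abs_lsq h) \<longlonglongrightarrow> 0"
    using L2f L2h by (subst tendsto_norm_zero_iff[symmetric]) (simp add: abs_lsq_diff)
  then show ?thesis using L2f L2h by (simp add: LIM_zero_iff)
qed

text \<open>The factors vanish to the left of \<open>a\<close> and to the right of \<open>b\<close>.
  A larger \<open>k\<close> steepens both edges, since exp (- 1/y) tends to 1 as y grows, so the
  limit is an indicator off the endpoints.\<close>

definition bump :: "real \<Rightarrow> real \<Rightarrow> nat \<Rightarrow> real \<Rightarrow> real" where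
  "bump a b k x = flat 1 (real k * (x - a)) * flat 1 (real k * (b - x))"

lemma flat_1_bounds: "0 \<le> flat 1 x" "flat 1 x \<le> 1"
  by (auto simp: flat_def)

lemma test_fun_bump: "test_fun (bump a b k)"
proof -
  have "bump a b k = (\<lambda>x. flat 1 (real k * x + (- real k * a)) * flat 1 ((- real k) * x + real k * b))"
    by (auto simp: bump_def algebra_simps)
  then have "Cn n (bump a b k)" for n
    by (simp only: ) (intro Cn_mult Cn_affine Cn_flat)
  moreover have "bump a b k x = 0" if "\<bar>x\<bar> > \<bar>a\<bar> + \<bar>b\<bar>" for x
  proof -
    have "x \<le> a \<or> b \<le> x" using that by linarith
    then show ?thesis by (auto simp: bump_def flat_def zero_less_mult_iff)
  qed
  ultimately show ?thesis unfolding test_fun_iff by blast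
qed

lemma bump_le: "\<bar>bump a b k x\<bar> \<le> \<bar>indicator {a..b} x\<bar>"
proof (cases "x \<in> {a..b}")
  case True
  then show ?thesis using flat_1_bounds by (simp add: bump_def abs_mult mult_le_one)
next
  case False
  then have "x \<le> a \<or> b \<le> x" by auto
  then show ?thesis by (auto simp: bump_def flat_def zero_less_mult_iff)
qed

lemma flat_1_tendsto: "y > 0 \<Longrightarrow> (\<lambda>k. flat 1 (real k * y)) \<longlonglongrightarrow> 1"
proof -
  assume y: "y > 0"
  have "(\<lambda>k. exp (- (inverse (real k) * (1 / y)))) \<longlonglongrightarrow> exp (- (0 * (1 / y)))"
    by (intro tendsto_intros lim_inverse_n)
  then have "(\<lambda>k. exp (- (inverse (real k) * (1 / y)))) \<longlonglongrightarrow> 1" by simp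
  then show ?thesis
  proof (rule Lim_transform_eventually)
    show "\<forall>\<^sub>F k in sequentially. exp (- (inverse (real k) * (1 / y))) = flat 1 (real k * y)"
      using eventually_gt_at_top[of 0]
      by eventually_elim (use y in \<open>auto simp: flat_def field_simps\<close>)
  qed
qed

lemma bump_tendsto: "x \<noteq> a \<Longrightarrow> x \<noteq> b \<Longrightarrow> (\<lambda>k. bump a b k x) \<longlonglongrightarrow> indicator {a..b} x"
proof (cases "x \<in> {a..b}")
  case True
  assume "x \<noteq> a" "x \<noteq> b"
  with True have "(\<lambda>k. bump a b k x) \<longlonglongrightarrow> 1 * 1"
    unfolding bump_def by (intro tendsto_mult flat_1_tendsto) auto
  then show ?thesis using True by simp
next
  case False
  then have "bump a b k x = 0" for k using bump_le[of a b k x] by simp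
  then show ?thesis using False by simp
qed

lemma interval_in_closure:
  assumes S: "closed S" and test: "\<And>\<phi>. test_fun \<phi> \<Longrightarrow> abs_lsq \<phi> \<in> S"
  shows "abs_lsq (indicator {a..b}) \<in> S"
proof -
  have "(\<lambda>k. abs_lsq (bump a b k)) \<longlonglongrightarrow> abs_lsq (indicator {a..b})"
  proof (intro lsq_dominated_tendsto[THEN conjunct2, THEN conjunct2])
    show "L2 (indicator {a..b})" by (rule L2_indicator_interval)
    show "AE x in lborel. (\<lambda>k. bump a b k x) \<longlonglongrightarrow> indicator {a..b} x"
      using AE_lborel_singleton[of a] AE_lborel_singleton[of b]
      by eventually_elim (rule bump_tendsto)
  qed (use bump_le in \<open>auto intro: L2_borel[OF L2_test_fun[OF test_fun_bump]]\<close>)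
  then show ?thesis
    by (rule closed_sequentially[OF S test[OF test_fun_bump]])
qed

text \<open>The closure contains the indicators of intervals, hence of Borel sets, hence simple functions.\<close>

theorem test_fun_dense:
  assumes S: "closed S" "subspace S" and test: "\<And>\<phi>. test_fun \<phi> \<Longrightarrow> abs_lsq \<phi> \<in> S"
  shows "f \<in> S"
proof -
  have L2I: "L2 (indicator (A \<inter> {-r..r}))" if "A \<in> sets borel" for A and r :: real
    by (rule L2_dominated[OF L2_indicator_interval[of "-r" r], where c=1])
       (use that in \<open>auto simp: indicator_def\<close>)
  \<comment> \<open>The cut with \<open>{-r..r}\<close> keeps complements in L^2, which an induction
    over all Borel sets requires.\<close>
  have step1: "abs_lsq (indicator (A \<inter> {-r..r})) \<in> S" if "A \<in> sets borel" for A and r :: real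
    using that
  proof (induction A rule: borel_set_induct)
    case empty
    then show ?case using S by (simp add: abs_lsq_zero subspace_0)
  next
    case (interval a b)
    then show ?case using interval_in_closure[OF S(1) test] by simp
  next
    case (compl A)
    have "indicator (- A \<inter> {-r..r}) = (\<lambda>x. indicator {-r..r} x - indicator (A \<inter> {-r..r}) x :: real)"
      by (auto simp: indicator_def fun_eq_iff)
    then have "abs_lsq (indicator (- A \<inter> {-r..r})) = abs_lsq (indicator {-r..r}) - abs_lsq (indicator (A \<inter> {-r..r}))"
      using L2I[OF compl(1), of r] by (simp add: abs_lsq_diff L2_indicator_interval)
    then show ?case using S compl interval_in_closure[OF S(1) test] by (simp add: subspace_diff)
  next
    case (union A)
    have *: "(\<Sum>i<n. indicator (A i \<inter> {-r..r}) x) = (indicator ((\<Union>i<n. A i) \<inter> {-r..r}) x :: real)" for n x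
    proof (induction n)
      case (Suc n)
      have "A n \<inter> A i = {}" if "i < n" for i
        using union(1) that unfolding disjoint_family_on_def by (metis UNIV_I nat_neq_iff)
      then have "A n \<inter> (\<Union>i<n. A i) = {}" by blast
      then show ?case using Suc by (auto simp: indicator_def less_Suc_eq)
    qed simp
    have in_S: "abs_lsq (\<lambda>x. \<Sum>i<n. indicator (A i \<inter> {-r..r}) x) \<in> S" for n
    proof (induction n)
      case 0 then show ?case using S by (simp add: abs_lsq_zero subspace_0)
    next
      case (Suc n)
      have "L2 (\<lambda>x. \<Sum>i<n. indicator (A i \<inter> {-r..r}) x)"
        unfolding * by (rule L2I) (use union in auto)
      then show ?case using Suc S union L2I[of "A n" r]
        by (simp add: abs_lsq_add subspace_add)
    qed
    have "(\<lambda>n. abs_lsq (indicator ((\<Union>i<n. A i) \<inter> {-r..r}))) \<longlonglongrightarrow> abs_lsq (indicator ((\<Union>i. A i) \<inter> {-r..r}))"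
    proof (intro lsq_dominated_tendsto[THEN conjunct2, THEN conjunct2])
      show "L2 (indicator {-r..r})" by (rule L2_indicator_interval)
      have "(\<lambda>n. indicator (\<Union>i<n. A i \<inter> {-r..r}) x :: real) \<longlonglongrightarrow> indicator (\<Union>i. A i \<inter> {-r..r}) x" for x
        by (rule LIMSEQ_indicator_UN)
      then show "AE x in lborel. (\<lambda>n. indicator ((\<Union>i<n. A i) \<inter> {- r..r}) x :: real) \<longlonglongrightarrow> indicator (\<Union> (range A) \<inter> {- r..r}) x"
        by simp
    qed (use union in \<open>auto simp: indicator_def\<close>)
    then show ?case
      by (rule closed_sequentially[OF S(1) in_S[unfolded *]])
  qed
  have step2: "abs_lsq (indicator A) \<in> S" if A: "A \<in> sets borel" "L2 (indicator A)" for A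
  proof -
    have "(\<lambda>n. abs_lsq (indicator (A \<inter> {-real n..real n}))) \<longlonglongrightarrow> abs_lsq (indicator A)"
    proof (intro lsq_dominated_tendsto[THEN conjunct2, THEN conjunct2])
      show "L2 (indicator A)" by fact
      have "(\<lambda>n. indicator (A \<inter> {-real n..real n}) x :: real) \<longlonglongrightarrow> indicator A x" for x
      proof (rule Lim_transform_eventually[OF tendsto_const])
        obtain N :: nat where N: "\<bar>x\<bar> \<le> real N" using real_arch_simple by blast
        show "\<forall>\<^sub>F n in sequentially. indicator A x = (indicator (A \<inter> {-real n..real n}) x :: real)"
          using eventually_ge_at_top[of N] by eventually_elim (use N in \<open>auto simp: indicator_def\<close>)
      qed
      then show "AE x in lborel. (\<lambda>n. indicator (A \<inter> {-real n..real n}) x :: real) \<longlonglongrightarrow> indicator A x" by simp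
    qed (use A in \<open>auto simp: indicator_def\<close>)
    then show ?thesis
      by (rule closed_sequentially[OF S(1) step1[OF A(1)]])
  qed
  define g where "g = rep_lsq f"
  have L2g: "L2 g" by (simp add: g_def)
  have gm: "g \<in> borel_measurable lborel" using L2g by (simp add: L2_def)
  obtain s where s: "\<And>i. simple_function lborel (s i)" "\<And>x. (\<lambda>i. s i x) \<longlonglongrightarrow> g x"
      "\<And>i x. \<bar>s i x\<bar> \<le> 2 * \<bar>g x\<bar>"
    using borel_measurable_implies_sequence_metric[OF gm, of 0] by (auto simp: dist_norm)
  have sm: "s i \<in> borel_measurable borel" for i
    using borel_measurable_simple_function[OF s(1)] by simp
  have L2s: "L2 (s i)" for i
    by (rule L2_dominated[OF L2g sm, where c=2]) (use s in auto)
  have "abs_lsq (s i) \<in> S" for i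
  proof -
    have fin: "finite (range (s i) - {0})" using s(1)[of i] by (simp add: simple_function_def)
    have pre: "s i -` {y} \<in> sets borel" for y
      using measurable_sets[OF sm[of i], of "{y}"] by simp
    define e :: "real \<Rightarrow> real \<Rightarrow> real" where "e y = indicator (s i -` {y})" for y
    \<comment> \<open>Chebyshev: on the level set of a nonzero value \<open>y\<close> the indicator
      is at most |s i| / |y|.\<close>
    have L2y: "L2 (e y)" if "y \<noteq> 0" for y
      unfolding e_def
      by (rule L2_dominated[OF L2s[of i], where c="inverse \<bar>y\<bar>"])
         (use pre that in \<open>auto simp: indicator_def\<close>)
    have eS: "abs_lsq (e y) \<in> S" if "y \<noteq> 0" for y
      using step2[OF pre L2y[OF that, unfolded e_def]] by (simp add: e_def)
    have part: "L2 (\<lambda>x. \<Sum>y\<in>F. y * e y x) \<and> abs_lsq (\<lambda>x. \<Sum>y\<in>F. y * e y x) \<in> S"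
      if "finite F" "0 \<notin> F" for F
      using that
    proof induction
      case empty
      then show ?case using S by (simp add: abs_lsq_zero subspace_0 L2_zero)
    next
      case (insert y F)
      then show ?case using S eS[of y]
        by (simp add: abs_lsq_add L2_add L2_scale L2y abs_lsq_scale subspace_add subspace_scale)
    qed
    have eq: "s i x = (\<Sum>y\<in>range (s i) - {0}. y * e y x)" for x
    proof (cases "s i x = 0")
      case True
      then have "(\<lambda>y. y * e y x) = (\<lambda>y. 0)" by (auto simp: e_def indicator_def)
      with True show ?thesis by (simp only: sum.neutral_const)
    next
      case False
      have "(\<Sum>y\<in>range (s i) - {0}. y * e y x) = (\<Sum>y\<in>{s i x}. y * e y x)"
        using fin False by (intro sum.mono_neutral_right) (auto simp: e_def)
      then show ?thesis by (simp add: e_def)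
    qed
    have "abs_lsq (s i) = abs_lsq (\<lambda>x. \<Sum>y\<in>range (s i) - {0}. y * e y x)"
      by (rule arg_cong[where f=abs_lsq], rule ext, rule eq)
    then show ?thesis using part[OF fin] by simp
  qed
  moreover have "(\<lambda>i. abs_lsq (s i)) \<longlonglongrightarrow> abs_lsq g"
    by (intro lsq_dominated_tendsto[THEN conjunct2, THEN conjunct2, of "\<lambda>x. 2 * g x"])
       (use L2g sm s gm in \<open>auto intro: L2_scale simp: abs_mult\<close>)
  ultimately have "abs_lsq g \<in> S" by (rule closed_sequentially[OF S(1)])
  then show ?thesis by (simp add: g_def)
qed

section \<open>Translations and weak derivatives\<close>

lemmas shift_linear_simps =
  linear_add[OF bounded_linear.linear[OF bounded_linear_shift]]
  linear_diff[OF bounded_linear.linear[OF bounded_linear_shift]]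
  linear_cmul[OF bounded_linear.linear[OF bounded_linear_shift]]
  linear_neg[OF bounded_linear.linear[OF bounded_linear_shift]]
  linear_0[OF bounded_linear.linear[OF bounded_linear_shift]]

text \<open>Turns derivatives in a normed space into limits of difference quotients, the form in
  which \<open>C1_L2_with\<close> states them.\<close>

lemma has_vector_derivative_quotient:
  "(f has_vector_derivative D) (at x within S) \<longleftrightarrow>
    ((\<lambda>y. (f y - f x) /\<^sub>R (y - x)) \<longlongrightarrow> D) (at x within S)"
proof -
  have "(f has_vector_derivative D) (at x within S) \<longleftrightarrow>
      ((\<lambda>y. norm (f y - f x - (y - x) *\<^sub>R D) / norm (y - x)) \<longlongrightarrow> 0) (at x within S)"
    by (simp add: has_vector_derivative_def has_derivative_iff_norm bounded_linear_scaleR_left)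
  also have "\<dots> \<longleftrightarrow> ((\<lambda>y. norm ((f y - f x) /\<^sub>R (y - x) - D)) \<longlongrightarrow> 0) (at x within S)"
  proof (rule filterlim_cong[OF refl refl])
    have "norm (f y - f x - (y - x) *\<^sub>R D) / norm (y - x) = norm ((f y - f x) /\<^sub>R (y - x) - D)"
      if "y \<noteq> x" for y
    proof -
      have "norm ((f y - f x) /\<^sub>R (y - x) - D) = norm (inverse (y - x) *\<^sub>R (f y - f x - (y - x) *\<^sub>R D))"
        using that by (simp add: scaleR_diff_right)
      then show ?thesis by (simp add: divide_inverse mult.commute)
    qed
    then show "\<forall>\<^sub>F y in at x within S. norm (f y - f x - (y - x) *\<^sub>R D) / norm (y - x)
        = norm ((f y - f x) /\<^sub>R (y - x) - D)"
      by (auto simp: eventually_at_filter)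
  qed
  finally show ?thesis by (simp add: tendsto_norm_zero_iff LIM_zero_iff)
qed

text \<open>The orthogonal complement of \<open>f - g\<close> is a closed subspace; once it contains
  all test functions, it contains \<open>f - g\<close> itself.\<close>

lemma lsq_test_eqI:
  assumes "\<And>\<phi>. test_fun \<phi> \<Longrightarrow> inner f (abs_lsq \<phi>) = inner g (abs_lsq \<phi>)"
  shows "f = g"
proof -
  have "f - g \<in> {h. inner (f - g) h = 0}"
  proof (rule test_fun_dense)
    show "closed {h. inner (f - g) h = 0}"
      by (intro closed_Collect_eq continuous_intros)
    show "subspace {h. inner (f - g) h = 0}"
      by (auto simp: subspace_def inner_add_right)
    show "abs_lsq \<phi> \<in> {h. inner (f - g) h = 0}" if "test_fun \<phi>" for \<phi>
      using assms[OF that] by (simp add: inner_diff_left)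
  qed
  then show ?thesis by simp
qed

lemma test_fun_difference_quotient:
  assumes \<phi>: "test_fun \<phi>" and h: "h \<longlonglongrightarrow> 0" "\<And>n. h n \<noteq> 0"
  shows "(\<lambda>n. abs_lsq (\<lambda>x. (\<phi> (x + h n) - \<phi> x) / h n)) \<longlonglongrightarrow> abs_lsq (deriv \<phi>)"
proof -
  obtain B r where B: "B \<ge> 0" "r \<ge> 0" "\<And>x. \<bar>\<phi> x\<bar> \<le> B * indicator {-r..r} x"
    using test_fun_bounds[OF \<phi>] by metis
  obtain B' r' where B': "B' \<ge> 0" "r' \<ge> 0" "\<And>x. \<bar>deriv \<phi> x\<bar> \<le> B' * indicator {-r'..r'} x"
    using test_fun_bounds[OF test_fun_deriv[OF \<phi>]] by metis
  have "bounded (range h)" using h(1) by (simp add: convergent_imp_bounded)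
  then obtain M where M: "\<And>n. \<bar>h n\<bar> \<le> M" by (auto simp: bounded_iff)
  have meas: "\<phi> \<in> borel_measurable borel" "deriv \<phi> \<in> borel_measurable borel"
    by (auto intro!: L2_borel L2_test_fun test_fun_deriv \<phi>)
  note [measurable] = meas
  have mvt: "\<bar>\<phi> (x + k) - \<phi> x\<bar> \<le> B' * \<bar>k\<bar>" for x k
  proof -
    have "norm (\<phi> (x + k) - \<phi> x) \<le> B' * norm (x + k - x)"
    proof (rule field_differentiable_bound[of UNIV _ "deriv \<phi>"])
      show "norm (deriv \<phi> z) \<le> B'" for z
        using B'(3)[of z] B'(1) by (cases "z \<in> {-r'..r'}") auto
    qed (use test_fun_DERIV[OF \<phi>] in auto)
    then show ?thesis by simp
  qed
  \<comment> \<open>One dominating function for all \<open>n\<close>: the mean value theorem bounds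
    the quotient by \<open>B'\<close>, and |h n| <= M makes it vanish for |x| > r + M.\<close>
  have bd: "\<bar>(\<phi> (x + h n) - \<phi> x) / h n\<bar> \<le> \<bar>B' * indicator {-(r+M)..r+M} x\<bar>" for x n
  proof (cases "\<bar>x\<bar> \<le> r + M")
    case True
    have "\<bar>(\<phi> (x + h n) - \<phi> x) / h n\<bar> = \<bar>\<phi> (x + h n) - \<phi> x\<bar> / \<bar>h n\<bar>" by (simp add: abs_divide)
    also have "\<dots> \<le> B'" using mvt[of x "h n"] h(2)[of n] by (simp add: pos_divide_le_eq)
    finally show ?thesis using True B' by (simp add: indicator_def abs_le_iff)
  next
    case False
    then have "x \<notin> {-r..r}" "x + h n \<notin> {-r..r}" using M[of n] by auto
    then have "\<phi> x = 0" "\<phi> (x + h n) = 0" using B(3)[of x] B(3)[of "x + h n"] by auto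
    then show ?thesis by simp
  qed
  show ?thesis
  proof (intro lsq_dominated_tendsto[THEN conjunct2, THEN conjunct2])
    show "L2 (\<lambda>x. B' * indicator {-(r+M)..r+M} x)" by (intro L2_scale L2_indicator_interval)
    have "(\<lambda>n. (\<phi> (x + h n) - \<phi> x) / h n) \<longlonglongrightarrow> deriv \<phi> x" for x
    proof -
      have "((\<lambda>k. (\<phi> (x + k) - \<phi> x) / k) \<longlongrightarrow> deriv \<phi> x) (at 0)"
        using test_fun_DERIV[OF \<phi>, of x] by (simp add: DERIV_def)
      then show ?thesis
        using h by (auto simp: tendsto_at_iff_sequentially o_def)
    qed
    then show "AE x in lborel. (\<lambda>n. (\<phi> (x + h n) - \<phi> x) / h n) \<longlonglongrightarrow> deriv \<phi> x" by simp
    show "AE x in lborel. \<bar>(\<phi> (x + h n) - \<phi> x) / h n\<bar> \<le> \<bar>B' * indicator {-(r+M)..r+M} x\<bar>" for n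
      using bd by simp
  qed measurable
qed

text \<open>Difference quotients give the derivative at 0; the group law for shifts carries it to
  any \<open>t\<close>.\<close>

lemma test_shift_vderiv:
  assumes \<phi>: "test_fun \<phi>"
  shows "((\<lambda>s. shift s (abs_lsq \<phi>)) has_vector_derivative shift t (abs_lsq (deriv \<phi>))) (at t within A)"
proof -
  have L2: "L2 \<phi>" "L2 (\<lambda>x. \<phi> (x + k))" for k
    by (auto intro: L2_test_fun test_fun_shift \<phi>)
  have "((\<lambda>k. (shift (0 + k) (abs_lsq \<phi>) - shift 0 (abs_lsq \<phi>)) /\<^sub>R k) \<longlongrightarrow> abs_lsq (deriv \<phi>)) (at 0)"
    unfolding tendsto_at_iff_sequentially
  proof (intro allI impI)
    fix h :: "nat \<Rightarrow> real" assume h: "\<forall>i. h i \<in> UNIV - {0}" "h \<longlonglongrightarrow> 0"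
    have "(shift (0 + h n) (abs_lsq \<phi>) - shift 0 (abs_lsq \<phi>)) /\<^sub>R h n
        = abs_lsq (\<lambda>x. (\<phi> (x + h n) - \<phi> x) / h n)" for n
      using abs_lsq_scale[OF L2_diff[OF L2(2)[of "h n"] L2(1)], of "inverse (h n)"]
      by (simp add: shift_abs L2 abs_lsq_diff divide_inverse mult.commute)
    then show "((\<lambda>k. (shift (0 + k) (abs_lsq \<phi>) - shift 0 (abs_lsq \<phi>)) /\<^sub>R k) \<circ> h) \<longlonglongrightarrow> abs_lsq (deriv \<phi>)"
      using test_fun_difference_quotient[OF \<phi> h(2)] h(1) by (simp add: o_def)
  qed
  then have 0: "((\<lambda>s. shift s (abs_lsq \<phi>)) has_vector_derivative abs_lsq (deriv \<phi>)) (at 0)"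
    by (simp add: has_vector_derivative_quotient)
  have "((\<lambda>s. shift s (abs_lsq \<phi>)) \<circ> (\<lambda>s. s - t) has_vector_derivative 1 *\<^sub>R abs_lsq (deriv \<phi>)) (at t)"
    by (rule vector_diff_chain_at) (use 0 in \<open>auto intro!: derivative_eq_intros\<close>)
  then have "((\<lambda>s. shift t (shift (s - t) (abs_lsq \<phi>))) has_vector_derivative shift t (abs_lsq (deriv \<phi>))) (at t)"
    by (intro bounded_linear.has_vector_derivative[OF bounded_linear_shift]) (simp add: o_def)
  then show ?thesis
    by (simp add: shift_shift has_vector_derivative_at_within)
qed

text \<open>Shifts are isometries, so norm convergence of functions makes their orbits converge
  uniformly. The functions with continuous orbit thus form a closed subspace, which contains the
  test functions.\<close>

lemma continuous_on_shift: "continuous_on UNIV (\<lambda>s. shift s f)"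
proof -
  have "f \<in> {f. continuous_on UNIV (\<lambda>s. shift s f)}"
  proof (rule test_fun_dense)
    show "closed {f. continuous_on UNIV (\<lambda>s. shift s f)}"
      unfolding closed_sequential_limits
    proof (intro allI impI, elim conjE, unfold mem_Collect_eq)
      fix g l assume g: "\<forall>n. continuous_on UNIV (\<lambda>s. shift s (g n))" and lim: "g \<longlonglongrightarrow> l"
      show "continuous_on UNIV (\<lambda>s. shift s l)"
      proof (rule uniform_limit_theorem)
        show "uniform_limit UNIV (\<lambda>n s. shift s (g n)) (\<lambda>s. shift s l) sequentially"
        proof (rule uniform_limitI)
          fix e :: real assume "e > 0"
          with lim have "\<forall>\<^sub>F n in sequentially. dist (g n) l < e" by (rule tendstoD)
          then show "\<forall>\<^sub>F n in sequentially. \<forall>s\<in>UNIV. dist (shift s (g n)) (shift s l) < e"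
            by eventually_elim (simp add: dist_norm flip: shift_linear_simps)
        qed
      qed (use g in auto)
    qed
    show "subspace {f. continuous_on UNIV (\<lambda>s. shift s f)}"
      by (auto simp: subspace_def shift_linear_simps intro!: continuous_intros)
    show "abs_lsq \<phi> \<in> {f. continuous_on UNIV (\<lambda>s. shift s f)}" if "test_fun \<phi>" for \<phi>
      using continuous_on_vector_derivative[OF test_shift_vderiv[OF that]] by simp
  qed
  then show ?thesis by simp
qed

lemma tendsto_shift:
  assumes "(r \<longlongrightarrow> s) F" "(f \<longlongrightarrow> g) F"
  shows "((\<lambda>x. shift (r x) (f x)) \<longlongrightarrow> shift s g) F"
proof -
  have "((\<lambda>x. shift (r x) g) \<longlongrightarrow> shift s g) F"
    using continuous_on_shift[of g] by (intro isCont_tendsto_compose[OF _ assms(1)]) (simp add: continuous_on_eq_continuous_at)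
  moreover have "((\<lambda>x. shift (r x) (f x) - shift (r x) g) \<longlongrightarrow> 0) F"
  proof (rule Lim_null_comparison)
    show "\<forall>\<^sub>F x in F. norm (shift (r x) (f x) - shift (r x) g) \<le> norm (f x - g)"
      by (simp flip: shift_linear_simps)
    show "((\<lambda>x. norm (f x - g)) \<longlongrightarrow> 0) F"
      using assms(2) by (simp add: tendsto_norm_zero_iff LIM_zero_iff)
  qed
  ultimately show ?thesis
    using tendsto_add[of "\<lambda>x. shift (r x) (f x) - shift (r x) g" 0 F "\<lambda>x. shift (r x) g" "shift s g"] by simp
qed

lemma continuous_on_shift2:
  "continuous_on A r \<Longrightarrow> continuous_on A f \<Longrightarrow> continuous_on A (\<lambda>x. shift (r x) (f x))"
  unfolding continuous_on_def by (auto intro: tendsto_shift)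

text \<open>The weak derivative as a relation between classes: \<open>f\<close> lies in H^1 when it
  has a partner, and no choice of a representative enters.\<close>

definition weak_pair :: "lsq \<Rightarrow> lsq \<Rightarrow> bool" where
  "weak_pair f g \<longleftrightarrow> (\<forall>\<phi>. test_fun \<phi> \<longrightarrow> inner f (abs_lsq (deriv \<phi>)) = - inner g (abs_lsq \<phi>))"

lemma weak_deriv_iff:
  assumes "L2 f" "L2 g"
  shows "weak_deriv f g \<longleftrightarrow> weak_pair (abs_lsq f) (abs_lsq g)"
  unfolding weak_deriv_def weak_pair_def
  using assms by (auto simp: inner_abs_lsq L2_test_fun test_fun_deriv)

lemma weak_pair_unique:
  assumes "weak_pair f g" "weak_pair f g'"
  shows "g = g'"
  by (rule lsq_test_eqI) (use assms in \<open>auto simp: weak_pair_def\<close>)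

lemma wderiv_weak_pair:
  assumes "H1 f"
  shows "L2 (wderiv f)" "weak_pair (abs_lsq f) (abs_lsq (wderiv f))"
proof -
  have "\<exists>g. L2 g \<and> weak_deriv f g" using assms by (simp add: H1_def)
  then have "L2 (wderiv f) \<and> weak_deriv f (wderiv f)"
    unfolding wderiv_def by (rule someI_ex)
  then show "L2 (wderiv f)" "weak_pair (abs_lsq f) (abs_lsq (wderiv f))"
    using assms by (auto simp: weak_deriv_iff H1_def)
qed

lemma H1_rep:
  assumes "weak_pair f g"
  shows "H1 (rep_lsq f)" "abs_lsq (wderiv (rep_lsq f)) = g"
proof -
  show "H1 (rep_lsq f)"
    unfolding H1_def using assms by (auto simp: weak_deriv_iff intro!: exI[of _ "rep_lsq g"])
  from wderiv_weak_pair[OF this] show "abs_lsq (wderiv (rep_lsq f)) = g"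
    using assms by (auto intro: weak_pair_unique)
qed

lemma weak_pair_diff: "weak_pair f g \<Longrightarrow> weak_pair f' g' \<Longrightarrow> weak_pair (f - f') (g - g')"
  by (auto simp: weak_pair_def inner_diff_left)

text \<open>An H^1 function lies in the domain of the generator of translations. Tested with
  \<open>\<psi>\<close>, the difference of \<open>shift s f\<close> and the integral of
  \<open>shift r g\<close> is constant in \<open>s\<close>, and density turns this into an identity
  in L^2, which can be differentiated.\<close>

lemma weak_pair_shift_vderiv:
  assumes "weak_pair f g"
  shows "((\<lambda>s. shift s f) has_vector_derivative shift t g) (at t within A)"
proof -
  \<comment> \<open>Starting one unit to the left makes \<open>t\<close> an interior point, so that
    the derivative obtained is two-sided.\<close>
  define c where "c = t - 1"
  have cont: "continuous_on {c..b} (\<lambda>r. shift r g)" for b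
    by (rule continuous_on_subset[OF continuous_on_shift]) simp
  define G where "G s = integral {c..s} (\<lambda>r. shift r g)" for s
  have G: "(G has_vector_derivative shift s g) (at s within {c..t+1})" if "s \<in> {c..t+1}" for s
    unfolding G_def by (rule integral_has_vector_derivative[OF cont that])
  have eq: "shift s f - G s = shift c f" if s: "s \<in> {c..t+1}" for s
  proof (rule lsq_test_eqI)
    fix \<psi> assume \<psi>: "test_fun \<psi>"
    \<comment> \<open>With the shift moved onto the test function, the first term is differentiable
      before \<open>shift s f\<close> is known to be, and the weak relation applies to its
      derivative.\<close>
    define F where "F s = inner f (shift (- s) (abs_lsq \<psi>)) - inner (G s) (abs_lsq \<psi>)" for s
    have d0: "(F has_vector_derivative 0) (at r within {c..t+1})" if r: "r \<in> {c..t+1}" for r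
    proof -
      have "((\<lambda>s. shift s (abs_lsq \<psi>)) \<circ> uminus has_vector_derivative (-1) *\<^sub>R shift (- r) (abs_lsq (deriv \<psi>))) (at r within {c..t+1})"
        by (rule vector_diff_chain_within)
           (use test_shift_vderiv[OF \<psi>] in \<open>auto intro!: derivative_eq_intros\<close>)
      then have 1: "((\<lambda>s. inner f (shift (- s) (abs_lsq \<psi>))) has_vector_derivative inner f (- shift (- r) (abs_lsq (deriv \<psi>)))) (at r within {c..t+1})"
        by (intro bounded_linear.has_vector_derivative[OF bounded_linear_inner_right]) (simp add: o_def)
      have 2: "((\<lambda>s. inner (G s) (abs_lsq \<psi>)) has_vector_derivative inner (shift r g) (abs_lsq \<psi>)) (at r within {c..t+1})"
        by (intro bounded_linear.has_vector_derivative[OF bounded_linear_inner_left] G r)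
      have "shift (- r) (abs_lsq (deriv \<psi>)) = abs_lsq (deriv (\<lambda>x. \<psi> (x + - r)))"
      proof -
        have "deriv (\<lambda>x. \<psi> (x + - r)) = (\<lambda>x. deriv \<psi> (x + - r))"
          by (rule ext, rule DERIV_imp_deriv, subst DERIV_shift[symmetric])
             (simp add: test_fun_DERIV[OF \<psi>])
        then show ?thesis using \<psi> by (simp only: shift_abs[OF L2_test_fun[OF test_fun_deriv[OF \<psi>]]])
      qed
      then have "inner f (- shift (- r) (abs_lsq (deriv \<psi>))) = inner g (shift (- r) (abs_lsq \<psi>))"
        using assms test_fun_shift[OF \<psi>, of "- r"]
        by (simp add: weak_pair_def shift_abs[OF L2_test_fun[OF \<psi>]])
      then show ?thesis
        using has_vector_derivative_diff[OF 1 2] unfolding F_def by (simp add: inner_shift_left)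
    qed
    have "F s = F c"
      using has_vector_derivative_zero_constant[OF _ d0] s
      by (metis atLeastAtMost_iff c_def convex_closed_interval less_add_one less_eq_real_def diff_add_cancel order_trans)
    moreover have "F c = inner (shift c f) (abs_lsq \<psi>)"
      by (simp add: F_def G_def inner_shift_left)
    ultimately show "inner (shift s f - G s) (abs_lsq \<psi>) = inner (shift c f) (abs_lsq \<psi>)"
      by (simp add: F_def inner_diff_left inner_shift_left)
  qed
  have "((\<lambda>s. shift c f + G s) has_vector_derivative shift t g) (at t within {c..t+1})"
    using has_vector_derivative_add[OF has_vector_derivative_const G[of t]] by (simp add: c_def)
  then have d: "((\<lambda>s. shift c f + G s) has_vector_derivative shift t g) (at t)"
    by (subst (asm) at_within_interior) (auto simp: c_def)
  have *: "shift c f + G s = shift s f" if "s \<in> {c<..<t+1}" for s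
    using eq[of s] that by (simp add: diff_eq_eq)
  have "((\<lambda>s. shift s f) has_vector_derivative shift t g) (at t)"
    by (rule has_vector_derivative_transform_within_open[OF d, where S="{c<..<t+1}"])
       (use * in \<open>auto simp: c_def\<close>)
  then show ?thesis by (rule has_vector_derivative_at_within)
qed

section \<open>Linear evolution equations\<close>

lemma integral_atLeast_vderiv:
  fixes h :: "real \<Rightarrow> 'a::banach"
  assumes "continuous_on {0..} h" "t \<ge> 0"
  shows "((\<lambda>s. integral {0..s} h) has_vector_derivative h t) (at t within {0..})"
proof -
  have "((\<lambda>s. integral {0..s} h) has_vector_derivative h t) (at t within {0..t+1})"
    by (rule integral_has_vector_derivative) (use assms in \<open>auto intro: continuous_on_subset\<close>)
  moreover have "at t within {0..t+1} = at t within {0..}"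
    by (rule at_within_nhd[of t "{..<t+1}"]) auto
  ultimately show ?thesis by simp
qed

text \<open>Integrating exp (l s) gains a factor 1/l; this makes the Picard map contract.\<close>

lemma exp_weighted_integral_bound:
  fixes h :: "real \<Rightarrow> 'a::banach"
  assumes h: "continuous_on {0..} h" and t: "t \<ge> 0" and l: "l > 0" and C: "C \<ge> 0"
    and bd: "\<And>s. 0 \<le> s \<Longrightarrow> s \<le> t \<Longrightarrow> norm (h s) \<le> C * exp (l * s)"
  shows "exp (- l * t) * norm (integral {0..t} h) \<le> C / l"
proof -
  have hi: "((\<lambda>s. C * exp (l * s)) has_integral (C / l * exp (l * t) - C / l * exp (l * 0))) {0..t}"
    using t l by (intro fundamental_theorem_of_calculus)
      (auto intro!: derivative_eq_intros simp: has_real_derivative_iff_has_vector_derivative[symmetric])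
  have "norm (integral {0..t} h) \<le> integral {0..t} (\<lambda>s. C * exp (l * s))"
    by (rule integral_norm_bound_integral)
       (use h hi bd in \<open>auto intro!: integrable_continuous_real[of 0 t h] has_integral_integrable[OF hi] intro: continuous_on_subset\<close>)
  also have "\<dots> = C / l * exp (l * t) - C / l" using integral_unique[OF hi] by simp
  also have "\<dots> \<le> C / l * exp (l * t)" using C l by simp
  finally have "exp (- l * t) * norm (integral {0..t} h) \<le> exp (- l * t) * (C / l * exp (l * t))"
    by (intro mult_left_mono) auto
  also have "\<dots> = C / l" by (simp add: exp_minus field_simps)
  finally show ?thesis .
qed

text \<open>The Picard map is a contraction for the norm weighted by \<open>exp (- l * t)\<close> with large \<open>l\<close>,
  which gives a global solution in one step.\<close>

theorem linear_ode_exists: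
  fixes B :: "real \<Rightarrow> 'a::banach \<Rightarrow> 'a" and K :: "real \<Rightarrow> 'a set"
  assumes lip: "\<And>s x y. 0 \<le> s \<Longrightarrow> norm (B s x - B s y) \<le> M * norm (x - y)"
    and B0: "\<And>s. 0 \<le> s \<Longrightarrow> B s 0 = 0"
    and cont: "\<And>x. continuous_on {0..} x \<Longrightarrow> continuous_on {0..} (\<lambda>s. B s (x s))"
    and K: "\<And>t. 0 \<le> t \<Longrightarrow> closed (K t)" "\<And>t. 0 \<le> t \<Longrightarrow> 0 \<in> K t"
      "\<And>t c x. 0 \<le> t \<Longrightarrow> x \<in> K t \<Longrightarrow> c *\<^sub>R x \<in> K t"
    and inv: "\<And>x t. continuous_on {0..} x \<Longrightarrow> (\<And>s. 0 \<le> s \<Longrightarrow> x s \<in> K s) \<Longrightarrow> 0 \<le> t \<Longrightarrow>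
        x0 + integral {0..t} (\<lambda>s. B s (x s)) \<in> K t"
  shows "\<exists>x. continuous_on {0..} x \<and> (\<forall>t\<ge>0. x t \<in> K t \<and> x t = x0 + integral {0..t} (\<lambda>s. B s (x s)))"
proof -
  \<comment> \<open>With this \<open>l\<close> the factor |M| / l is at most 1/2, the contraction
    constant.\<close>
  define l where "l = 2 * \<bar>M\<bar> + 1"
  have l: "l > 0" by (simp add: l_def)
  define X :: "(real \<Rightarrow> 'a) \<Rightarrow> real \<Rightarrow> 'a" where "X y s = exp (l * s) *\<^sub>R y s" for y s
  define P where "P y t = exp (- l * t) *\<^sub>R (x0 + integral {0..t} (\<lambda>s. B s (X y s)))" for y t
  have X_cont: "continuous_on {0::real..} (X y)" if "continuous_on UNIV y" for y
    unfolding X_def by (intro continuous_intros continuous_on_subset[OF that]) auto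
  have BX_cont: "continuous_on {0..} (\<lambda>s. B s (X y s))" if "continuous_on UNIV y" for y
    by (intro cont X_cont that)
  have lip1: "norm (B s x - B s y) \<le> \<bar>M\<bar> * norm (x - y)" if "0 \<le> s" for s x y
    using lip[OF that, of x y] by (rule order_trans) (intro mult_right_mono, auto)
  have P_dist: "norm (P y t - P z t) \<le> (1/2) * b"
    if y: "continuous_on UNIV y" and z: "continuous_on UNIV z" and t: "0 \<le> t"
      and b: "\<And>s. norm (y s - z s) \<le> b" for y z t b
  proof -
    have b0: "b \<ge> 0" using b[of 0] norm_ge_zero order_trans by blast
    have i: "(\<lambda>s. B s (X w s)) integrable_on {0..t}" if "continuous_on UNIV w" for w
      by (intro integrable_continuous_real continuous_on_subset[OF BX_cont[OF that]]) auto
    have "P y t - P z t = exp (- l * t) *\<^sub>R integral {0..t} (\<lambda>s. B s (X y s) - B s (X z s))"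
      by (simp add: P_def integral_diff[OF i[OF y] i[OF z]] flip: scaleR_diff_right)
    then have "norm (P y t - P z t) = exp (- l * t) * norm (integral {0..t} (\<lambda>s. B s (X y s) - B s (X z s)))"
      by simp
    also have "\<dots> \<le> (\<bar>M\<bar> * b) / l"
    proof (rule exp_weighted_integral_bound)
      show "continuous_on {0..} (\<lambda>s. B s (X y s) - B s (X z s))"
        by (intro continuous_intros BX_cont y z)
      fix s :: real assume s: "0 \<le> s"
      have "norm (B s (X y s) - B s (X z s)) \<le> \<bar>M\<bar> * norm (X y s - X z s)" by (rule lip1[OF s])
      also have "X y s - X z s = exp (l * s) *\<^sub>R (y s - z s)" by (simp add: X_def scaleR_diff_right)
      also have "\<bar>M\<bar> * norm (exp (l * s) *\<^sub>R (y s - z s)) \<le> \<bar>M\<bar> * (exp (l * s) * b)"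
        using b[of s] by (intro mult_left_mono) auto
      finally show "norm (B s (X y s) - B s (X z s)) \<le> \<bar>M\<bar> * b * exp (l * s)" by (simp add: mult_ac)
    qed (use t l b0 in auto)
    also have "\<dots> \<le> (1/2) * b"
      using b0 l mult_right_mono[of "2 * \<bar>M\<bar>" l b] by (simp add: pos_divide_le_eq l_def field_simps)
    finally show ?thesis .
  qed
  have P_cont: "continuous_on {0..} (P y)" if "continuous_on UNIV y" for y
  proof -
    have "continuous_on {0..} (\<lambda>t. integral {0..t} (\<lambda>s. B s (X y s)))"
      using integral_atLeast_vderiv[OF BX_cont[OF that]] by (intro continuous_on_vector_derivative) auto
    then show ?thesis unfolding P_def by (intro continuous_intros)
  qed
  \<comment> \<open>Bounded continuous functions live on the whole line; \<open>max 0 t\<close>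
    continues the Picard image constantly to negative times, where \<open>S\<close> imposes no
    condition.\<close>
  define Q where "Q y = Bcontfun (\<lambda>t. P (apply_bcontfun y) (max 0 t))" for y
  have Q: "apply_bcontfun (Q y) t = P (apply_bcontfun y) (max 0 t)" for y t
  proof -
    have "(\<lambda>t. P (apply_bcontfun y) (max 0 t)) \<in> bcontfun"
    proof (rule bcontfun_normI)
      show "continuous_on UNIV (\<lambda>t. P (apply_bcontfun y) (max 0 t))"
        by (rule continuous_on_compose2[OF P_cont]) (auto intro!: continuous_intros)
      fix t :: real
      let ?t = "max 0 t"
      have "norm (P (apply_bcontfun y) ?t - P (\<lambda>_. 0) ?t) \<le> (1/2) * norm y"
        by (rule P_dist) (auto intro: norm_bounded)
      moreover have "norm (P (\<lambda>_. 0) ?t) \<le> norm x0"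
      proof -
        have "integral {0..?t} (\<lambda>s. B s (X (\<lambda>_. 0) s)) = 0"
          by (subst integral_cong[where g="\<lambda>_. 0"]) (simp_all add: X_def B0)
        then show ?thesis using l by (simp add: P_def mult_left_le_one_le mult_nonneg_nonneg)
      qed
      ultimately show "norm (P (apply_bcontfun y) ?t) \<le> (1/2) * norm y + norm x0"
        using norm_triangle_sub[of "P (apply_bcontfun y) ?t" "P (\<lambda>_. 0) ?t"] by linarith
    qed
    then show ?thesis by (simp add: Q_def Bcontfun_inverse)
  qed
  \<comment> \<open>The constraints \<open>K t\<close> are built into the complete space, so the
    fixed point satisfies them. Closure under scaling makes them insensitive to the weight exp (l
    t).\<close>
  define S where "S = PiC {0..} K"
  have "\<exists>!y\<in>S. Q y = y"
  proof (rule Banach_fix[where c="1/2"])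
    show "complete S"
      unfolding S_def complete_eq_closed by (intro closed_PiC) (use K in auto)
    have "0 \<in> S"
      using K(2) by (auto simp: S_def mem_PiC_iff)
    then show "S \<noteq> {}" by blast
    show "Q ` S \<subseteq> S"
    proof (safe)
      fix y assume y: "y \<in> S"
      show "Q y \<in> S" unfolding S_def mem_PiC_iff
      proof (intro Pi_I)
        fix t :: real assume t: "t \<in> {0..}"
        have "x0 + integral {0..t} (\<lambda>s. B s (X (apply_bcontfun y) s)) \<in> K t"
        proof (rule inv)
          show "continuous_on {0..} (X (apply_bcontfun y))" by (rule X_cont) simp
          show "X (apply_bcontfun y) s \<in> K s" if "0 \<le> s" for s
            using y that K(3) by (auto simp: X_def S_def mem_PiC_iff Pi_iff)
        qed (use t in auto)
        then show "apply_bcontfun (Q y) t \<in> K t" using t K(3) by (simp add: Q P_def)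
      qed
    qed
    fix y z assume "y \<in> S" "z \<in> S"
    show "dist (Q y) (Q z) \<le> 1/2 * dist y z"
    proof (rule dist_bound)
      fix t
      have "norm (apply_bcontfun y s - apply_bcontfun z s) \<le> dist y z" for s
        using dist_bounded[of y s z] by (simp add: dist_norm)
      then show "dist (apply_bcontfun (Q y) t) (apply_bcontfun (Q z) t) \<le> 1/2 * dist y z"
        unfolding Q dist_norm[of "P _ _"] by (intro P_dist) auto
    qed
  qed auto
  then obtain y where y: "y \<in> S" "Q y = y" by blast
  let ?x = "X (apply_bcontfun y)"
  have "?x t \<in> K t \<and> ?x t = x0 + integral {0..t} (\<lambda>s. B s (?x s))" if t: "t \<ge> 0" for t
  proof
    show "?x t \<in> K t" using y(1) t K(3) by (auto simp: X_def S_def mem_PiC_iff Pi_iff)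
    have "apply_bcontfun y t = P (apply_bcontfun y) t" using Q[of y t] y(2) t by simp
    then have "?x t = exp (l * t) *\<^sub>R P (apply_bcontfun y) t" by (simp add: X_def)
    then show "?x t = x0 + integral {0..t} (\<lambda>s. B s (?x s))" by (simp add: P_def flip: exp_add)
  qed
  then show ?thesis using X_cont[of "apply_bcontfun y"] by blast
qed

section \<open>Mild solutions\<close>

text \<open>The cutoff operator is bounded and linear, so it commutes with the integral.\<close>

lemma supported_integral:
  fixes t :: real
  assumes "continuous_on {0..t} h" "\<And>s. s \<in> {0..t} \<Longrightarrow> supported r (h s)"
  shows "supported r (integral {0..t} h)"
proof -
  let ?C = "multop (indicator {x. r < \<bar>x\<bar>})"
  have "?C (integral {0..t} h) = integral {0..t} (?C \<circ> h)"
    by (rule integral_linear[OF integrable_continuous_real[OF assms(1)] bounded_linear_cutoff, symmetric])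
  also have "\<dots> = integral {0..t} (\<lambda>_. 0)"
    by (rule integral_cong) (use assms(2) in \<open>auto simp: supported_iff\<close>)
  finally show ?thesis by (simp add: supported_iff)
qed

lemma supported_0: "supported r 0"
  unfolding supported_iff by (simp add: linear_0[OF bounded_linear.linear[OF bounded_linear_cutoff]])

text \<open>With \<open>p = u\<^sub>t + u\<^sub>x\<close> and \<open>q = u\<^sub>t - u\<^sub>x\<close>, the equation reads \<open>p\<^sub>t - p\<^sub>x = q\<^sub>t + q\<^sub>x = f\<close> with
  \<open>f = - V u - a u\<^sub>t\<close>. Along the characteristics, \<open>shift (-t) (p t)\<close> and \<open>shift t (q t)\<close> are
  differentiable in the sense of the norm of \<open>L\<^sup>2\<close>, even if \<open>p\<close> and \<open>q\<close> are not.\<close>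

locale damped_wave =
  fixes a V :: "real \<Rightarrow> real"
  assumes bmeas_a: "bmeas a" and bmeas_V: "bmeas V"
begin

definition force :: "lsq \<Rightarrow> lsq \<Rightarrow> lsq" where
  "force u v = - multop V u - multop a v"

definition avg :: "lsq \<Rightarrow> lsq \<Rightarrow> lsq" where
  "avg p q = (1/2) *\<^sub>R (p + q)"

definition mild :: "(real \<Rightarrow> lsq) \<Rightarrow> (real \<Rightarrow> lsq) \<Rightarrow> (real \<Rightarrow> lsq) \<Rightarrow> bool" where
  "mild u p q \<longleftrightarrow> (\<forall>t\<ge>0.
     (u has_vector_derivative avg (p t) (q t)) (at t within {0..}) \<and>
     ((\<lambda>s. shift (- s) (p s)) has_vector_derivative shift (- t) (force (u t) (avg (p t) (q t)))) (at t within {0..}) \<and>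
     ((\<lambda>s. shift s (q s)) has_vector_derivative shift t (force (u t) (avg (p t) (q t)))) (at t within {0..}))"

lemmas mult_linear_simps =
  linear_add[OF bounded_linear.linear[OF bounded_linear_mult]]
  linear_diff[OF bounded_linear.linear[OF bounded_linear_mult]]
  linear_cmul[OF bounded_linear.linear[OF bounded_linear_mult]]
  linear_neg[OF bounded_linear.linear[OF bounded_linear_mult]]
  linear_0[OF bounded_linear.linear[OF bounded_linear_mult]]

lemma force_diff: "force u v - force u' v' = force (u - u') (v - v')"
  by (simp add: force_def mult_linear_simps bmeas_a bmeas_V)

lemma force_0: "force 0 0 = 0"
  by (simp add: force_def mult_linear_simps bmeas_a bmeas_V)

lemma avg_diff: "avg p q - avg p' q' = avg (p - p') (q - q')"
  by (simp add: avg_def algebra_simps)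

lemma norm_avg: "norm (avg p q) \<le> (norm p + norm q) / 2"
  using norm_triangle_ineq[of p q] by (simp add: avg_def)

lemma norm_force: "\<exists>C\<ge>0. \<forall>u v. norm (force u v) \<le> C * (norm u + norm v)"
proof -
  obtain Ca where Ca: "Ca > 0" "\<And>f. norm (multop a f) \<le> norm f * Ca"
    using bounded_linear.pos_bounded[OF bounded_linear_mult[OF bmeas_a]] by auto
  obtain CV where CV: "CV > 0" "\<And>f. norm (multop V f) \<le> norm f * CV"
    using bounded_linear.pos_bounded[OF bounded_linear_mult[OF bmeas_V]] by auto
  have "norm (force u v) \<le> (Ca + CV) * (norm u + norm v)" for u v
  proof -
    have "norm (force u v) \<le> norm (multop V u) + norm (multop a v)"
      unfolding force_def using norm_triangle_ineq4[of "- multop V u" "multop a v"] by simp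
    also have "\<dots> \<le> norm u * CV + norm v * Ca" using Ca CV by (intro add_mono)
    also have "\<dots> \<le> (Ca + CV) * (norm u + norm v)" using Ca CV by (simp add: algebra_simps)
    finally show ?thesis .
  qed
  with Ca CV show ?thesis by (intro exI[of _ "Ca + CV"]) auto
qed

lemma continuous_on_mult: "bmeas m \<Longrightarrow> continuous_on A f \<Longrightarrow> continuous_on A (\<lambda>x. multop m (f x))"
  by (rule bounded_linear.continuous_on[OF bounded_linear_mult])

lemma continuous_on_force:
  "continuous_on A u \<Longrightarrow> continuous_on A v \<Longrightarrow> continuous_on A (\<lambda>s. force (u s) (v s))"
  unfolding force_def by (intro continuous_intros continuous_on_mult bmeas_a bmeas_V)

lemma supported_force: "supported r u \<Longrightarrow> supported r v \<Longrightarrow> supported r (force u v)"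
  unfolding force_def
  by (metis bmeas_a bmeas_V diff_0 supported_0 supported_diff supported_mult)

lemma supported_avg: "supported r p \<Longrightarrow> supported r q \<Longrightarrow> supported r (avg p q)"
  unfolding avg_def by (intro supported_scaleR supported_add)

text \<open>Finite speed of propagation comes along with existence: the support condition is a
  closed set that the Picard map preserves, so no energy estimate on cones is involved.\<close>

lemma mild_exists:
  assumes "supported R u0" "supported R p0" "supported R q0"
  shows "\<exists>u p q. mild u p q \<and> u 0 = u0 \<and> p 0 = p0 \<and> q 0 = q0 \<and> (\<forall>t\<ge>0. supported (R + t) (u t) \<and> supported (R + t) (avg (p t) (q t)))"
proof -
  \<comment> \<open>The unknown \<open>z\<close> consists of \<open>u\<close> and the pulled back
    invariants \<open>shift (- s) (p s)\<close> and \<open>shift s (q s)\<close>; \<open>v\<close>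
    restores u_t. In these variables no space derivative is left, and \<open>B s\<close> is bounded
    uniformly in \<open>s\<close>.\<close>
  define v where "v s z = avg (shift s (fst (snd z))) (shift (- s) (snd (snd z)))" for s and z :: "lsq \<times> lsq \<times> lsq"
  define f where "f s z = force (fst z) (v s z)" for s z
  define B where "B s z = (v s z, shift (- s) (f s z), shift s (f s z))" for s z
  \<comment> \<open>In the original variables: \<open>u\<close>, \<open>p\<close> and
    \<open>q\<close> at time \<open>t\<close> vanish for |x| > R + t.\<close>
  define K where "K t = {z. supported (R + t) (fst z) \<and> supported (R + t) (shift t (fst (snd z)))
      \<and> supported (R + t) (shift (- t) (snd (snd z)))}" for t
  obtain C where C: "C \<ge> 0" "\<And>u v. norm (force u v) \<le> C * (norm u + norm v)"
    using norm_force by auto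
  have v_diff: "v s z - v s w = v s (z - w)" for s z w
    by (simp add: v_def avg_diff shift_linear_simps)
  have f_diff: "f s z - f s w = f s (z - w)" for s z w
    by (simp add: f_def force_diff v_diff)
  have B_diff: "B s z - B s w = B s (z - w)" for s z w
    by (simp add: B_def v_diff f_diff flip: shift_linear_simps)
  have norm_parts: "norm (fst z) \<le> norm z" "norm (fst (snd z)) \<le> norm z" "norm (snd (snd z)) \<le> norm z"
    for z :: "lsq \<times> lsq \<times> lsq"
    using norm_fst_le[of "fst z" "snd z"] norm_snd_le[of "snd z" "fst z"]
      norm_fst_le[of "fst (snd z)" "snd (snd z)"] norm_snd_le[of "snd (snd z)" "fst (snd z)"] by auto
  have nv: "norm (v s z) \<le> norm z" for s z
    using norm_avg[of "shift s (fst (snd z))" "shift (- s) (snd (snd z))"] norm_parts[of z] by (simp add: v_def)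
  have nf: "norm (f s z) \<le> 2 * C * norm z" for s z
  proof -
    have "norm (f s z) \<le> C * (norm (fst z) + norm (v s z))" unfolding f_def by (rule C(2))
    also have "\<dots> \<le> C * (norm z + norm z)" using C(1) nv norm_parts by (intro mult_left_mono add_mono)
    finally show ?thesis by simp
  qed
  \<comment> \<open>The constant adds 1 for \<open>v\<close> and 2 C for each of the two shifted
    copies of the force.\<close>
  have nB: "norm (B s z) \<le> (1 + 4 * C) * norm z" for s z
  proof -
    have "norm (B s z) \<le> norm (v s z) + (norm (f s z) + norm (f s z))"
      unfolding B_def using norm_Pair_le[of "v s z" "(shift (- s) (f s z), shift s (f s z))"]
        norm_Pair_le[of "shift (- s) (f s z)" "shift s (f s z)"] by simp
    then show ?thesis using nv[of s z] nf[of s z] by (simp add: algebra_simps)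
  qed
  have v_cont: "continuous_on {0..} (\<lambda>s. v s (x s))" if "continuous_on {0..} x" for x
    unfolding v_def avg_def by (intro continuous_intros continuous_on_shift2 that)
  have f_cont: "continuous_on {0..} (\<lambda>s. f s (x s))" if "continuous_on {0..} x" for x
    unfolding f_def by (intro continuous_on_force v_cont continuous_intros that)
  have B_cont: "continuous_on {0..} (\<lambda>s. B s (x s))" if "continuous_on {0..} x" for x
    unfolding B_def by (intro continuous_intros continuous_on_shift2 v_cont f_cont that)
  have "\<exists>x. continuous_on {0..} x \<and> (\<forall>t\<ge>0. x t \<in> K t \<and> x t = (u0, p0, q0) + integral {0..t} (\<lambda>s. B s (x s)))"
  proof (rule linear_ode_exists)
    show "norm (B s x - B s y) \<le> (1 + 4 * C) * norm (x - y)" for s x y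
      unfolding B_diff by (rule nB)
    show "B s 0 = 0" for s
      by (simp add: B_def f_def v_def avg_def shift_linear_simps force_0 flip: zero_prod_def)
    show "closed (K t)" for t
    proof -
      have "K t = fst -` {f. supported (R + t) f} \<inter> (\<lambda>z. shift t (fst (snd z))) -` {f. supported (R + t) f}
          \<inter> (\<lambda>z. shift (- t) (snd (snd z))) -` {f. supported (R + t) f}"
        by (auto simp: K_def)
      then show ?thesis
        by (simp only:) (intro closed_Int closed_vimage closed_supported continuous_intros continuous_on_shift2)
    qed
    show "0 \<in> K t" for t by (simp add: K_def shift_linear_simps supported_0)
    show "c *\<^sub>R x \<in> K t" if "x \<in> K t" for c x t
      using that by (simp add: K_def shift_linear_simps supported_scaleR)
    fix x :: "real \<Rightarrow> lsq \<times> lsq \<times> lsq" and t :: real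
    assume x: "continuous_on {0..} x" "\<And>s. 0 \<le> s \<Longrightarrow> x s \<in> K s" and t: "0 \<le> t"
    have sub: "continuous_on {0..t} g" if "continuous_on {0..} g" for g :: "real \<Rightarrow> 'b::topological_space"
      by (rule continuous_on_subset[OF that]) auto
    have vs: "supported (R + s) (v s (x s))" if "0 \<le> s" for s
      using x(2)[OF that] unfolding v_def K_def by (auto intro: supported_avg)
    have fs: "supported (R + s) (f s (x s))" if "0 \<le> s" for s
      using x(2)[OF that] vs[OF that] unfolding f_def K_def by (auto intro: supported_force)
    have i: "(\<lambda>s. B s (x s)) integrable_on {0..t}"
      by (intro integrable_continuous_real sub B_cont x)
    have 1: "fst (integral {0..t} (\<lambda>s. B s (x s))) = integral {0..t} (\<lambda>s. v s (x s))"
      using integral_linear[OF i bounded_linear_fst] by (simp add: o_def B_def)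
    have 2: "shift t (fst (snd (integral {0..t} (\<lambda>s. B s (x s))))) = integral {0..t} (\<lambda>s. shift (t - s) (f s (x s)))"
      using integral_linear[OF i bounded_linear_compose[OF bounded_linear_shift[of t] bounded_linear_compose[OF bounded_linear_fst bounded_linear_snd]]]
      by (simp add: o_def B_def shift_shift)
    have 3: "shift (- t) (snd (snd (integral {0..t} (\<lambda>s. B s (x s))))) = integral {0..t} (\<lambda>s. shift (s - t) (f s (x s)))"
      using integral_linear[OF i bounded_linear_compose[OF bounded_linear_shift[of "- t"] bounded_linear_compose[OF bounded_linear_snd bounded_linear_snd]]]
      by (simp add: o_def B_def shift_shift)
    have "supported (R + t) (integral {0..t} (\<lambda>s. v s (x s)))"
    proof (rule supported_integral)
      show "continuous_on {0..t} (\<lambda>s. v s (x s))" by (intro sub v_cont x)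
      show "supported (R + t) (v s (x s))" if "s \<in> {0..t}" for s
        using that by (intro supported_mono[OF vs]) auto
    qed
    moreover have "supported (R + t) (integral {0..t} (\<lambda>s. shift (t - s) (f s (x s))))"
    proof (rule supported_integral)
      show "continuous_on {0..t} (\<lambda>s. shift (t - s) (f s (x s)))"
        by (intro continuous_on_shift2 continuous_intros sub f_cont x)
      \<comment> \<open>The force at time \<open>s\<close> lives in |x| <= R + s and travels the
        distance t - s until time \<open>t\<close>.\<close>
      show "supported (R + t) (shift (t - s) (f s (x s)))" if "s \<in> {0..t}" for s
        using supported_shift[OF fs[of s], of "t - s"] that by simp
    qed
    moreover have "supported (R + t) (integral {0..t} (\<lambda>s. shift (s - t) (f s (x s))))"
    proof (rule supported_integral)
      show "continuous_on {0..t} (\<lambda>s. shift (s - t) (f s (x s)))"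
        by (intro continuous_on_shift2 continuous_intros sub f_cont x)
      show "supported (R + t) (shift (s - t) (f s (x s)))" if "s \<in> {0..t}" for s
        using supported_shift[OF fs[of s], of "s - t"] that by simp
    qed
    moreover have "supported (R + t) u0" "supported (R + t) (shift t p0)" "supported (R + t) (shift (- t) q0)"
      using supported_mono[OF assms(1), of "R + t"] supported_shift[OF assms(2), of t] supported_shift[OF assms(3), of "- t"] t by auto
    ultimately show "(u0, p0, q0) + integral {0..t} (\<lambda>s. B s (x s)) \<in> K t"
      by (simp add: K_def 1 2 3 shift_linear_simps supported_add)
  qed (rule B_cont)
  then obtain x where x: "continuous_on {0..} x" "\<And>t. t \<ge> 0 \<Longrightarrow> x t \<in> K t"
    "\<And>t. t \<ge> 0 \<Longrightarrow> x t = (u0, p0, q0) + integral {0..t} (\<lambda>s. B s (x s))" by blast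
  define u p q where "u t = fst (x t)" and "p t = shift t (fst (snd (x t)))" and "q t = shift (- t) (snd (snd (x t)))" for t
  have x': "(x has_vector_derivative B t (x t)) (at t within {0..})" if t: "t \<ge> 0" for t
  proof (rule has_vector_derivative_transform)
    show "((\<lambda>s. (u0, p0, q0) + integral {0..s} (\<lambda>s. B s (x s))) has_vector_derivative B t (x t)) (at t within {0..})"
      using has_vector_derivative_add[OF has_vector_derivative_const integral_atLeast_vderiv[OF B_cont[OF x(1)] t]] by simp
  qed (use x(3) t in auto)
  have vt: "v t (x t) = avg (p t) (q t)" for t by (simp add: v_def p_def q_def)
  have "mild u p q"
    unfolding mild_def
  proof (intro allI impI conjI)
    fix t :: real assume t: "t \<ge> 0"
    show "(u has_vector_derivative avg (p t) (q t)) (at t within {0..})"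
      using bounded_linear.has_vector_derivative[OF bounded_linear_fst x'[OF t]]
      by (simp add: u_def[abs_def] B_def vt)
    have ps: "shift (- s) (p s) = fst (snd (x s))" "shift s (q s) = snd (snd (x s))" for s
      by (simp_all add: p_def q_def shift_shift)
    show "((\<lambda>s. shift (- s) (p s)) has_vector_derivative shift (- t) (force (u t) (avg (p t) (q t)))) (at t within {0..})"
      using bounded_linear.has_vector_derivative[OF bounded_linear_compose[OF bounded_linear_fst bounded_linear_snd] x'[OF t]]
      by (simp add: u_def B_def f_def vt ps)
    show "((\<lambda>s. shift s (q s)) has_vector_derivative shift t (force (u t) (avg (p t) (q t)))) (at t within {0..})"
      using bounded_linear.has_vector_derivative[OF bounded_linear_compose[OF bounded_linear_snd bounded_linear_snd] x'[OF t]]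
      by (simp add: u_def B_def f_def vt ps)
  qed
  moreover have "u 0 = u0" "p 0 = p0" "q 0 = q0"
    using x(3)[of 0] by (simp_all add: u_def p_def q_def)
  moreover have "supported (R + t) (u t)" "supported (R + t) (avg (p t) (q t))" if "t \<ge> 0" for t
    using x(2)[OF that] by (auto simp: K_def u_def p_def q_def intro: supported_avg)
  ultimately show ?thesis by blast
qed

end

section \<open>Time derivatives of inner products and of transported functions\<close>

lemma deriv_nonpos_le:
  fixes f :: "real \<Rightarrow> real"
  assumes "0 \<le> a" "a \<le> b"
    and "\<And>x. a \<le> x \<Longrightarrow> x \<le> b \<Longrightarrow> (f has_real_derivative f' x) (at x within {0..})"
    and "\<And>x. a \<le> x \<Longrightarrow> x \<le> b \<Longrightarrow> f' x \<le> 0"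
  shows "f b \<le> f a"
proof (cases "a = b")
  case False
  with assms(2) have "a < b" by simp
  have "\<exists>x\<in>{a<..<b}. f b - f a = (\<lambda>h. f' x * h) (b - a)"
  proof (rule mvt_simple)
    fix x assume "a \<le> x" "x \<le> b"
    then show "(f has_derivative (\<lambda>h. f' x * h)) (at x within {a..b})"
      using assms(1) assms(3)[of x]
      by (auto simp: has_field_derivative_def intro: has_derivative_subset)
  qed fact
  then obtain x where x: "x \<in> {a<..<b}" "f b - f a = f' x * (b - a)" by blast
  moreover have "f' x * (b - a) \<le> 0"
    using x(1) assms(4)[of x] by (intro mult_nonpos_nonneg) auto
  ultimately show ?thesis using x(2) by linarith
qed simp

lemma norm_sq_deriv:
  assumes "(f has_vector_derivative f') (at t within S)"
  shows "((\<lambda>s. (norm (f s))\<^sup>2) has_real_derivative 2 * inner (f t) f') (at t within S)"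
  using bounded_bilinear.has_vector_derivative[OF bounded_bilinear_inner assms assms]
  by (simp add: has_real_derivative_iff_has_vector_derivative power2_norm_eq_inner inner_commute)

lemma inner_const_deriv:
  assumes "(f has_vector_derivative f') (at t within S)"
  shows "((\<lambda>s. inner (f s) g) has_real_derivative inner f' g) (at t within S)"
  using bounded_linear.has_vector_derivative[OF bounded_linear_inner_left assms]
  by (simp add: has_real_derivative_iff_has_vector_derivative)

text \<open>A product rule for a factor that is differentiable only when tested with the fixed
  \<open>f t\<close>. In the difference quotient the increment of \<open>f\<close>, which converges
  in norm, is paired with \<open>v s\<close>, for which continuity suffices.\<close>

lemma inner_weak_product:
  assumes v: "(v \<longlongrightarrow> v t) (at t within S)"
    and f: "(f has_vector_derivative f') (at t within S)"
    and d: "((\<lambda>s. inner (v s) (f t)) has_real_derivative d) (at t within S)"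
  shows "((\<lambda>s. inner (v s) (f s)) has_real_derivative d + inner (v t) f') (at t within S)"
proof -
  have "((\<lambda>s. (inner (v s) (f t) - inner (v t) (f t)) /\<^sub>R (s - t) + inner (v s) ((f s - f t) /\<^sub>R (s - t)))
      \<longlongrightarrow> d + inner (v t) f') (at t within S)"
    using d f unfolding has_real_derivative_iff_has_vector_derivative has_vector_derivative_quotient
    by (intro tendsto_add tendsto_inner v)
  moreover have "(inner (v s) (f t) - inner (v t) (f t)) /\<^sub>R (s - t) + inner (v s) ((f s - f t) /\<^sub>R (s - t))
      = (inner (v s) (f s) - inner (v t) (f t)) /\<^sub>R (s - t)" for s
    by (simp add: inner_diff_right algebra_simps)
  ultimately show ?thesis
    by (simp add: has_real_derivative_iff_has_vector_derivative has_vector_derivative_quotient)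
qed

lemma shift_scaled_vderiv:
  assumes "weak_pair f g"
  shows "((\<lambda>s. shift (c * s) f) has_vector_derivative c *\<^sub>R shift (c * t) g) (at t within A)"
proof -
  have "((\<lambda>s. shift s f) \<circ> (\<lambda>s. c * s) has_vector_derivative c *\<^sub>R shift (c * t) g) (at t within A)"
    by (rule vector_diff_chain_within)
       (use weak_pair_shift_vderiv[OF assms] in \<open>auto intro!: derivative_eq_intros\<close>)
  then show ?thesis by (simp add: o_def)
qed

text \<open>Integration by parts from translation invariance: the inner product of two functions
  shifted together is constant, so its derivative at 0 vanishes.\<close>

lemma weak_pair_test: "test_fun \<phi> \<Longrightarrow> weak_pair (abs_lsq \<phi>) (abs_lsq (deriv \<phi>))"
proof -
  assume \<phi>: "test_fun \<phi>"
  show ?thesis unfolding weak_pair_def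
  proof (intro allI impI)
    fix \<psi> assume \<psi>: "test_fun \<psi>"
    define G where "G s = inner (shift s (abs_lsq \<phi>)) (shift s (abs_lsq \<psi>))" for s
    have "(G has_vector_derivative inner (shift 0 (abs_lsq \<phi>)) (shift 0 (abs_lsq (deriv \<psi>))) + inner (shift 0 (abs_lsq (deriv \<phi>))) (shift 0 (abs_lsq \<psi>))) (at 0)"
      unfolding G_def
      by (rule bounded_bilinear.has_vector_derivative[OF bounded_bilinear_inner test_shift_vderiv[OF \<phi>] test_shift_vderiv[OF \<psi>]])
    moreover have "G = (\<lambda>s. inner (abs_lsq \<phi>) (abs_lsq \<psi>))"
      by (rule ext) (simp add: G_def inner_shift)
    then have "(G has_vector_derivative 0) (at 0)" by simp
    ultimately have "inner (abs_lsq \<phi>) (abs_lsq (deriv \<psi>)) + inner (abs_lsq (deriv \<phi>)) (abs_lsq \<psi>) = 0"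
      using vector_derivative_unique_at by fastforce
    then show "inner (abs_lsq \<phi>) (abs_lsq (deriv \<psi>)) = - inner (abs_lsq (deriv \<phi>)) (abs_lsq \<psi>)" by simp
  qed
qed

text \<open>The next two lemmas relate the strong form \<open>d/dt (shift (- c t) (p t)) = shift (- c t) (F t)\<close> and the
  weak form of the transport equation \<open>p\<^sub>t = c p\<^sub>x + F\<close>.\<close>

lemma transport_weak:
  assumes P: "((\<lambda>s. shift (- c * s) (p s)) has_vector_derivative shift (- c * t) F) (at t within A)"
    and w: "weak_pair f g"
  shows "((\<lambda>s. inner (p s) f) has_real_derivative inner F f - c * inner (p t) g) (at t within A)"
proof -
  have "((\<lambda>s. inner (shift (- c * s) (p s)) (shift (- c * s) f)) has_vector_derivative
      inner (shift (- c * t) (p t)) ((- c) *\<^sub>R shift (- c * t) g) + inner (shift (- c * t) F) (shift (- c * t) f)) (at t within A)"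
    by (rule bounded_bilinear.has_vector_derivative[OF bounded_bilinear_inner P shift_scaled_vderiv[OF w]])
  then show ?thesis
    by (simp add: has_real_derivative_iff_has_vector_derivative inner_shift algebra_simps)
qed

lemma transport_strong:
  assumes p: "continuous_on {0..} p" and F: "continuous_on {0..} F"
    and w: "\<And>\<phi> t. test_fun \<phi> \<Longrightarrow> t > 0 \<Longrightarrow>
      ((\<lambda>s. inner (p s) (abs_lsq \<phi>)) has_real_derivative
        inner (F t) (abs_lsq \<phi>) - c * inner (p t) (abs_lsq (deriv \<phi>))) (at t)"
    and t: "t \<ge> 0"
  shows "((\<lambda>s. shift (- c * s) (p s)) has_vector_derivative shift (- c * t) (F t)) (at t within {0..})"
proof -
  define h where "h s = shift (- c * s) (F s)" for s
  have h: "continuous_on {0..} h"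
    unfolding h_def by (intro continuous_on_shift2 F continuous_intros)
  define G where "G s = integral {0..s} h" for s
  have G: "(G has_vector_derivative h s) (at s within {0..})" if "s \<ge> 0" for s
    unfolding G_def using h that by (rule integral_atLeast_vderiv)
  have eq: "shift (- c * s) (p s) - G s = p 0" if s: "s \<ge> 0" for s
  proof (rule lsq_test_eqI)
    fix \<phi> assume \<phi>: "test_fun \<phi>"
    \<comment> \<open>The test function moves along with the characteristics: its time derivative
      cancels the transport term of the weak equation, and \<open>G\<close> cancels the
      source.\<close>
    let ?f = "\<lambda>s. inner (p s) (shift (c * s) (abs_lsq \<phi>)) - inner (G s) (abs_lsq \<phi>)"
    have f_alt: "?f s = inner (shift (- c * s) (p s) - G s) (abs_lsq \<phi>)" for s
      by (simp add: inner_diff_left inner_shift_left)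
    have Gc: "continuous_on {0..} G"
      using G by (intro continuous_on_vector_derivative) auto
    have "?f s = ?f 0"
    proof (cases "s = 0")
      case False
      with s have "0 < s" by simp
      \<comment> \<open>The weak equation is given for positive times only; time 0 is reached by
        continuity.\<close>
      then show ?thesis
      proof (rule DERIV_isconst_end)
        show "continuous_on {0..s} ?f"
          by (intro continuous_intros continuous_on_shift2 continuous_on_subset[OF p] continuous_on_subset[OF Gc]) auto
        fix r assume r: "0 < r" "r < s"
        have "at r within {0..} = at r" using r by (intro at_within_interior) auto
        moreover have "(p \<longlongrightarrow> p r) (at r within {0..})" using p r by (simp add: continuous_on_def)
        ultimately have G': "(G has_vector_derivative h r) (at r)" and p': "(p \<longlongrightarrow> p r) (at r)"
          using G[of r] r by auto
        have sh: "shift (c * r) (abs_lsq \<phi>) = abs_lsq (\<lambda>x. \<phi> (x + c * r))"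
            "shift (c * r) (abs_lsq (deriv \<phi>)) = abs_lsq (deriv (\<lambda>x. \<phi> (x + c * r)))"
        proof -
          have "deriv (\<lambda>x. \<phi> (x + c * r)) = (\<lambda>x. deriv \<phi> (x + c * r))"
            by (rule ext, rule DERIV_imp_deriv, subst DERIV_shift[symmetric])
               (simp add: test_fun_DERIV[OF \<phi>])
          then show "shift (c * r) (abs_lsq (deriv \<phi>)) = abs_lsq (deriv (\<lambda>x. \<phi> (x + c * r)))"
            by (simp only: shift_abs[OF L2_test_fun[OF test_fun_deriv[OF \<phi>]]])
        qed (simp add: shift_abs L2_test_fun \<phi>)
        have "((\<lambda>s. inner (p s) (shift (c * s) (abs_lsq \<phi>))) has_real_derivative
            (inner (F r) (shift (c * r) (abs_lsq \<phi>)) - c * inner (p r) (shift (c * r) (abs_lsq (deriv \<phi>))))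
              + inner (p r) (c *\<^sub>R shift (c * r) (abs_lsq (deriv \<phi>)))) (at r)"
          by (rule inner_weak_product[OF p' shift_scaled_vderiv[OF weak_pair_test[OF \<phi>]]])
             (use w[OF test_fun_shift[OF \<phi>] r(1)] in \<open>simp add: sh\<close>)
        from DERIV_diff[OF this inner_const_deriv[OF G', of "abs_lsq \<phi>"]]
        show "(?f has_real_derivative 0) (at r)"
          by (simp add: h_def inner_shift_left)
      qed
    qed simp
    then show "inner (shift (- c * s) (p s) - G s) (abs_lsq \<phi>) = inner (p 0) (abs_lsq \<phi>)"
      by (simp only: f_alt[symmetric]) (simp add: G_def)
  qed
  have "((\<lambda>s. p 0 + G s) has_vector_derivative h t) (at t within {0..})"
    using has_vector_derivative_add[OF has_vector_derivative_const G[OF t]] by simp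
  then have "((\<lambda>s. shift (- c * s) (p s)) has_vector_derivative h t) (at t within {0..})"
    by (rule has_vector_derivative_transform[rotated 2]) (use eq t in \<open>auto simp: diff_eq_eq\<close>)
  then show ?thesis by (simp add: h_def)
qed

lemma const_atLeast:
  fixes f :: "real \<Rightarrow> 'b::real_inner"
  assumes "\<And>t. t \<ge> 0 \<Longrightarrow> (f has_vector_derivative 0) (at t within {0..})" "t \<ge> 0"
  shows "f t = f 0"
  using has_vector_derivative_zero_constant[of "{0..}" f] assms by (metis atLeast_iff convex_real_interval(1) order_refl)

section \<open>Energy identity, compatibility of the invariants with u, and uniqueness\<close>

context damped_wave
begin

text \<open>\<open>avg\<close> and \<open>half_diff\<close> recover \<open>u\<^sub>t\<close> and \<open>u\<^sub>x\<close> from \<open>p\<close> and \<open>q\<close>.\<close>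

definition half_diff :: "lsq \<Rightarrow> lsq \<Rightarrow> lsq" where
  "half_diff p q = (1/2) *\<^sub>R (p - q)"

text \<open>The energy E in Riemann invariants: |p|^2 + |q|^2 = 2 (|u_t|^2 + |u_x|^2) by the
  parallelogram identity. In this form each term is differentiable in time.\<close>

definition char_energy :: "lsq \<Rightarrow> lsq \<Rightarrow> lsq \<Rightarrow> real" where
  "char_energy u p q = ((norm p)\<^sup>2 + (norm q)\<^sup>2) / 4 + inner (multop V u) u / 2"

lemma char_energy_eq: "char_energy u p q = ((norm (avg p q))\<^sup>2 + (norm (half_diff p q))\<^sup>2 + inner (multop V u) u) / 2"
  by (simp add: char_energy_def avg_def half_diff_def power2_norm_eq_inner inner_add inner_diff field_simps)

text \<open>\<open>p\<close> and \<open>q\<close> are only continuous: each is a differentiable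
  pulled back function, shifted back by an amount that varies with time.\<close>

lemma mild_continuous:
  assumes "mild u p q"
  shows "continuous_on {0..} u" "continuous_on {0..} p" "continuous_on {0..} q"
    "continuous_on {0..} (\<lambda>t. avg (p t) (q t))" "continuous_on {0..} (\<lambda>t. half_diff (p t) (q t))"
proof -
  show "continuous_on {0..} u"
    using assms unfolding mild_def by (intro continuous_on_vector_derivative) auto
  have "continuous_on {0..} (\<lambda>s. shift s (shift (- s) (p s)))" "continuous_on {0..} (\<lambda>s. shift (- s) (shift s (q s)))"
    using assms unfolding mild_def
    by (intro continuous_on_shift2 continuous_intros continuous_on_vector_derivative; force)+
  then show pq: "continuous_on {0..} p" "continuous_on {0..} q" by (simp_all add: shift_shift)
  then show "continuous_on {0..} (\<lambda>t. avg (p t) (q t))" "continuous_on {0..} (\<lambda>t. half_diff (p t) (q t))"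
    unfolding avg_def half_diff_def by (auto intro!: continuous_intros)
qed

lemma mild_diff:
  assumes "mild u p q" "mild u' p' q'"
  shows "mild (\<lambda>t. u t - u' t) (\<lambda>t. p t - p' t) (\<lambda>t. q t - q' t)"
  using assms unfolding mild_def
  by (auto intro!: has_vector_derivative_diff
      simp: shift_linear_simps avg_diff[symmetric] force_diff[symmetric])

lemma mult_quadratic_deriv:
  assumes "bmeas m" "(f has_vector_derivative f') (at t within S)"
  shows "((\<lambda>s. inner (multop m (f s)) (f s)) has_real_derivative 2 * inner (multop m (f t)) f') (at t within S)"
  using bounded_bilinear.has_vector_derivative[OF bounded_bilinear_inner
      bounded_linear.has_vector_derivative[OF bounded_linear_mult[OF assms(1)] assms(2)] assms(2)]
  by (simp add: has_real_derivative_iff_has_vector_derivative inner_mult_commute[OF assms(1), of f'] inner_commute[of f'])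

text \<open>The norms of \<open>p t\<close> and \<open>q t\<close> are those of the pulled back
  functions, hence differentiable. The potential part of the force cancels the derivative of (V u,
  u)/2, and the damping remains.\<close>

lemma char_energy_deriv:
  assumes "mild u p q" "t \<ge> 0"
  shows "((\<lambda>t. char_energy (u t) (p t) (q t)) has_real_derivative
      - inner (multop a (avg (p t) (q t))) (avg (p t) (q t))) (at t within {0..})"
proof -
  let ?v = "avg (p t) (q t)" let ?F = "force (u t) ?v"
  have d: "(u has_vector_derivative ?v) (at t within {0..})"
    "((\<lambda>s. shift (- s) (p s)) has_vector_derivative shift (- t) ?F) (at t within {0..})"
    "((\<lambda>s. shift s (q s)) has_vector_derivative shift t ?F) (at t within {0..})"
    using assms by (auto simp: mild_def)
  have "((\<lambda>t. char_energy (u t) (p t) (q t)) has_real_derivative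
      (2 * inner (p t) ?F + 2 * inner (q t) ?F) / 4 + 2 * inner (multop V (u t)) ?v / 2) (at t within {0..})"
    unfolding char_energy_def
    using norm_sq_deriv[OF d(2)] norm_sq_deriv[OF d(3)] mult_quadratic_deriv[OF bmeas_V d(1)]
    by (intro DERIV_add DERIV_cdivide) (simp_all add: inner_shift)
  moreover have "(2 * inner (p t) ?F + 2 * inner (q t) ?F) / 4 = inner ?v ?F"
    by (simp add: avg_def inner_add_left)
  moreover have "inner ?v ?F = - inner (multop V (u t)) ?v - inner (multop a ?v) ?v"
    by (simp add: force_def inner_diff_right inner_commute)
  ultimately show ?thesis by simp
qed

text \<open>With v = u_t and d = u_x these are v_t = d_x + force and d_t = v_x in weak form, where
  any H^1 function may be used for testing, in particular \<open>u t\<close> itself.\<close>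

lemma mild_weak:
  assumes "mild u p q" "t \<ge> 0" "weak_pair f g"
  shows "((\<lambda>s. inner (avg (p s) (q s)) f) has_real_derivative
      inner (force (u t) (avg (p t) (q t))) f - inner (half_diff (p t) (q t)) g) (at t within {0..})"
    and "((\<lambda>s. inner (half_diff (p s) (q s)) f) has_real_derivative
      - inner (avg (p t) (q t)) g) (at t within {0..})"
proof -
  let ?F = "force (u t) (avg (p t) (q t))"
  have p: "((\<lambda>s. inner (p s) f) has_real_derivative inner ?F f - 1 * inner (p t) g) (at t within {0..})"
    by (rule transport_weak[OF _ assms(3)]) (use assms in \<open>auto simp: mild_def\<close>)
  have q: "((\<lambda>s. inner (q s) f) has_real_derivative inner ?F f - (- 1) * inner (q t) g) (at t within {0..})"
    by (rule transport_weak[OF _ assms(3)]) (use assms in \<open>auto simp: mild_def\<close>)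
  show "((\<lambda>s. inner (avg (p s) (q s)) f) has_real_derivative
      inner ?F f - inner (half_diff (p t) (q t)) g) (at t within {0..})"
    using DERIV_cmult[OF DERIV_add[OF p q], of "1/2"]
    by (simp add: avg_def[of "p _"] half_diff_def inner_add_left inner_diff_left algebra_simps)
  show "((\<lambda>s. inner (half_diff (p s) (q s)) f) has_real_derivative
      - inner (avg (p t) (q t)) g) (at t within {0..})"
    using DERIV_cmult[OF DERIV_diff[OF p q], of "1/2"]
    by (simp add: avg_def[of "p _"] half_diff_def inner_add_left inner_diff_left algebra_simps)
qed

text \<open>\<open>mild\<close> does not say that (p - q)/2 is the space derivative of
  \<open>u\<close>. The tested defect of this relation has time derivative zero, as u_t and
  \<open>avg\<close> agree, so the relation propagates from time 0.\<close>

lemma mild_weak_pair: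
  assumes "mild u p q" "weak_pair (u 0) (half_diff (p 0) (q 0))" "t \<ge> 0"
  shows "weak_pair (u t) (half_diff (p t) (q t))"
  unfolding weak_pair_def
proof (intro allI impI)
  fix \<phi> assume \<phi>: "test_fun \<phi>"
  define D where "D s = inner (u s) (abs_lsq (deriv \<phi>)) + inner (half_diff (p s) (q s)) (abs_lsq \<phi>)" for s
  have "D t = D 0"
  proof (rule const_atLeast[OF _ assms(3)])
    fix t :: real assume t: "t \<ge> 0"
    have "(u has_vector_derivative avg (p t) (q t)) (at t within {0..})"
      using assms(1) t by (simp add: mild_def)
    from DERIV_add[OF inner_const_deriv[OF this, of "abs_lsq (deriv \<phi>)"] mild_weak(2)[OF assms(1) t weak_pair_test[OF \<phi>]]]
    have "(D has_real_derivative 0) (at t within {0..})"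
      unfolding D_def by simp
    then show "(D has_vector_derivative 0) (at t within {0..})"
      by (simp add: has_real_derivative_iff_has_vector_derivative)
  qed
  also have "D 0 = 0" using assms(2) \<phi> by (simp add: D_def weak_pair_def)
  finally show "inner (u t) (abs_lsq (deriv \<phi>)) = - inner (half_diff (p t) (q t)) (abs_lsq \<phi>)"
    by (simp add: D_def)
qed

lemma mild_unique:
  assumes m: "mild u p q" "mild u' p' q'" and init: "u 0 = u' 0" "p 0 = p' 0" "q 0 = q' 0"
    and nonneg: "\<And>x. 0 \<le> a x" "\<And>x. 0 \<le> V x" and t: "t \<ge> 0"
  shows "u t = u' t"
proof -
  define w y z where "w s = u s - u' s" and "y s = p s - p' s" and "z s = q s - q' s" for s
  have mw: "mild w y z" using mild_diff[OF m] by (simp add: w_def[abs_def] y_def[abs_def] z_def[abs_def])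
  have zero: "y s = 0 \<and> z s = 0" if s: "s \<ge> 0" for s
  proof -
    have "char_energy (w s) (y s) (z s) \<le> char_energy (w 0) (y 0) (z 0)"
      by (rule deriv_nonpos_le[OF _ s char_energy_deriv[OF mw]]) (use nonneg bmeas_a in \<open>auto intro: inner_mult_nonneg\<close>)
    also have "\<dots> = 0" by (simp add: char_energy_def w_def y_def z_def init)
    finally have le: "(norm (y s))\<^sup>2 / 4 + (norm (z s))\<^sup>2 / 4 + inner (multop V (w s)) (w s) / 2 \<le> 0"
      by (simp add: char_energy_def add_divide_distrib)
    have nn: "0 \<le> inner (multop V (w s)) (w s) / 2" "0 \<le> (norm (y s))\<^sup>2 / 4" "0 \<le> (norm (z s))\<^sup>2 / 4"
      using inner_mult_nonneg[OF bmeas_V nonneg(2), of "w s"] by auto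
    have "(norm (y s))\<^sup>2 / 4 = 0" "(norm (z s))\<^sup>2 / 4 = 0" using le nn by argo+
    then show ?thesis by simp
  qed
  \<comment> \<open>With \<open>y = z = 0\<close> the time derivative of \<open>w\<close> vanishes,
    and \<open>w\<close> starts at 0.\<close>
  have "w t = w 0"
  proof (rule const_atLeast[OF _ t])
    fix s :: real assume s: "s \<ge> 0"
    show "(w has_vector_derivative 0) (at s within {0..})"
      using mw s zero[OF s] by (auto simp: mild_def avg_def)
  qed
  then show ?thesis using init by (simp add: w_def)
qed

end

section \<open>Weak and mild solutions\<close>

lemma inner_rep_lsq_abs: "L2 g \<Longrightarrow> (LINT x|lborel. rep_lsq f x * g x) = inner f (abs_lsq g)"
  using inner_abs_lsq[OF L2_rep_lsq, of g f] by simp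

lemma inner_mult_abs:
  assumes "bmeas m" "L2 f" "L2 g"
  shows "(LINT x|lborel. m x * f x * g x) = inner (multop m (abs_lsq f)) (abs_lsq g)"
  using assms by (simp add: multop_abs_lsq inner_abs_lsq L2_bmeas_mult)

lemma H1norm_weak_pair:
  assumes "L2 f" "weak_pair (abs_lsq f) g"
  shows "H1 f" "abs_lsq (wderiv f) = g" "H1norm f = sqrt ((norm (abs_lsq f))\<^sup>2 + (norm g)\<^sup>2)"
proof -
  show "H1 f"
    unfolding H1_def using assms by (auto simp: weak_deriv_iff intro!: exI[of _ "rep_lsq g"])
  note w = wderiv_weak_pair[OF this]
  show g: "abs_lsq (wderiv f) = g" using weak_pair_unique[OF w(2) assms(2)] .
  show "H1norm f = sqrt ((norm (abs_lsq f))\<^sup>2 + (norm g)\<^sup>2)"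
    unfolding H1norm_def using norm_abs_lsq[OF w(1)] norm_abs_lsq[OF assms(1)] by (simp add: g)
qed

lemma continuous_on_atLeast_tendsto:
  "continuous_on {0..} f \<Longrightarrow> 0 \<le> t \<Longrightarrow> (f \<longlongrightarrow> f t) (at t within {0..})" for t :: real
  by (simp add: continuous_on_def)

lemma eventually_at_atLeast: "\<forall>\<^sub>F s in at t within {0..}. (0::real) \<le> s"
  by (auto simp: eventually_at_filter)

lemma at_within_atLeast: "0 < t \<Longrightarrow> at t within {0..} = at (t::real)"
  by (intro at_within_interior) auto

context damped_wave
begin

text \<open>\<open>half_diff\<close> represents the weak space derivative of \<open>u\<close>, so
  the continuity of \<open>p\<close> and \<open>q\<close> in L^2 gives that of \<open>u\<close> in
  H^1.\<close>

lemma mild_imp_weak_solution: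
  assumes m: "mild u p q" and w0: "weak_pair (u 0) (half_diff (p 0) (q 0))"
    and init: "L2 u0" "L2 u1" "u 0 = abs_lsq u0" "avg (p 0) (q 0) = abs_lsq u1"
  shows "weak_solution a V u0 u1 (\<lambda>t. rep_lsq (u t)) (\<lambda>t. rep_lsq (avg (p t) (q t)))"
proof -
  define v d where "v t = avg (p t) (q t)" and "d t = half_diff (p t) (q t)" for t
  have w: "weak_pair (u t) (d t)" if "t \<ge> 0" for t
    unfolding d_def using mild_weak_pair[OF m w0 that] .
  have cont: "continuous_on {0..} u" "continuous_on {0..} v" "continuous_on {0..} d"
    unfolding v_def[abs_def] d_def[abs_def] using mild_continuous[OF m] by auto
  have u': "(u has_vector_derivative v t) (at t within {0..})" if "t \<ge> 0" for t
    using m that by (simp add: mild_def v_def)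
  have 1: "C_H1 (\<lambda>t. rep_lsq (u t))"
    unfolding C_H1_def
  proof (intro conjI allI impI)
    fix t :: real assume t: "t \<ge> 0"
    show "H1 (rep_lsq (u t))" by (rule H1_rep(1)[OF w[OF t]])
    have "((\<lambda>s. sqrt ((norm (u s - u t))\<^sup>2 + (norm (d s - d t))\<^sup>2)) \<longlongrightarrow>
        sqrt ((norm (u t - u t))\<^sup>2 + (norm (d t - d t))\<^sup>2)) (at t within {0..})"
      by (intro tendsto_intros continuous_on_atLeast_tendsto cont t)
    then have "((\<lambda>s. sqrt ((norm (u s - u t))\<^sup>2 + (norm (d s - d t))\<^sup>2)) \<longlongrightarrow> 0) (at t within {0..})"
      by simp
    then show "((\<lambda>s. H1norm (\<lambda>x. rep_lsq (u s) x - rep_lsq (u t) x)) \<longlongrightarrow> 0) (at t within {0..})"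
    proof (rule Lim_transform_eventually)
      show "\<forall>\<^sub>F s in at t within {0..}. sqrt ((norm (u s - u t))\<^sup>2 + (norm (d s - d t))\<^sup>2)
          = H1norm (\<lambda>x. rep_lsq (u s) x - rep_lsq (u t) x)"
        using eventually_at_atLeast
      proof eventually_elim
        case (elim s)
        have "weak_pair (abs_lsq (\<lambda>x. rep_lsq (u s) x - rep_lsq (u t) x)) (d s - d t)"
          using weak_pair_diff[OF w[OF elim] w[OF t]] by (simp add: abs_lsq_diff)
        from H1norm_weak_pair(3)[OF _ this] show ?case by (simp add: L2_diff abs_lsq_diff)
      qed
    qed
  qed
  have 2: "C1_L2_with (\<lambda>t. rep_lsq (u t)) (\<lambda>t. rep_lsq (v t))"
    unfolding C1_L2_with_def
  proof (intro conjI allI impI)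
    fix t :: real assume t: "t \<ge> 0"
    have "((\<lambda>s. norm (v s - v t)) \<longlongrightarrow> norm (v t - v t)) (at t within {0..})"
      by (intro tendsto_intros continuous_on_atLeast_tendsto cont t)
    then show "((\<lambda>s. L2norm (\<lambda>x. rep_lsq (v s) x - rep_lsq (v t) x)) \<longlongrightarrow> 0) (at t within {0..})"
      by (simp add: norm_abs_lsq[symmetric] L2_diff abs_lsq_diff)
    have "((\<lambda>s. norm ((u s - u t) /\<^sub>R (s - t) - v t)) \<longlongrightarrow> 0) (at t within {0..})"
      using u'[OF t] by (simp add: has_vector_derivative_quotient tendsto_norm_zero_iff LIM_zero_iff)
    moreover have "norm ((u s - u t) /\<^sub>R (s - t) - v t)
        = L2norm (\<lambda>x. (rep_lsq (u s) x - rep_lsq (u t) x) / (s - t) - rep_lsq (v t) x)" for s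
    proof -
      have "L2 (\<lambda>x. inverse (s - t) * (rep_lsq (u s) x - rep_lsq (u t) x))"
        by (intro L2_scale L2_diff L2_rep_lsq)
      then show ?thesis
        by (simp add: norm_abs_lsq[symmetric] L2_diff abs_lsq_diff abs_lsq_scale divide_inverse mult.commute[of _ "inverse _"])
    qed
    ultimately show "((\<lambda>s. L2norm (\<lambda>x. (rep_lsq (u s) x - rep_lsq (u t) x) / (s - t) - rep_lsq (v t) x)) \<longlongrightarrow> 0) (at t within {0..})"
      by simp
  qed auto
  have 3: "((\<lambda>s. LINT x|lborel. rep_lsq (v s) x * \<phi> x) has_real_derivative
           (- (LINT x|lborel. wderiv (rep_lsq (u t)) x * deriv \<phi> x)
            - (LINT x|lborel. V x * rep_lsq (u t) x * \<phi> x)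
            - (LINT x|lborel. a x * rep_lsq (v t) x * \<phi> x))) (at t)"
    if \<phi>: "test_fun \<phi>" and t: "t > 0" for \<phi> t
  proof -
    have L2: "L2 \<phi>" "L2 (deriv \<phi>)" by (auto intro: L2_test_fun test_fun_deriv \<phi>)
    have wd: "L2 (wderiv (rep_lsq (u t)))" "abs_lsq (wderiv (rep_lsq (u t))) = d t"
      using wderiv_weak_pair(1)[OF H1_rep(1)[OF w]] H1_rep(2)[OF w] t by auto
    have "((\<lambda>s. inner (v s) (abs_lsq \<phi>)) has_real_derivative
        inner (force (u t) (v t)) (abs_lsq \<phi>) - inner (d t) (abs_lsq (deriv \<phi>))) (at t)"
      using mild_weak(1)[OF m _ weak_pair_test[OF \<phi>], of t] t by (simp add: v_def d_def at_within_atLeast)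
    moreover have "inner (force (u t) (v t)) (abs_lsq \<phi>) - inner (d t) (abs_lsq (deriv \<phi>))
        = - inner (d t) (abs_lsq (deriv \<phi>)) - inner (multop V (u t)) (abs_lsq \<phi>) - inner (multop a (v t)) (abs_lsq \<phi>)"
      by (simp add: force_def inner_diff_left)
    moreover have "(LINT x|lborel. wderiv (rep_lsq (u t)) x * deriv \<phi> x) = inner (d t) (abs_lsq (deriv \<phi>))"
      using inner_abs_lsq[OF wd(1) L2(2)] wd(2) by simp
    ultimately show ?thesis
      by (simp only: inner_rep_lsq_abs[OF L2(1)] inner_mult_abs[OF bmeas_V L2_rep_lsq L2(1)]
          inner_mult_abs[OF bmeas_a L2_rep_lsq L2(1)] abs_lsq_rep)
  qed
  show ?thesis
    unfolding weak_solution_def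
    using 1 2[unfolded v_def] 3[unfolded v_def] init rep_lsq_abs[OF init(1)] rep_lsq_abs[OF init(2)] by auto
qed

text \<open>For an arbitrary weak solution put p = u_t + u_x and q = u_t - u_x. The weak equation
  and (u_x)_t = (u_t)_x combine into weak transport equations, which \<open>transport_strong\<close>
  turns into differential equations in norm. This makes the energy identity, and with it uniqueness,
  available for all weak solutions.\<close>

lemma weak_solution_imp_mild:
  assumes sol: "weak_solution a V u0 u1 w z" and init: "L2 u0" "L2 u1" "weak_pair (abs_lsq u0) g"
  shows "\<exists>p q. mild (\<lambda>t. abs_lsq (w t)) p q \<and> abs_lsq (w 0) = abs_lsq u0 \<and> p 0 = abs_lsq u1 + g \<and> q 0 = abs_lsq u1 - g"
proof -
  define U Z D where "U t = abs_lsq (w t)" and "Z t = abs_lsq (z t)" and "D t = abs_lsq (wderiv (w t))" for t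
  have H1: "H1 (w t)" and L2: "L2 (w t)" "L2 (z t)" "L2 (wderiv (w t))" if "t \<ge> 0" for t
    using sol that by (auto simp: weak_solution_def C_H1_def C1_L2_with_def intro: wderiv_weak_pair)
  have wp: "weak_pair (U t) (D t)" if "t \<ge> 0" for t
    unfolding U_def D_def by (rule wderiv_weak_pair[OF H1[OF that]])
  have Zc: "continuous_on {0..} Z"
    unfolding continuous_on_def
  proof
    fix t :: real assume "t \<in> {0..}"
    then have t: "t \<ge> 0" by simp
    have "((\<lambda>s. L2norm (\<lambda>x. z s x - z t x)) \<longlongrightarrow> 0) (at t within {0..})"
      using sol t by (simp add: weak_solution_def C1_L2_with_def)
    then have "((\<lambda>s. norm (Z s - Z t)) \<longlongrightarrow> 0) (at t within {0..})"
    proof (rule Lim_transform_eventually)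
      show "\<forall>\<^sub>F s in at t within {0..}. L2norm (\<lambda>x. z s x - z t x) = norm (Z s - Z t)"
        using eventually_at_atLeast
        by eventually_elim (simp add: norm_abs_lsq[symmetric] L2_diff abs_lsq_diff L2 t Z_def)
    qed
    then show "(Z \<longlongrightarrow> Z t) (at t within {0..})"
      by (simp add: tendsto_norm_zero_iff LIM_zero_iff)
  qed
  have Dc: "continuous_on {0..} D"
    unfolding continuous_on_def
  proof
    fix t :: real assume "t \<in> {0..}"
    then have t: "t \<ge> 0" by simp
    have "((\<lambda>s. H1norm (\<lambda>x. w s x - w t x)) \<longlongrightarrow> 0) (at t within {0..})"
      using sol t by (simp add: weak_solution_def C_H1_def)
    then have "((\<lambda>s. D s - D t) \<longlongrightarrow> 0) (at t within {0..})"
    proof (rule Lim_null_comparison[rotated])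
      show "\<forall>\<^sub>F s in at t within {0..}. norm (D s - D t) \<le> H1norm (\<lambda>x. w s x - w t x)"
        using eventually_at_atLeast
      proof eventually_elim
        case (elim s)
        \<comment> \<open>\<open>wderiv\<close> chooses a representative for each function
          separately; uniqueness of weak derivatives identifies the class chosen for the difference
          with \<open>D s - D t\<close>.\<close>
        have "weak_pair (abs_lsq (\<lambda>x. w s x - w t x)) (D s - D t)"
          using weak_pair_diff[OF wp[OF elim] wp[OF t]] by (simp add: abs_lsq_diff L2 elim t U_def)
        from H1norm_weak_pair(3)[OF _ this] show ?case by (simp add: L2_diff L2 elim t)
      qed
    qed
    then show "(D \<longlongrightarrow> D t) (at t within {0..})" by (simp add: LIM_zero_iff)
  qed
  have U': "(U has_vector_derivative Z t) (at t within {0..})" if t: "t \<ge> 0" for t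
  proof -
    have "((\<lambda>s. L2norm (\<lambda>x. (w s x - w t x) / (s - t) - z t x)) \<longlongrightarrow> 0) (at t within {0..})"
      using sol t by (simp add: weak_solution_def C1_L2_with_def)
    then have "((\<lambda>s. norm ((U s - U t) /\<^sub>R (s - t) - Z t)) \<longlongrightarrow> 0) (at t within {0..})"
    proof (rule Lim_transform_eventually)
      show "\<forall>\<^sub>F s in at t within {0..}. L2norm (\<lambda>x. (w s x - w t x) / (s - t) - z t x) = norm ((U s - U t) /\<^sub>R (s - t) - Z t)"
        using eventually_at_atLeast
      proof eventually_elim
        case (elim s)
        have "L2 (\<lambda>x. inverse (s - t) * (w s x - w t x))"
          by (intro L2_scale L2_diff L2 elim t)
        then show ?case
          by (simp add: norm_abs_lsq[symmetric] L2_diff abs_lsq_diff abs_lsq_scale L2 elim t U_def Z_def divide_inverse mult.commute[of _ "inverse _"])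
      qed
    qed
    then show ?thesis by (simp add: has_vector_derivative_quotient tendsto_norm_zero_iff LIM_zero_iff)
  qed
  define p q where "p t = Z t + D t" and "q t = Z t - D t" for t
  have avg: "avg (p t) (q t) = Z t" for t by (simp add: avg_def p_def q_def scaleR_2[symmetric])
  have Uc: "continuous_on {0..} U" using U' by (intro continuous_on_vector_derivative) auto
  have Fc: "continuous_on {0..} (\<lambda>t. force (U t) (Z t))" by (intro continuous_on_force Uc Zc)
  have Z': "((\<lambda>s. inner (Z s) (abs_lsq \<phi>)) has_real_derivative
      inner (force (U t) (Z t)) (abs_lsq \<phi>) - inner (D t) (abs_lsq (deriv \<phi>))) (at t)"
    if \<phi>: "test_fun \<phi>" and t: "t > 0" for \<phi> t
  proof -
    have L2\<phi>: "L2 \<phi>" "L2 (deriv \<phi>)" by (auto intro: L2_test_fun test_fun_deriv \<phi>)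
    have "((\<lambda>s. LINT x|lborel. z s x * \<phi> x) has_real_derivative
           (- (LINT x|lborel. wderiv (w t) x * deriv \<phi> x)
            - (LINT x|lborel. V x * w t x * \<phi> x)
            - (LINT x|lborel. a x * z t x * \<phi> x))) (at t)"
      using sol \<phi> t by (simp add: weak_solution_def)
    moreover have "(LINT x|lborel. wderiv (w t) x * deriv \<phi> x) = inner (D t) (abs_lsq (deriv \<phi>))"
      "(LINT x|lborel. V x * w t x * \<phi> x) = inner (multop V (U t)) (abs_lsq \<phi>)"
      "(LINT x|lborel. a x * z t x * \<phi> x) = inner (multop a (Z t)) (abs_lsq \<phi>)"
      using t by (simp_all add: U_def Z_def D_def inner_abs_lsq inner_mult_abs L2 L2\<phi> bmeas_V bmeas_a)
    moreover have "inner (force (U t) (Z t)) (abs_lsq \<phi>) - inner (D t) (abs_lsq (deriv \<phi>))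
        = - inner (D t) (abs_lsq (deriv \<phi>)) - inner (multop V (U t)) (abs_lsq \<phi>) - inner (multop a (Z t)) (abs_lsq \<phi>)"
      by (simp add: force_def inner_diff_left)
    ultimately have "((\<lambda>s. LINT x|lborel. z s x * \<phi> x) has_real_derivative
        inner (force (U t) (Z t)) (abs_lsq \<phi>) - inner (D t) (abs_lsq (deriv \<phi>))) (at t)"
      by (simp only:)
    \<comment> \<open>The integrals are known to be inner products of classes for nonnegative times
      only, which suffices near a positive \<open>t\<close>.\<close>
    then show ?thesis
      by (rule has_field_derivative_transform_within_open[of _ _ _ "{0<..}"])
         (use t in \<open>auto simp: Z_def inner_abs_lsq L2 L2\<phi>\<close>)
  qed
  have D': "((\<lambda>s. inner (D s) (abs_lsq \<phi>)) has_real_derivative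
      - inner (Z t) (abs_lsq (deriv \<phi>))) (at t)"
    if \<phi>: "test_fun \<phi>" and t: "t > 0" for \<phi> t
  proof -
    have "(U has_vector_derivative Z t) (at t)" using U'[of t] t by (simp add: at_within_atLeast)
    \<comment> \<open>Tested with \<open>\<phi>\<close>, u_x becomes minus \<open>u\<close> tested
      with the derivative of \<open>\<phi>\<close>, and \<open>u\<close> is differentiable in
      time.\<close>
    from DERIV_minus[OF inner_const_deriv[OF this, of "abs_lsq (deriv \<phi>)"]]
    show ?thesis
      by (rule has_field_derivative_transform_within_open[of _ _ _ "{0<..}"])
         (use t wp \<phi> in \<open>auto simp: weak_pair_def\<close>)
  qed
  have "((\<lambda>s. shift (- 1 * s) (p s)) has_vector_derivative shift (- 1 * t) (force (U t) (Z t))) (at t within {0..})"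
    if t: "t \<ge> 0" for t
  proof (rule transport_strong[OF _ Fc _ t])
    show "continuous_on {0..} p" unfolding p_def by (intro continuous_intros Zc Dc)
    show "((\<lambda>s. inner (p s) (abs_lsq \<phi>)) has_real_derivative
        inner (force (U t) (Z t)) (abs_lsq \<phi>) - 1 * inner (p t) (abs_lsq (deriv \<phi>))) (at t)"
      if "test_fun \<phi>" "t > 0" for \<phi> t
      using DERIV_add[OF Z'[OF that] D'[OF that]] by (simp add: p_def inner_add_left algebra_simps)
  qed
  moreover have "((\<lambda>s. shift (- (- 1) * s) (q s)) has_vector_derivative shift (- (- 1) * t) (force (U t) (Z t))) (at t within {0..})"
    if t: "t \<ge> 0" for t
  proof (rule transport_strong[OF _ Fc _ t])
    show "continuous_on {0..} q" unfolding q_def by (intro continuous_intros Zc Dc)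
    show "((\<lambda>s. inner (q s) (abs_lsq \<phi>)) has_real_derivative
        inner (force (U t) (Z t)) (abs_lsq \<phi>) - (- 1) * inner (q t) (abs_lsq (deriv \<phi>))) (at t)"
      if "test_fun \<phi>" "t > 0" for \<phi> t
      using DERIV_diff[OF Z'[OF that] D'[OF that]] by (simp add: q_def inner_diff_left algebra_simps)
  qed
  ultimately have "mild U p q" using U' by (auto simp: mild_def avg)
  moreover have U0: "U 0 = abs_lsq u0" and Z0: "Z 0 = abs_lsq u1"
    using sol L2[of 0] init by (auto simp: weak_solution_def U_def Z_def abs_lsq_eq_iff)
  moreover have "D 0 = g" using weak_pair_unique[OF wp[of 0]] init(3) U0 by simp
  ultimately show ?thesis
    by (intro exI[of _ p] exI[of _ q]) (auto simp: U_def[abs_def, symmetric] U_def[symmetric] p_def q_def)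
qed

end

section \<open>Energy decay\<close>

text \<open>For functions not confined to |x| <= r: the part outside contributes a nonnegative
  amount. It is applied to the time integral of \<open>u\<close>, whose support may grow.\<close>

lemma inner_mult_cutoff_ge:
  assumes "bmeas m" "\<And>x. 0 \<le> m x" "\<And>x. \<bar>x\<bar> \<le> r \<Longrightarrow> c \<le> m x"
  shows "c * (norm (multop (indicator {-r..r}) f))\<^sup>2 \<le> inner (multop m f) f"
proof -
  let ?i = "indicator {-r..r} :: real \<Rightarrow> real"
  have i: "bmeas ?i" by (rule bmeas_indicator) simp
  have L: "L2 (\<lambda>x. ?i x * rep_lsq f x)" by (intro L2_bmeas_mult i L2_rep_lsq)
  have "c * (norm (multop ?i f))\<^sup>2 = (LINT x|lborel. c * (?i x * rep_lsq f x * (?i x * rep_lsq f x)))"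
    unfolding power2_norm_eq_inner multop_def inner_abs_lsq[OF L L] by simp
  also have "\<dots> \<le> (LINT x|lborel. m x * rep_lsq f x * rep_lsq f x)"
  proof (rule integral_mono)
    show "integrable lborel (\<lambda>x. c * (?i x * rep_lsq f x * (?i x * rep_lsq f x)))"
      by (intro integrable_mult_right impI L2_mult_integrable L)
    show "integrable lborel (\<lambda>x. m x * rep_lsq f x * rep_lsq f x)"
      by (intro L2_mult_integrable L2_bmeas_mult assms L2_rep_lsq)
    show "c * (?i x * rep_lsq f x * (?i x * rep_lsq f x)) \<le> m x * rep_lsq f x * rep_lsq f x" for x
      using assms(2)[of x] assms(3)[of x] mult_right_mono[of c "m x" "rep_lsq f x * rep_lsq f x"]
      by (auto simp: indicator_def mult.assoc)
  qed
  finally show ?thesis by (simp add: inner_mult_left[OF assms(1)])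
qed

lemma supported_cutoff:
  assumes "supported r f"
  shows "multop (indicator {-r..r}) f = f"
proof (rule lsq_eqI)
  have "bmeas (indicator {-r..r})" by (rule bmeas_indicator) simp
  from rep_lsq_multop[OF this, of f] assms[unfolded supported_def]
  show "AE x in lborel. rep_lsq (multop (indicator {-r..r}) f) x = rep_lsq f x"
    by eventually_elim (auto simp: indicator_def)
qed

lemma inner_le_weighted_squares:
  fixes f g :: "'b::real_inner"
  assumes "c > 0"
  shows "\<bar>inner f g\<bar> \<le> (norm f)\<^sup>2 / (2 * c) + c * (norm g)\<^sup>2 / 2"
proof -
  have "0 \<le> (norm f - c * norm g)\<^sup>2" by simp
  then have "2 * c * (norm f * norm g) \<le> (norm f)\<^sup>2 + c\<^sup>2 * (norm g)\<^sup>2"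
    by (simp add: power2_diff power_mult_distrib mult_ac)
  then have "norm f * norm g \<le> (norm f)\<^sup>2 / (2 * c) + c * (norm g)\<^sup>2 / 2"
    using assms by (simp add: field_simps power2_eq_square)
  then show ?thesis using Cauchy_Schwarz_ineq2[of f g] by linarith
qed

text \<open>The weak derivative is the norm limit of difference quotients of translations, which
  vanish for |x| > r + |h|. Letting the margin run through the values 1/(n + 1) removes it.\<close>

lemma weak_pair_supported:
  assumes w: "weak_pair f g" and f: "supported r f"
  shows "supported r g"
proof -
  have sup: "supported (r + e) g" if e: "e > 0" for e
  proof -
    have "((\<lambda>h. (shift h f - shift 0 f) /\<^sub>R (h - 0)) \<longlongrightarrow> shift 0 g) (at 0)"
      using weak_pair_shift_vderiv[OF w, of 0 UNIV] by (simp add: has_vector_derivative_quotient)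
    moreover have "\<forall>\<^sub>F h in at 0. (shift h f - shift 0 f) /\<^sub>R (h - 0) \<in> {f. supported (r + e) f}"
    proof -
      have "\<forall>\<^sub>F h in at (0::real). \<bar>h\<bar> < e" using e by (auto simp: eventually_at dist_norm)
      then show ?thesis
      proof eventually_elim
        case (elim h)
        then show ?case
          using supported_mono[OF supported_shift[OF f, of h], of "r + e"] supported_mono[OF f, of "r + e"] e
          by (auto intro!: supported_scaleR supported_diff)
      qed
    qed
    ultimately have "shift 0 g \<in> {f. supported (r + e) f}"
      by (intro Lim_in_closed_set[OF closed_supported]) auto
    then show ?thesis by simp
  qed
  have "AE x in lborel. \<forall>n. \<bar>x\<bar> > r + inverse (real (Suc n)) \<longrightarrow> rep_lsq g x = 0"
    unfolding AE_all_countable using sup by (auto simp: supported_def)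
  then show ?thesis
    unfolding supported_def
  proof eventually_elim
    case (elim x)
    show ?case
    proof
      assume "r < \<bar>x\<bar>"
      then obtain n where "inverse (real (Suc n)) < \<bar>x\<bar> - r" using reals_Archimedean[of "\<bar>x\<bar> - r"] by auto
      then show "rep_lsq g x = 0" using elim by (auto dest!: spec[of _ n])
    qed
  qed
qed

section \<open>The setting for the decay of one mild solution\<close>

locale decaying_damped_wave = damped_wave +
  fixes \<alpha> a1 R :: real and u p q :: "real \<Rightarrow> lsq"
  assumes alpha: "0 \<le> \<alpha>" "\<alpha> < 1" and a1: "a1 > 0" and R: "R > 0"
    and a_lower: "\<And>x. a1 / (1 + \<bar>x\<bar>) powr \<alpha> \<le> a x"
    and V_pos: "\<And>x. 0 < V x" and V_cont: "continuous_on UNIV V"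
    and m: "mild u p q" and w0: "weak_pair (u 0) (half_diff (p 0) (q 0))"
    and supp: "\<And>t. t \<ge> 0 \<Longrightarrow> supported (R + t) (u t)" "\<And>t. t \<ge> 0 \<Longrightarrow> supported (R + t) (avg (p t) (q t))"
begin

definition "v t = avg (p t) (q t)"
definition "d t = half_diff (p t) (q t)"
definition "A t = inner (multop a (u t)) (u t)"
definition "IA t = integral {0..t} A"
definition "W t = inner (multop V (u t)) (u t)"
definition "en t = char_energy (u t) (p t) (q t)"

lemma en_eq: "en t = ((norm (v t))\<^sup>2 + (norm (d t))\<^sup>2 + W t) / 2"
  by (simp add: en_def char_energy_eq v_def d_def W_def)

lemma a_nonneg: "0 \<le> a x"
proof -
  have "0 \<le> a1 / (1 + \<bar>x\<bar>) powr \<alpha>" using a1 by simp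
  then show ?thesis using a_lower[of x] by linarith
qed

lemma W_nonneg: "0 \<le> W t"
  unfolding W_def using V_pos by (intro inner_mult_nonneg bmeas_V) (simp add: less_imp_le)

lemma u_deriv: "t \<ge> 0 \<Longrightarrow> (u has_vector_derivative v t) (at t within {0..})"
  using m by (simp add: mild_def v_def)

lemma continuous_on_u_v_d: "continuous_on {0..} u" "continuous_on {0..} v" "continuous_on {0..} d"
  unfolding v_def[abs_def] d_def[abs_def] using mild_continuous[OF m] by auto

lemma weak_pair_u_d: "t \<ge> 0 \<Longrightarrow> weak_pair (u t) (d t)"
  unfolding d_def using mild_weak_pair[OF m w0] .

lemma IA_deriv: "t \<ge> 0 \<Longrightarrow> (IA has_real_derivative A t) (at t within {0..})"
  unfolding IA_def[abs_def] has_real_derivative_iff_has_vector_derivative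
  by (rule integral_atLeast_vderiv) (auto simp: A_def[abs_def] intro!: continuous_intros continuous_on_mult bmeas_a continuous_on_u_v_d)

lemma v_weak_deriv:
  assumes "t \<ge> 0" "weak_pair f g"
  shows "((\<lambda>s. inner (v s) f) has_real_derivative inner (force (u t) (v t)) f - inner (d t) g) (at t within {0..})"
  using mild_weak(1)[OF m assms] by (simp add: v_def[abs_def] d_def v_def)

definition "g0 = v 0 + multop a (u 0)"

definition "Uint t = integral {0..t} u"
text \<open>Stands for the space derivative of \<open>Uint\<close>. As the integral of
  \<open>d\<close> it has its time derivative at hand, without an exchange of integral and weak
  derivative.\<close>

definition "Dint t = integral {0..t} d"

lemma Uint_deriv: "t \<ge> 0 \<Longrightarrow> (Uint has_vector_derivative u t) (at t within {0..})"
  and Dint_deriv: "t \<ge> 0 \<Longrightarrow> (Dint has_vector_derivative d t) (at t within {0..})"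
  unfolding Uint_def[abs_def] Dint_def[abs_def] by (auto intro: integral_atLeast_vderiv continuous_on_u_v_d)

text \<open>The time integral of \<open>u\<close> solves a wave equation with the source \<open>g0\<close>; this is its weak form.\<close>

lemma integrated_equation:
  assumes t: "t \<ge> 0" and w: "weak_pair f g"
  shows "inner (v t) f + inner (Dint t) g + inner (multop V (Uint t)) f + inner (multop a (u t)) f = inner g0 f"
proof -
  define L where "L t = inner (v t) f + inner (Dint t) g + inner (multop V (Uint t)) f + inner (multop a (u t)) f" for t
  have "L t = L 0"
  proof (rule const_atLeast[OF _ t])
    fix t :: real assume t: "t \<ge> 0"
    \<comment> \<open>The force cancels the two multiplication terms, and the two \<open>d\<close>
      terms cancel each other.\<close>
    have "(L has_real_derivative (inner (force (u t) (v t)) f - inner (d t) g) + inner (d t) g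
        + inner (multop V (u t)) f + inner (multop a (v t)) f) (at t within {0..})"
      unfolding L_def
      by (intro DERIV_add v_weak_deriv t w inner_const_deriv Dint_deriv
          bounded_linear.has_vector_derivative[OF bounded_linear_mult] bmeas_a bmeas_V Uint_deriv u_deriv)
    then have "(L has_real_derivative 0) (at t within {0..})"
      by (simp add: force_def inner_diff_left)
    then show "(L has_vector_derivative 0) (at t within {0..})"
      by (simp add: has_real_derivative_iff_has_vector_derivative)
  qed
  also have "L 0 = inner g0 f"
    by (simp add: L_def g0_def Uint_def Dint_def inner_add_left mult_linear_simps bmeas_V)
  finally show ?thesis by (simp add: L_def)
qed

lemma V_lower: "\<exists>c>0. \<forall>x. \<bar>x\<bar> \<le> R \<longrightarrow> c \<le> V x"
proof -
  obtain x0 where "x0 \<in> {-R..R}" "\<And>x. x \<in> {-R..R} \<Longrightarrow> V x0 \<le> V x"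
    using continuous_attains_inf[of "{-R..R}" V] R continuous_on_subset[OF V_cont] by auto
  then show ?thesis using V_pos[of x0] by (intro exI[of _ "V x0"]) (auto simp: abs_le_iff)
qed

lemma IA_bounded: "\<exists>C. \<forall>t\<ge>0. IA t \<le> C"
proof -
  obtain c where c: "c > 0" "\<And>x. \<bar>x\<bar> \<le> R \<Longrightarrow> c \<le> V x" using V_lower by auto
  let ?i = "indicator {-R..R} :: real \<Rightarrow> real"
  have i: "bmeas ?i" by (rule bmeas_indicator) simp
  \<comment> \<open>The source lives where the initial data live, and there \<open>c\<close> bounds
    \<open>V\<close> from below.\<close>
  have g0: "multop ?i g0 = g0"
    using supp[of 0] by (intro supported_cutoff) (auto simp: g0_def v_def intro!: supported_add supported_mult bmeas_a)
  \<comment> \<open>The energy of \<open>Uint\<close>, corrected by the work of the source and by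
    the accumulated dissipation. Its derivative is the integrated equation tested with
    \<open>u t\<close>.\<close>
  define J where "J t = (norm (u t))\<^sup>2 / 2 + (norm (Dint t))\<^sup>2 / 2 + inner (multop V (Uint t)) (Uint t) / 2 - inner (Uint t) g0 + IA t" for t
  have J: "J t = J 0" if t: "t \<ge> 0" for t
  proof (rule const_atLeast[OF _ t])
    fix t :: real assume t: "t \<ge> 0"
    have "(J has_real_derivative 2 * inner (u t) (v t) / 2 + 2 * inner (Dint t) (d t) / 2
        + 2 * inner (multop V (Uint t)) (u t) / 2 - inner (u t) g0 + A t) (at t within {0..})"
      unfolding J_def
      by (intro DERIV_add DERIV_diff DERIV_cdivide norm_sq_deriv mult_quadratic_deriv inner_const_deriv
          IA_deriv Uint_deriv Dint_deriv u_deriv bmeas_V t)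
    moreover have "2 * inner (u t) (v t) / 2 + 2 * inner (Dint t) (d t) / 2
        + 2 * inner (multop V (Uint t)) (u t) / 2 - inner (u t) g0 + A t = 0"
      using integrated_equation[OF t weak_pair_u_d[OF t]] by (simp add: A_def inner_commute[of "u t"])
    ultimately show "(J has_vector_derivative 0) (at t within {0..})"
      by (simp only: has_real_derivative_iff_has_vector_derivative)
  qed
  have "IA t \<le> (norm (u 0))\<^sup>2 / 2 + (norm g0)\<^sup>2 / (2 * c)" if t: "t \<ge> 0" for t
  proof -
    \<comment> \<open>\<open>Uint\<close> may spread beyond |x| <= R, but only its part there meets
      \<open>g0\<close>. The weight \<open>c\<close> makes that part cost no more than the potential
      term of \<open>J\<close>.\<close>
    have "inner (Uint t) g0 = inner g0 (multop ?i (Uint t))"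
      using g0 inner_mult_commute[OF i, of g0 "Uint t"] by (simp add: inner_commute)
    also have "\<dots> \<le> (norm g0)\<^sup>2 / (2 * c) + c * (norm (multop ?i (Uint t)))\<^sup>2 / 2"
      using inner_le_weighted_squares[OF c(1), of g0 "multop ?i (Uint t)"] by linarith
    also have "c * (norm (multop ?i (Uint t)))\<^sup>2 \<le> inner (multop V (Uint t)) (Uint t)"
      using V_pos c by (intro inner_mult_cutoff_ge bmeas_V) (auto intro: less_imp_le)
    finally have "inner (Uint t) g0 \<le> (norm g0)\<^sup>2 / (2 * c) + inner (multop V (Uint t)) (Uint t) / 2"
      by simp
    moreover have "J 0 = (norm (u 0))\<^sup>2 / 2"
      by (simp add: J_def Uint_def Dint_def IA_def mult_linear_simps bmeas_V)
    moreover have "0 \<le> (norm (u t))\<^sup>2 / 2" "0 \<le> (norm (Dint t))\<^sup>2 / 2" by auto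
    ultimately show ?thesis using J[OF t] unfolding J_def by linarith
  qed
  then show ?thesis by blast
qed

section \<open>The weighted energy functional\<close>

definition "N t = inner (v t) (u t)"

text \<open>The multiplier \<open>u\<close>: the derivative of (u_t, u) is |u_t|^2 - |u_x|^2 - (V u,
  u) - (a u_t, u). The last term is minus the derivative of (a u, u)/2, which is why
  \<open>A s / 2\<close> is added; the rest equals 2 |u_t|^2 - 2 E.\<close>

lemma NA_deriv:
  assumes t: "t \<ge> 0"
  shows "((\<lambda>s. N s + A s / 2) has_real_derivative 2 * (norm (v t))\<^sup>2 - 2 * en t) (at t within {0..})"
proof -
  have "((\<lambda>s. N s + A s / 2) has_real_derivative
      (inner (force (u t) (v t)) (u t) - inner (d t) (d t) + inner (v t) (v t)) + 2 * inner (multop a (u t)) (v t) / 2) (at t within {0..})"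
    unfolding N_def A_def
    by (intro DERIV_add DERIV_cdivide inner_weak_product mult_quadratic_deriv bmeas_a u_deriv t v_weak_deriv weak_pair_u_d)
       (use continuous_on_u_v_d(2) t in \<open>simp add: continuous_on_def\<close>)
  moreover have "(inner (force (u t) (v t)) (u t) - inner (d t) (d t) + inner (v t) (v t)) + 2 * inner (multop a (u t)) (v t) / 2
      = 2 * (norm (v t))\<^sup>2 - 2 * en t"
    using inner_mult_commute[OF bmeas_a, of "u t" "v t"]
    by (simp add: force_def inner_diff_left en_eq W_def power2_norm_eq_inner add_divide_distrib inner_commute[of "u t"])
  ultimately show ?thesis by simp
qed

definition "lam t = a1 / (1 + R + t) powr \<alpha>"

lemma damping_lower:
  assumes "t \<ge> 0" "supported (R + t) f"
  shows "lam t * (norm f)\<^sup>2 \<le> inner (multop a f) f"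
proof (rule inner_mult_supported_ge[OF bmeas_a assms(2)])
  fix x :: real assume x: "\<bar>x\<bar> \<le> R + t"
  have "lam t \<le> a1 / (1 + \<bar>x\<bar>) powr \<alpha>"
    unfolding lam_def using x a1 alpha R assms
    by (intro divide_left_mono powr_mono2 mult_pos_pos) auto
  then show "lam t \<le> a x" using a_lower[of x] by linarith
qed

lemma lam_pos: "t \<ge> 0 \<Longrightarrow> 0 < lam t"
  using a1 R by (simp add: lam_def)

text \<open>The product is \<open>a1\<close> times the power 1 - \<open>\<alpha>\<close> of 1 + R +
  t, hence unbounded as \<open>\<alpha> < 1\<close>. Of the value 3, two units will pay for 2 tau
  |u_t|^2 in the derivative of the functional and less than one more for \<open>N\<close>.\<close>

lemma lam_tau: "\<exists>T\<ge>0. \<forall>t\<ge>T. 3 \<le> lam t * (1 + R + t)"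
proof -
  \<comment> \<open>This \<open>T\<close> solves a1 T^(1 - \<alpha>) = 3, and passing from
    \<open>T\<close> to 1 + R + t only increases the power.\<close>
  define T where "T = (3 / a1) powr (1 / (1 - \<alpha>))"
  have "3 \<le> lam t * (1 + R + t)" if t: "t \<ge> T" for t
  proof -
    have T0: "0 \<le> T" by (simp add: T_def)
    have "3 / a1 = T powr (1 - \<alpha>)" using alpha a1 by (simp add: T_def powr_powr)
    also have "\<dots> \<le> (1 + R + t) powr (1 - \<alpha>)"
      using alpha R T0 t by (intro powr_mono2) auto
    also have "\<dots> = (1 + R + t) / (1 + R + t) powr \<alpha>"
      using R T0 t by (simp add: powr_diff)
    finally show ?thesis using a1 by (simp add: lam_def field_simps)
  qed
  then show ?thesis by (intro exI[of _ T]) (simp add: T_def)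
qed

text \<open>Weighting by \<open>lam t\<close> lets the damping bound absorb the square of
  \<open>u\<close> into (a u, u)/2, at the price of 1 / lam in front of |u_t|^2.\<close>

lemma N_bound:
  assumes t: "t \<ge> 0"
  shows "\<bar>N t\<bar> \<le> A t / 2 + (norm (v t))\<^sup>2 / (2 * lam t)"
  using inner_le_weighted_squares[OF lam_pos[OF t], of "v t" "u t"] damping_lower[OF t supp(1)[OF t]]
  by (simp add: N_def A_def)

lemma energy_decay: "\<exists>C T. \<forall>t\<ge>T. t\<^sup>2 * en t \<le> C"
proof -
  obtain T where T: "T \<ge> 0" "\<And>t. t \<ge> T \<Longrightarrow> 3 \<le> lam t * (1 + R + t)" using lam_tau by blast
  obtain C where C: "\<And>t. t \<ge> 0 \<Longrightarrow> IA t \<le> C" using IA_bounded by blast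
  define H where "H t = (1 + R + t)\<^sup>2 * en t + (1 + R + t) * (N t + A t / 2)" for t
  \<comment> \<open>The derivative of \<open>H\<close> after cancellation: 2 tau E from the factor
    tau^2 meets - 2 tau E from \<open>NA_deriv\<close>.\<close>
  define H' where "H' t = 2 * (1 + R + t) * (norm (v t))\<^sup>2 - (1 + R + t)\<^sup>2 * inner (multop a (v t)) (v t) + N t + A t / 2" for t
  have H_deriv: "(H has_real_derivative H' t) (at t within {0..})" if t: "t \<ge> 0" for t
  proof -
    have en': "(en has_real_derivative - inner (multop a (v t)) (v t)) (at t within {0..})"
      using char_energy_deriv[OF m t] by (simp add: en_def[abs_def] v_def)
    have "(H has_real_derivative
        (2 * (1 + R + t) * en t + - inner (multop a (v t)) (v t) * (1 + R + t)\<^sup>2)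
        + (1 * (N t + A t / 2) + (2 * (norm (v t))\<^sup>2 - 2 * en t) * (1 + R + t))) (at t within {0..})"
      unfolding H_def
      by (intro DERIV_add DERIV_mult en' NA_deriv[OF t]) (auto intro!: derivative_eq_intros)
    then show ?thesis by (simp add: H'_def algebra_simps)
  qed
  have est: "1 / lam t \<le> (1 + R + t) / 3" if t: "t \<ge> T" for t
    using T(1) T(2)[OF t] t lam_pos[of t] by (simp add: field_simps)
  have H'_le: "H' t \<le> A t" if t: "t \<ge> T" for t
  proof -
    define \<tau> n where "\<tau> = 1 + R + t" and "n = (norm (v t))\<^sup>2"
    have t0: "t \<ge> 0" using T t by simp
    have \<tau>: "\<tau> > 0" "3 \<le> lam t * \<tau>" "1 / lam t \<le> \<tau> / 3" using T(2)[OF t] est[OF t] t0 R by (auto simp: \<tau>_def)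
    have n: "n \<ge> 0" by (simp add: n_def)
    have "3 * \<tau> * n \<le> \<tau>\<^sup>2 * (lam t * n)"
      using mult_right_mono[OF \<tau>(2), of "\<tau> * n"] \<tau>(1) n by (simp add: power2_eq_square mult_ac)
    also have "\<dots> \<le> \<tau>\<^sup>2 * inner (multop a (v t)) (v t)"
      unfolding n_def v_def by (intro mult_left_mono damping_lower t0 supp) auto
    finally have 1: "3 * (\<tau> * n) \<le> \<tau>\<^sup>2 * inner (multop a (v t)) (v t)" by simp
    have "n / (2 * lam t) = (1 / lam t) * n / 2" by simp
    also have "\<dots> \<le> (\<tau> / 3) * n / 2" using \<tau>(3) n by (intro divide_right_mono mult_right_mono) auto
    finally have 2: "n / (2 * lam t) \<le> (\<tau> * n) / 6" by simp
    have "0 \<le> \<tau> * n" using \<tau>(1) n by simp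
    \<comment> \<open>The coefficients of tau |u_t|^2 add up to 2 - 3 + 1/6 < 0. What remains is A/2
      from the bound for \<open>N\<close> and A/2 from \<open>H'\<close> itself.\<close>
    then show ?thesis using 1 2 N_bound[OF t0]
      unfolding H'_def \<tau>_def[symmetric] n_def[symmetric] by (simp add: mult.assoc abs_le_iff)
  qed
  have H_ge: "(1 + R + t)\<^sup>2 * en t / 2 \<le> H t" if t: "t \<ge> T" for t
  proof -
    define \<tau> n where "\<tau> = 1 + R + t" and "n = (norm (v t))\<^sup>2"
    have t0: "t \<ge> 0" using T t by simp
    have \<tau>: "\<tau> > 0" "1 / lam t \<le> \<tau> / 3" using est[OF t] t0 R by (auto simp: \<tau>_def)
    have n: "0 \<le> n" "n \<le> 2 * en t" using W_nonneg[of t] by (auto simp: n_def en_eq)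
    have "- (n / (2 * lam t)) \<le> N t + A t / 2"
      using N_bound[OF t0] by (simp add: n_def abs_le_iff)
    then have "\<tau> * (- (n / (2 * lam t))) \<le> \<tau> * (N t + A t / 2)"
      using \<tau>(1) by (intro mult_left_mono) auto
    \<comment> \<open>At most one third of tau^2 E is lost, less than the half that may be.\<close>
    moreover have "\<tau> * (n / (2 * lam t)) \<le> \<tau>\<^sup>2 * en t / 3"
    proof -
      have "\<tau> * (n / (2 * lam t)) = \<tau> * ((1 / lam t) * n / 2)" by simp
      also have "\<dots> \<le> \<tau> * ((\<tau> / 3) * (2 * en t) / 2)"
        using \<tau> n lam_pos[OF t0] by (intro mult_left_mono divide_right_mono mult_mono) auto
      finally show ?thesis by (simp add: power2_eq_square)
    qed
    moreover have "0 \<le> \<tau>\<^sup>2 * en t" using n by simp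
    ultimately show ?thesis unfolding H_def \<tau>_def[symmetric] by simp
  qed
  have "t\<^sup>2 * en t \<le> 2 * (H T - IA T + C)" if t: "t \<ge> T" for t
  proof -
    \<comment> \<open>The bound for \<open>H'\<close> holds from \<open>T\<close> on, so the
      comparison starts at \<open>T\<close> and not at 0.\<close>
    have "H t - IA t \<le> H T - IA T"
    proof (rule deriv_nonpos_le[OF T(1) t])
      fix x assume x: "T \<le> x" "x \<le> t"
      show "((\<lambda>t. H t - IA t) has_real_derivative H' x - A x) (at x within {0..})"
        using x T by (intro DERIV_diff H_deriv IA_deriv) auto
      show "H' x - A x \<le> 0" using H'_le[OF x(1)] by simp
    qed
    moreover have "IA t \<le> C" using C T t by simp
    ultimately have "(1 + R + t)\<^sup>2 * en t \<le> 2 * (H T - IA T + C)" using H_ge[OF t] by argo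
    moreover have "t\<^sup>2 * en t \<le> (1 + R + t)\<^sup>2 * en t"
      using R T t W_nonneg[of t] by (intro mult_right_mono power_mono) (auto simp: en_eq)
    ultimately show ?thesis by linarith
  qed
  then show ?thesis by blast
qed

end

text \<open>The link to \<open>energy\<close>: \<open>wderiv\<close> may return any representative,
  but its norm is that of the class \<open>half_diff (p t) (q t)\<close>.\<close>

lemma (in damped_wave) energy_rep:
  assumes V: "\<And>x. 0 \<le> V x" and w: "weak_pair (u t) (half_diff (p t) (q t))"
  shows "energy V (\<lambda>t. rep_lsq (u t)) (\<lambda>t. rep_lsq (avg (p t) (q t))) t = char_energy (u t) (p t) (q t)"
proof -
  have "(L2norm (\<lambda>x. sqrt (V x) * rep_lsq (u t) x))\<^sup>2 = (LINT x|lborel. (sqrt (V x) * rep_lsq (u t) x)\<^sup>2)"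
    unfolding L2norm_def by (intro real_sqrt_pow2 integral_nonneg_AE) simp
  also have "\<dots> = (LINT x|lborel. V x * rep_lsq (u t) x * rep_lsq (u t) x)"
    using V by (simp add: power_mult_distrib) (simp add: power2_eq_square mult.assoc)
  also have "\<dots> = inner (multop V (u t)) (u t)" by (simp add: inner_mult_left bmeas_V)
  finally have "(L2norm (\<lambda>x. sqrt (V x) * rep_lsq (u t) x))\<^sup>2 = inner (multop V (u t)) (u t)" .
  moreover have "L2norm (wderiv (rep_lsq (u t))) = norm (half_diff (p t) (q t))"
    using norm_abs_lsq[OF wderiv_weak_pair(1)[OF H1_rep(1)[OF w]]] H1_rep(2)[OF w] by simp
  ultimately show ?thesis by (simp add: energy_def char_energy_eq norm_rep_lsq)
qed

theorem theorem1p1: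
  fixes \<alpha> a1 a2 R :: real and a V V' u0 u1 :: "real \<Rightarrow> real"
  assumes "0 \<le> \<alpha>" "\<alpha> < 1"
    and "continuous_on UNIV a"
    and "a1 > 0" "a2 > 0"
    and "\<And>x. a1 / (1 + \<bar>x\<bar>) powr \<alpha> \<le> a x \<and> a x \<le> a2 / (1 + \<bar>x\<bar>) powr \<alpha>"
    and "\<And>x. (V has_real_derivative V' x) (at x)" "continuous_on UNIV V'"
    and "bounded (range V)"
    and "\<And>x. V x > 0" "\<And>x. x * V' x \<le> 0"
    and "R > 0"
    and "H1 u0" "L2 u1"
    and "AE x in lborel. \<bar>x\<bar> > R \<longrightarrow> u0 x = 0"
    and "AE x in lborel. \<bar>x\<bar> > R \<longrightarrow> u1 x = 0"
  shows "\<exists>u v. weak_solution a V u0 u1 u v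
           \<and> (\<forall>w z. weak_solution a V u0 u1 w z \<longrightarrow> (\<forall>t\<ge>0. AE x in lborel. w t x = u t x))
           \<and> (\<forall>t\<ge>0. AE x in lborel. \<bar>x\<bar> > R + t \<longrightarrow> u t x = 0)
           \<and> (\<lambda>t. energy V u v t) \<in> O[at_top](\<lambda>t. 1 / t\<^sup>2)"
proof -
  have a_pos: "0 < a x" and a_le: "a x \<le> a2" for x
  proof -
    have one: "1 \<le> (1 + \<bar>x\<bar>) powr \<alpha>" using assms(1) by (intro ge_one_powr_ge_zero) auto
    then have "0 < a1 / (1 + \<bar>x\<bar>) powr \<alpha>" using assms(4) by simp
    then show "0 < a x" using assms(6)[of x] by linarith
    have "a2 / (1 + \<bar>x\<bar>) powr \<alpha> \<le> a2 / 1" using one assms(5) by (intro divide_left_mono) auto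
    then show "a x \<le> a2" using assms(6)[of x] by simp
  qed
  have V_cont: "continuous_on UNIV V"
    using assms(7) by (auto intro!: DERIV_continuous_on simp: has_field_derivative_at_within)
  have "bmeas a"
    using a_pos a_le assms(3)
    by (intro bmeasI[where B=a2] borel_measurable_continuous_onI) (auto simp: abs_of_pos)
  moreover have "bmeas V"
    using V_cont assms(9) by (auto simp: bmeas_def intro: borel_measurable_continuous_onI)
  ultimately interpret damped_wave a V by unfold_locales
  define g where "g = abs_lsq (wderiv u0)"
  have L2u0: "L2 u0" using assms(13) by (simp add: H1_def)
  have g: "weak_pair (abs_lsq u0) g" unfolding g_def by (rule wderiv_weak_pair[OF assms(13)])
  have sup: "supported R (abs_lsq f)" if "L2 f" "AE x in lborel. \<bar>x\<bar> > R \<longrightarrow> f x = 0" for f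
    unfolding supported_def using that(2) rep_lsq_abs[OF that(1)] by eventually_elim simp
  have su0: "supported R (abs_lsq u0)" and su1: "supported R (abs_lsq u1)"
    using sup[OF L2u0 assms(15)] sup[OF assms(14) assms(16)] .
  have sg: "supported R g" by (rule weak_pair_supported[OF g su0])
  \<comment> \<open>The initial invariants are u_1 + u_0' and u_1 - u_0'; their support includes
    that of the weak derivative \<open>g\<close>.\<close>
  obtain u p q where m: "mild u p q" and init: "u 0 = abs_lsq u0" "p 0 = abs_lsq u1 + g" "q 0 = abs_lsq u1 - g"
    and supp: "\<And>t. t \<ge> 0 \<Longrightarrow> supported (R + t) (u t)" "\<And>t. t \<ge> 0 \<Longrightarrow> supported (R + t) (avg (p t) (q t))"
    using mild_exists[OF su0 supported_add[OF su1 sg] supported_diff[OF su1 sg]] by blast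
  have avg0: "avg (p 0) (q 0) = abs_lsq u1" and diff0: "half_diff (p 0) (q 0) = g"
    by (simp_all add: init avg_def half_diff_def scaleR_2[symmetric])
  have w0: "weak_pair (u 0) (half_diff (p 0) (q 0))" using g by (simp only: init(1) diff0)
  interpret decaying_damped_wave a V \<alpha> a1 R u p q
    using assms V_cont m w0 supp by unfold_locales auto
  let ?u = "\<lambda>t. rep_lsq (u t)" and ?v = "\<lambda>t. rep_lsq (avg (p t) (q t))"
  have "weak_solution a V u0 u1 ?u ?v"
    by (rule mild_imp_weak_solution[OF m w0 L2u0 assms(14) init(1) avg0])
  moreover have "AE x in lborel. w t x = rep_lsq (u t) x"
    if sol: "weak_solution a V u0 u1 w z" and t: "t \<ge> 0" for w z t
  proof -
    obtain p' q' where m': "mild (\<lambda>t. abs_lsq (w t)) p' q'"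
      and init': "abs_lsq (w 0) = abs_lsq u0" "p' 0 = abs_lsq u1 + g" "q' 0 = abs_lsq u1 - g"
      using weak_solution_imp_mild[OF sol L2u0 assms(14) g] by blast
    \<comment> \<open>Both solutions start from the same class and the same two invariants.\<close>
    have "abs_lsq (w t) = u t"
      by (rule mild_unique[OF m' m _ _ _ a_nonneg _ t])
         (use init init' assms(10) in \<open>auto intro: less_imp_le\<close>)
    moreover have "L2 (w t)" using sol t by (simp add: weak_solution_def C1_L2_with_def)
    ultimately show ?thesis using rep_lsq_abs[of "w t"] by (auto elim: eventually_mono)
  qed
  moreover have "AE x in lborel. \<bar>x\<bar> > R + t \<longrightarrow> rep_lsq (u t) x = 0" if "t \<ge> 0" for t
    using supp(1)[OF that] by (simp add: supported_def)
  moreover have "(\<lambda>t. energy V ?u ?v t) \<in> O[at_top](\<lambda>t. 1 / t\<^sup>2)"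
  proof -
    obtain C T where C: "\<And>t. t \<ge> T \<Longrightarrow> t\<^sup>2 * en t \<le> C" using energy_decay by blast
    show ?thesis
    proof (rule bigoI)
      show "\<forall>\<^sub>F t in at_top. norm (energy V ?u ?v t) \<le> C * norm (1 / t\<^sup>2)"
        \<comment> \<open>\<open>t > 0\<close> allows the division by t^2, as 1 / 0 = 0 in
          HOL.\<close>
        using eventually_ge_at_top[of T] eventually_gt_at_top[of 0]
      proof eventually_elim
        case (elim t)
        have "energy V ?u ?v t = en t"
          unfolding en_def using elim assms(10) weak_pair_u_d[of t, unfolded d_def]
          by (intro energy_rep) (auto intro: less_imp_le)
        moreover have "0 \<le> en t" using W_nonneg by (simp add: en_eq)
        ultimately show ?case using C[OF elim(1)] elim by (simp add: field_simps)
      qed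
    qed
  qed
  ultimately show ?thesis by blast
qed

end
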